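(* Fix integers $d_1,d_2\ge1$, $s>0$ and $L>0$. There is a constant $C(s,d_1,d_2,L)>0$ such that for all integers $n\ge4$, all $\alpha\in(0,1)$, $\beta\in(0,1-\alpha)$ and all $$\epsilon_n\ \ge\ \frac{C(s,d_1,d_2,L)}{\alpha^{1/4}\beta^{1/2}}\Big(\frac1n\Big)^{\frac{2s}{4s+d_1+d_2}},$$ the following holds. For testing $\mathcal{P}_0=\{P_{YZ}\in\mathcal{P}^{(d_1+d_2,s)}_{\text{Hölder}}:f_{YZ}=f_Yf_Z\}$ against $\mathcal{P}_1=\{P_{YZ}\in\mathcal{P}^{(d_1+d_2,s)}_{\text{Hölder}}:\|f_{YZ}-f_Yf_Z\|_{L_2}\ge\epsilon_n\}$, the permutation test based on the binned $U$-statistic $U_n$ described in the context, with bins of side length $1/\kappa_{(2)}$, $\kappa_{(2)}=\lfloor n^{2/(4s+d_1+d_2)}\rfloor$, satisfies $$\sup_{P\in\mathcal{P}_0}\mathbb{P}_P(U_n>c_{1-\alpha,n})\le\alpha\quad\text{and}\quad\sup_{P\in\mathcal{P}_1}\mathbb{P}_P(U_n\le c_{1-\alpha,n})\le\beta .$$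
   Context: Hölder class: $\mathcal{H}^{d_1+d_2}_s(L)$ is the class of functions $f:[0,1]^{d_1+d_2}\to\mathbb{R}$ with (1) $|f^{(\lfloor s\rfloor)}(x)-f^{(\lfloor s\rfloor)}(x')|\le L\|x-x'\|^{s-\lfloor s\rfloor}$ for all $x,x'$, and (2) $\|f^{(s')}\|_\infty\le L$ for each $s'\in\{1,\dots,\lfloor s\rfloor\}$, where $f^{(k)}$ denotes the $k$-th order derivative (the array of all order-$k$ partial derivatives). $\mathcal{P}^{(d_1+d_2,s)}_{\text{Hölder}}$ is the set of joint distributions $P_{YZ}$ of $(Y,Z)\in[0,1]^{d_1}\times[0,1]^{d_2}$ such that both the joint Lebesgue density $f_{YZ}$ and the product of marginal densities $f_Yf_Z$ belong to $\mathcal{H}^{d_1+d_2}_s(L)$. $\|f\|_{L_2}^2=\int f^2$. Data: $(Y_1,Z_1),\dots,(Y_n,Z_n)$ i.i.d. from $P_{YZ}$. Binned statistic: partition $[0,1]^{d_1}$ and $[0,1]^{d_2}$ into hypercubes of side length $\kappa_{(2)}^{-1}$ ($\kappa_{(2)}^{d_1}$ and $\kappa_{(2)}^{d_2}$ of them, respectively), and replace each $Y_i$, $Z_i$ by the index of the hypercube containing it. Let $g_Y(y_1,y_2)=1$ if $y_1,y_2$ are in the same hypercube of $[0,1]^{d_1}$ and $0$ otherwise; $g_Z$ similarly on $[0,1]^{d_2}$. For $x_i=(y_i,z_i)$, $$h_{\rm in}(x_1,x_2,x_3,x_4):=\{g_Y(y_1,y_2)+g_Y(y_3,y_4)-g_Y(y_1,y_3)-g_Y(y_2,y_4)\}\cdot\{g_Z(z_1,z_2)+g_Z(z_3,z_4)-g_Z(z_1,z_3)-g_Z(z_2,z_4)\},$$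 and $U_n$ is the average of $h_{\rm in}(X_{i_1},X_{i_2},X_{i_3},X_{i_4})$, $X_i=(Y_i,Z_i)$, over all ordered 4-tuples of distinct indices in $\{1,\dots,n\}$. Permutation critical value: for a permutation $\pi$ of $\{1,\dots,n\}$, $U_n^\pi$ is $U_n$ computed from $(Y_1,Z_{\pi_1}),\dots,(Y_n,Z_{\pi_n})$, and $c_{1-\alpha,n}:=\inf\{t:\frac1{n!}\sum_\pi\mathbb{1}(U_n^\pi\le t)\ge1-\alpha\}$; the test rejects when $U_n>c_{1-\alpha,n}$. *)

theory Defs
  imports "HOL-Probability.Probability" "HOL-Combinatorics.Permutations"
begin

subsection \<open>Hoelder classes on the unit cube\<close>

abbreviation unit_cube :: "'a::euclidean_space set" where
  "unit_cube \<equiv> cbox 0 One"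

text \<open>For \<open>x\<close> in the cube and \<open>b \<in> Basis\<close>, the point \<open>x + (t - x \<bullet> b) *\<^sub>R b\<close> is \<open>x\<close> with its
  \<open>b\<close>-coordinate replaced by \<open>t\<close>; the derivative is one-sided on the boundary of the cube, so
  only values of \<open>f\<close> on the cube matter.\<close>

definition coord_line :: "'a::euclidean_space \<Rightarrow> 'a \<Rightarrow> ('a \<Rightarrow> real) \<Rightarrow> real \<Rightarrow> real" where
  "coord_line b x f = (\<lambda>t. f (x + (t - x \<bullet> b) *\<^sub>R b))"

definition partial_differentiable :: "'a::euclidean_space \<Rightarrow> ('a \<Rightarrow> real) \<Rightarrow> bool" where
  "partial_differentiable b f \<longleftrightarrow>
     (\<forall>x\<in>unit_cube. coord_line b x f differentiable (at (x \<bullet> b) within {0..1}))"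

definition partial_deriv :: "'a::euclidean_space \<Rightarrow> ('a \<Rightarrow> real) \<Rightarrow> 'a \<Rightarrow> real" where
  "partial_deriv b f x = vector_derivative (coord_line b x f) (at (x \<bullet> b) within {0..1})"

primrec iter_partial :: "'a::euclidean_space list \<Rightarrow> ('a \<Rightarrow> real) \<Rightarrow> 'a \<Rightarrow> real" where
  "iter_partial [] f = f"
| "iter_partial (b # bs) f = partial_deriv b (iter_partial bs f)"

text \<open>The array \<open>f\<^sup>(\<^sup>k\<^sup>)(x)\<close> has the entries \<open>iter_partial bs f x\<close>, where \<open>bs\<close> ranges over the
  sequences of \<open>k\<close> basis vectors. Arrays are measured in the Euclidean norm.\<close>

definition multi_index :: "nat \<Rightarrow> 'a::euclidean_space list set" where
  "multi_index k = {bs. set bs \<subseteq> Basis \<and> length bs = k}"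

definition times_differentiable :: "nat \<Rightarrow> ('a::euclidean_space \<Rightarrow> real) \<Rightarrow> bool" where
  "times_differentiable k f \<longleftrightarrow>
     (\<forall>j<k. \<forall>bs\<in>multi_index j. \<forall>b\<in>Basis. partial_differentiable b (iter_partial bs f))"

definition holder_class :: "real \<Rightarrow> real \<Rightarrow> ('a::euclidean_space \<Rightarrow> real) set" where
  "holder_class s L = {f. let m = nat \<lfloor>s\<rfloor> in
     times_differentiable m f \<and>
     (\<forall>x\<in>unit_cube. \<forall>x'\<in>unit_cube.
        L2_set (\<lambda>bs. iter_partial bs f x - iter_partial bs f x') (multi_index m)
          \<le> L * norm (x - x') powr (s - real m)) \<and>
     (\<forall>k\<in>{1..m}. \<forall>x\<in>unit_cube. L2_set (\<lambda>bs. iter_partial bs f x) (multi_index k) \<le> L)}"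

subsection \<open>The classes of distributions\<close>

definition joint_density ::
  "('a::euclidean_space \<times> 'b::euclidean_space) measure \<Rightarrow> ('a \<times> 'b \<Rightarrow> real) \<Rightarrow> bool" where
  "joint_density P f \<longleftrightarrow> prob_space P \<and> f \<in> borel_measurable borel \<and> (\<forall>x. 0 \<le> f x) \<and>
     (\<forall>x. x \<notin> unit_cube \<longrightarrow> f x = 0) \<and> P = density lborel (\<lambda>x. ennreal (f x))"

definition marginal_Y :: "('a::euclidean_space \<times> 'b::euclidean_space \<Rightarrow> real) \<Rightarrow> 'a \<Rightarrow> real" where
  "marginal_Y f y = (LINT z|lborel. f (y, z))"

definition marginal_Z :: "('a::euclidean_space \<times> 'b::euclidean_space \<Rightarrow> real) \<Rightarrow> 'b \<Rightarrow> real" where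
  "marginal_Z f z = (LINT y|lborel. f (y, z))"

definition marginal_product ::
  "('a::euclidean_space \<times> 'b::euclidean_space \<Rightarrow> real) \<Rightarrow> 'a \<times> 'b \<Rightarrow> real" where
  "marginal_product f = (\<lambda>(y, z). marginal_Y f y * marginal_Z f z)"

definition holder_distributions ::
  "real \<Rightarrow> real \<Rightarrow> ('a::euclidean_space \<times> 'b::euclidean_space) measure set" where
  "holder_distributions s L =
     {P. \<exists>f. joint_density P f \<and> f \<in> holder_class s L \<and> marginal_product f \<in> holder_class s L}"

definition L2_norm :: "('a::euclidean_space \<Rightarrow> real) \<Rightarrow> real" where
  "L2_norm f = sqrt (LINT x|lborel. (f x)\<^sup>2)"

text \<open>Densities are determined up to null sets; neither condition below depends on the version,
  in the sense that some version satisfies it iff the corresponding almost-everywhere (respectively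
  \<open>L\<^sub>2\<close>) statement holds.\<close>

definition null_distributions ::
  "real \<Rightarrow> real \<Rightarrow> ('a::euclidean_space \<times> 'b::euclidean_space) measure set" where
  "null_distributions s L =
     {P \<in> holder_distributions s L. \<exists>f. joint_density P f \<and> f = marginal_product f}"

definition alt_distributions ::
  "real \<Rightarrow> real \<Rightarrow> real \<Rightarrow> ('a::euclidean_space \<times> 'b::euclidean_space) measure set" where
  "alt_distributions s L \<epsilon> =
     {P \<in> holder_distributions s L.
        \<exists>f. joint_density P f \<and> L2_norm (\<lambda>x. f x - marginal_product f x) \<ge> \<epsilon>}"

subsection \<open>The binned U-statistic and its permutation test\<close>

text \<open>Bins are half-open, except that coordinates equal to 1 are put into the last of the \<open>\<kappa>\<close>
  intervals; hence exactly \<open>\<kappa> ^ CARD('d)\<close> bins cover the unit cube.\<close>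

definition bin_index :: "nat \<Rightarrow> real ^ 'd \<Rightarrow> 'd \<Rightarrow> int" where
  "bin_index \<kappa> y = (\<lambda>i. min \<lfloor>real \<kappa> * y $ i\<rfloor> (int \<kappa> - 1))"

definition same_bin :: "nat \<Rightarrow> real ^ 'd \<Rightarrow> real ^ 'd \<Rightarrow> real" where
  "same_bin \<kappa> y y' = (if bin_index \<kappa> y = bin_index \<kappa> y' then 1 else 0)"

definition h_in :: "nat \<Rightarrow> (real ^ 'd1) \<times> (real ^ 'd2) \<Rightarrow> (real ^ 'd1) \<times> (real ^ 'd2) \<Rightarrow>
    (real ^ 'd1) \<times> (real ^ 'd2) \<Rightarrow> (real ^ 'd1) \<times> (real ^ 'd2) \<Rightarrow> real" where
  "h_in \<kappa> x1 x2 x3 x4 =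
     (same_bin \<kappa> (fst x1) (fst x2) + same_bin \<kappa> (fst x3) (fst x4)
        - same_bin \<kappa> (fst x1) (fst x3) - same_bin \<kappa> (fst x2) (fst x4)) *
     (same_bin \<kappa> (snd x1) (snd x2) + same_bin \<kappa> (snd x3) (snd x4)
        - same_bin \<kappa> (snd x1) (snd x3) - same_bin \<kappa> (snd x2) (snd x4))"

definition distinct_quads :: "nat \<Rightarrow> (nat \<times> nat \<times> nat \<times> nat) set" where
  "distinct_quads n = {(i, j, k, l). {i, j, k, l} \<subseteq> {1..n} \<and> distinct [i, j, k, l]}"

definition U_stat :: "nat \<Rightarrow> nat \<Rightarrow> (nat \<Rightarrow> (real ^ 'd1) \<times> (real ^ 'd2)) \<Rightarrow> real" where
  "U_stat \<kappa> n X = (\<Sum>(i, j, k, l)\<in>distinct_quads n. h_in \<kappa> (X i) (X j) (X k) (X l))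
                     / real (card (distinct_quads n))"

definition U_perm ::
  "nat \<Rightarrow> nat \<Rightarrow> (nat \<Rightarrow> (real ^ 'd1) \<times> (real ^ 'd2)) \<Rightarrow> (nat \<Rightarrow> nat) \<Rightarrow> real" where
  "U_perm \<kappa> n X \<pi> = U_stat \<kappa> n (\<lambda>i. (fst (X i), snd (X (\<pi> i))))"

definition crit_value ::
  "nat \<Rightarrow> nat \<Rightarrow> real \<Rightarrow> (nat \<Rightarrow> (real ^ 'd1) \<times> (real ^ 'd2)) \<Rightarrow> real" where
  "crit_value \<kappa> n \<alpha> X =
     Inf {t. 1 / fact n * (\<Sum>\<pi> | \<pi> permutes {1..n}. if U_perm \<kappa> n X \<pi> \<le> t then 1 else 0) \<ge> 1 - \<alpha>}"

abbreviation iid_sample :: "nat \<Rightarrow> 'a measure \<Rightarrow> (nat \<Rightarrow> 'a) measure" where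
  "iid_sample n P \<equiv> Pi\<^sub>M {1..n} (\<lambda>_. P)"

definition prob_reject ::
  "nat \<Rightarrow> nat \<Rightarrow> real \<Rightarrow> ((real ^ 'd1) \<times> (real ^ 'd2)) measure \<Rightarrow> ennreal" where
  "prob_reject \<kappa> n \<alpha> P =
     emeasure (iid_sample n P) {X \<in> space (iid_sample n P). U_stat \<kappa> n X > crit_value \<kappa> n \<alpha> X}"

definition prob_accept ::
  "nat \<Rightarrow> nat \<Rightarrow> real \<Rightarrow> ((real ^ 'd1) \<times> (real ^ 'd2)) measure \<Rightarrow> ennreal" where
  "prob_accept \<kappa> n \<alpha> P =
     emeasure (iid_sample n P) {X \<in> space (iid_sample n P). U_stat \<kappa> n X \<le> crit_value \<kappa> n \<alpha> X}"

end

theory Submission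
  imports Defs "HOL-Computational_Algebra.Polynomial"
begin

text \<open>
  The statistic depends on the data only through the bin labels, so probabilities are finite sums over
  labels. With \<open>p\<close> the table of cell probabilities, \<open>dev = p - row \<cdot> col\<close> and \<open>\<theta> = \<Sum> dev\<^sup>2\<close>, the
  statistic has mean \<open>4\<theta>\<close>. For densities bounded by \<open>M\<close> and \<open>D = d\<^sub>1 + d\<^sub>2\<close>, the variance is of
  order \<open>M\<^sup>2 \<kappa>\<^sup>-\<^sup>D (\<theta> / n + 1 / n\<^sup>2)\<close>, and the permuted statistics have second moment of order
  \<open>M\<^sup>2 \<kappa>\<^sup>-\<^sup>D / n\<^sup>2\<close>: exchanging two partners flips the sign of the kernel, so only pairs of quadruples
  with two common indices contribute. Chebyshev's inequality, applied to the data and to the random permutation,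
  then bounds the probability of acceptance. Exchangeability gives the level.

  It remains to bound \<open>\<theta>\<close> from below. On \<open>K = \<lfloor>s\<rfloor> + 1\<close> consecutive bins a Hoelder function is within
  \<open>O(\<kappa>\<^sup>-\<^sup>s)\<close> of a polynomial of degree less than \<open>K\<close> along each coordinate, and such a polynomial is
  recovered from its averages over these \<open>K\<close> bins. Applying this coordinate by coordinate bounds
  \<open>\<parallel>f - f\<^sub>Y f\<^sub>Z\<parallel>\<^sup>2\<close> by a multiple of \<open>\<kappa>\<^sup>D \<theta> + \<kappa>\<^sup>-\<^sup>2\<^sup>s\<close>, also for \<open>s > 1\<close>.
\<close>

text \<open>Write N for \<kappa>^D. A square of the kernel costs one coincidence of Y-labels and one
  of Z-labels, together of probability at most \<open>a * b\<close>, of order 1/N, whichever indices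
  are involved. This factor is what makes the rate attainable: \<theta> is detected once n \<theta>
  exceeds a multiple of N^(-1/2), that is, once N \<theta> exceeds a multiple of N^(1/2)/n, and
  \<kappa> ~ n^(2/(4s+D)) is the choice for which this is of the order of the squared bias
  \<kappa>^(-2s). The powers of \<alpha> and \<beta> come from different terms. The permutation
  threshold stays below 2 \<theta> if the permuted second moment is at most a multiple of \<alpha>
  \<theta>^2, so \<theta> scales like \<alpha>^(-1/2), and \<epsilon>, of order (N \<theta>)^(1/2),
  like \<alpha>^(-1/4). The variance term of order 1/(N n \<theta>) has to be below \<beta>, which
  puts 1/\<beta> into \<epsilon>^2. Two obstacles lie in the classes. They bound derivatives but not
  the function, so the bound M has to come from the unit integral of the density. And smoothness,
  independence and separation may be witnessed by different versions of the density, which have to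
  be reconciled.\<close>

section \<open>Expectations over finitely many independent labels\<close>

definition sample_mean :: "'x set \<Rightarrow> ('x \<Rightarrow> real) \<Rightarrow> 'i set \<Rightarrow> (('i \<Rightarrow> 'x) \<Rightarrow> real) \<Rightarrow> real" where
  "sample_mean S w J F = (\<Sum>X\<in>PiE J (\<lambda>_. S). (\<Prod>i\<in>J. w (X i)) * F X)"

text \<open>Fubini for a finite product, with draw \<open>i\<close> averaged first. Every later
  evaluation of \<open>sample_mean\<close> peels off indices by this rule.\<close>

lemma sample_mean_insert:
  assumes "finite J" "i \<notin> J"
  shows "sample_mean S w (insert i J) F
    = sample_mean S w J (\<lambda>X. \<Sum>x\<in>S. w x * F (X(i := x)))"
proof -
  have "sample_mean S w (insert i J) F =
    (\<Sum>(x, X)\<in>S \<times> PiE J (\<lambda>_. S). (\<Prod>k\<in>insert i J. w ((X(i := x)) k)) * F (X(i := x)))"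
    unfolding sample_mean_def PiE_insert_eq
    by (subst sum.reindex) (use inj_combinator[of i J "\<lambda>_. S"] assms in \<open>simp_all add: case_prod_unfold\<close>)
  also have "\<dots> = (\<Sum>x\<in>S. \<Sum>X\<in>PiE J (\<lambda>_. S). (\<Prod>k\<in>J. w (X k)) * (w x * F (X(i := x))))"
    unfolding sum.cartesian_product[symmetric]
  proof (intro sum.cong refl)
    fix x X
    have "(\<Prod>k\<in>J. w ((X(i := x)) k)) = (\<Prod>k\<in>J. w (X k))"
      using assms(2) by (intro prod.cong) auto
    then show "(\<Prod>k\<in>insert i J. w ((X(i := x)) k)) * F (X(i := x)) = (\<Prod>k\<in>J. w (X k)) * (w x * F (X(i := x)))"
      using assms by simp
  qed
  finally show ?thesis
    unfolding sample_mean_def by (subst (asm) sum.swap) (simp add: sum_distrib_left)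
qed

lemma sample_mean_peel:
  assumes "finite J" "i \<in> J"
  shows "sample_mean S w J F = sample_mean S w (J - {i}) (\<lambda>X. \<Sum>x\<in>S. w x * F (X(i := x)))"
  using sample_mean_insert[of "J - {i}" i S w F] assms by (simp add: insert_absorb)

lemma sample_mean_add: "sample_mean S w J (\<lambda>X. F X + G X) = sample_mean S w J F + sample_mean S w J G"
  by (simp add: sample_mean_def algebra_simps sum.distrib)

lemma sample_mean_cmult: "sample_mean S w J (\<lambda>X. c * F X) = c * sample_mean S w J F"
  by (simp add: sample_mean_def sum_distrib_left mult_ac)

lemma sample_mean_sum: "sample_mean S w J (\<lambda>X. \<Sum>k\<in>I. F k X) = (\<Sum>k\<in>I. sample_mean S w J (F k))"
  by (simp add: sample_mean_def sum_distrib_left) (rule sum.swap)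

lemma sample_mean_mono:
  assumes "\<And>x. x \<in> S \<Longrightarrow> 0 \<le> w x" "\<And>X. X \<in> PiE J (\<lambda>_. S) \<Longrightarrow> F X \<le> G X"
  shows "sample_mean S w J F \<le> sample_mean S w J G"
  unfolding sample_mean_def
  by (intro sum_mono mult_left_mono prod_nonneg) (use assms in \<open>auto simp: PiE_iff\<close>)

lemma sample_mean_cong:
  assumes "\<And>X. X \<in> PiE J (\<lambda>_. S) \<Longrightarrow> F X = G X"
  shows "sample_mean S w J F = sample_mean S w J G"
  unfolding sample_mean_def using assms by (intro sum.cong) auto

lemma sample_mean_const:
  assumes "finite J" "sum w S = 1"
  shows "sample_mean S w J (\<lambda>_. c) = c"
  using assms
proof (induction J rule: finite_induct)
  case empty
  then show ?case by (simp add: sample_mean_def)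
next
  case (insert i J)
  then show ?case by (simp add: sample_mean_insert sum_distrib_right[symmetric])
qed

lemma sample_mean_one_index:
  assumes "finite J" "sum w S = 1" "i \<in> J"
  shows "sample_mean S w J (\<lambda>X. f (X i)) = (\<Sum>x\<in>S. w x * f x)"
  using assms by (subst sample_mean_peel[of _ i]) (auto simp: sample_mean_const)

lemma sample_mean_two_index:
  assumes "finite J" "sum w S = 1" "i \<in> J" "l \<in> J" "i \<noteq> l"
  shows "sample_mean S w J (\<lambda>X. f (X i) (X l)) = (\<Sum>x\<in>S. w x * (\<Sum>y\<in>S. w y * f x y))"
proof -
  have "sample_mean S w J (\<lambda>X. f (X i) (X l)) =
     sample_mean S w (J - {l}) (\<lambda>X. (\<lambda>x. \<Sum>y\<in>S. w y * f x y) (X i))"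
    using assms by (subst sample_mean_peel[of _ l]) auto
  also have "\<dots> = (\<Sum>x\<in>S. w x * (\<Sum>y\<in>S. w y * f x y))"
    using assms by (intro sample_mean_one_index) auto
  finally show ?thesis .
qed

text \<open>The source of all orthogonality over the data: the conditional mean given the remaining
  draws vanishes. Two draws are averaged together because the pieces of the kernel are centred in a
  pair of arguments, not in a single one.\<close>

lemma sample_mean_indep_zero:
  assumes "finite J" "i \<in> J" "l \<in> J" "i \<noteq> l"
    and "\<And>X. X \<in> PiE (J - {l} - {i}) (\<lambda>_. S) \<Longrightarrow>
       (\<Sum>x\<in>S. w x * (\<Sum>y\<in>S. w y * F (X(i := x, l := y)))) = 0"
  shows "sample_mean S w J F = 0"
proof -
  have "sample_mean S w J F =
     sample_mean S w (J - {l} - {i}) (\<lambda>X. (\<Sum>x\<in>S. w x * (\<Sum>y\<in>S. w y * F (X(i := x, l := y)))))"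
    using assms(1-4) by (subst sample_mean_peel[of _ l]; simp?) (subst sample_mean_peel[of _ i]; simp)
  also have "\<dots> = sample_mean S w (J - {l} - {i}) (\<lambda>X. 0)"
    by (intro sample_mean_cong assms(5))
  finally show ?thesis by (simp add: sample_mean_def)
qed

subsection \<open>Averages over quadruples\<close>

lemma distinct_quads_subset:
  "distinct_quads n \<subseteq> {1..n} \<times> {1..n} \<times> {1..n} \<times> {1..n}"
  by (auto simp: distinct_quads_def)

lemma finite_distinct_quads [simp]: "finite (distinct_quads n)"
  by (rule finite_subset[OF distinct_quads_subset]) auto

lemma card_distinct_quads:
  assumes "n \<ge> 4"
  shows "32 * real (card (distinct_quads n)) \<ge> 3 * real n ^ 4"
proof -
  have "distinct_quads n = (\<lambda>xs. (xs ! 0, xs ! 1, xs ! 2, xs ! 3)) `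
      {xs. length xs = 4 \<and> distinct xs \<and> set xs \<subseteq> {1..n}}" (is "_ = ?f ` ?A")
  proof (intro subset_antisym subsetI)
    fix x assume "x \<in> distinct_quads n"
    then obtain i j k l where "x = (i, j, k, l)" "{i, j, k, l} \<subseteq> {1..n}" "distinct [i, j, k, l]"
      by (auto simp: distinct_quads_def)
    then show "x \<in> ?f ` ?A"
      by (intro image_eqI[of _ _ "[i, j, k, l]"]) auto
  next
    fix x assume "x \<in> ?f ` ?A"
    then obtain xs where xs: "length xs = 4" "distinct xs" "set xs \<subseteq> {1..n}" "x = ?f xs" by auto
    then obtain i j k l where "xs = [i, j, k, l]"
      by (auto simp: length_Suc_conv eval_nat_numeral)
    with xs show "x \<in> distinct_quads n" by (auto simp: distinct_quads_def)
  qed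
  moreover have "inj_on ?f ?A"
  proof (rule inj_onI)
    fix xs ys assume *: "xs \<in> ?A" "ys \<in> ?A" "?f xs = ?f ys"
    show "xs = ys"
    proof (rule nth_equalityI)
      fix i assume "i < length xs"
      then have "i \<in> {0, 1, 2, 3}" using * by auto
      then show "xs ! i = ys ! i" using * by auto
    qed (use * in auto)
  qed
  ultimately have "card (distinct_quads n) = card ?A"
    by (simp add: card_image)
  also have "\<dots> = \<Prod>{n - 3..n}"
    using assms Suc_diff_le[of 4 n] by (subst card_lists_distinct_length_eq) auto
  also have "\<dots> = (n - 3) * (n - 2) * (n - 1) * n"
  proof -
    obtain m where n: "n = m + 4" using assms le_Suc_ex[of 4 n] by (auto simp: add.commute)
    have "{n - 3..n} = {m + 1, m + 2, m + 3, m + 4}" unfolding n by auto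
    then show ?thesis unfolding n by (simp add: algebra_simps)
  qed
  finally have eq: "real (card (distinct_quads n)) = (real n - 3) * (real n - 2) * (real n - 1) * real n"
    using assms by (simp add: of_nat_diff)
  have n: "real n \<ge> 4" using assms by simp
  \<comment> \<open>For n at least 4, n - k is at least (1 - k/4) n, with equality at n = 4. The
    product of the three factors is 3/32.\<close>
  have "(1/4 * real n) * (1/2 * real n) * (3/4 * real n) * real n \<le>
     (real n - 3) * (real n - 2) * (real n - 1) * real n"
    using n by (intro mult_mono) auto
  then show ?thesis unfolding eq by (simp add: power4_eq_xxxx algebra_simps)
qed

text \<open>Expanding the square, pairs outside \<open>R\<close> contribute nothing, and every other
  pair contributes at most \<open>v\<close> because xy is at most (x^2 + y^2)/2. The weighted set
  \<open>\<Omega>\<close> is abstract since the lemma serves both for the data alone and for the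
  data together with a random permutation.\<close>

lemma second_moment_average:
  fixes F :: "'q \<Rightarrow> 'o \<Rightarrow> real" and p :: "'o \<Rightarrow> real"
  assumes fin: "finite Q"
    and p: "\<And>\<omega>. \<omega> \<in> \<Omega> \<Longrightarrow> 0 \<le> p \<omega>"
    and orth: "\<And>I I'. I \<in> Q \<Longrightarrow> I' \<in> Q \<Longrightarrow> I' \<notin> R I \<Longrightarrow> (\<Sum>\<omega>\<in>\<Omega>. p \<omega> * (F I \<omega> * F I' \<omega>)) = 0"
    and v: "\<And>I. I \<in> Q \<Longrightarrow> (\<Sum>\<omega>\<in>\<Omega>. p \<omega> * (F I \<omega>)\<^sup>2) \<le> v"
    and R: "\<And>I. I \<in> Q \<Longrightarrow> real (card (R I \<inter> Q)) \<le> m * real (card Q)"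
    and "0 \<le> v" "0 \<le> m"
  shows "(\<Sum>\<omega>\<in>\<Omega>. p \<omega> * ((\<Sum>I\<in>Q. F I \<omega>) / real (card Q))\<^sup>2) \<le> m * v"
proof (cases "Q = {}")
  case True
  then show ?thesis using assms(6,7) by simp
next
  case False
  then have c: "real (card Q) > 0" using fin by (simp add: card_gt_0_iff)
  define E where "E G = (\<Sum>\<omega>\<in>\<Omega>. p \<omega> * G \<omega>)" for G
  have pair: "E (\<lambda>\<omega>. F I \<omega> * F I' \<omega>) \<le> v" if "I \<in> Q" "I' \<in> Q" for I I'
  proof -
    have "E (\<lambda>\<omega>. F I \<omega> * F I' \<omega>) \<le> E (\<lambda>\<omega>. 1/2 * (F I \<omega>)\<^sup>2 + 1/2 * (F I' \<omega>)\<^sup>2)"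
      unfolding E_def
    proof (intro sum_mono mult_left_mono p)
      fix \<omega>
      show "F I \<omega> * F I' \<omega> \<le> 1/2 * (F I \<omega>)\<^sup>2 + 1/2 * (F I' \<omega>)\<^sup>2"
        using zero_le_power2[of "F I \<omega> - F I' \<omega>"] by (simp add: power2_diff)
    qed
    also have "\<dots> = 1/2 * E (\<lambda>\<omega>. (F I \<omega>)\<^sup>2) + 1/2 * E (\<lambda>\<omega>. (F I' \<omega>)\<^sup>2)"
      by (simp add: E_def algebra_simps sum.distrib sum_divide_distrib[symmetric] add_divide_distrib)
    also have "\<dots> \<le> v" using v[OF that(1)] v[OF that(2)] by (simp add: E_def)
    finally show ?thesis .
  qed
  have "E (\<lambda>\<omega>. (\<Sum>I\<in>Q. F I \<omega>)\<^sup>2) = (\<Sum>I\<in>Q. \<Sum>I'\<in>Q. E (\<lambda>\<omega>. F I \<omega> * F I' \<omega>))"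
  proof -
    have "E (\<lambda>\<omega>. (\<Sum>I\<in>Q. F I \<omega>)\<^sup>2) = (\<Sum>\<omega>\<in>\<Omega>. \<Sum>I\<in>Q. \<Sum>I'\<in>Q. p \<omega> * (F I \<omega> * F I' \<omega>))"
      unfolding E_def power2_eq_square sum_product by (simp only: sum_distrib_left)
    also have "\<dots> = (\<Sum>I\<in>Q. \<Sum>\<omega>\<in>\<Omega>. \<Sum>I'\<in>Q. p \<omega> * (F I \<omega> * F I' \<omega>))"
      by (rule sum.swap)
    also have "\<dots> = (\<Sum>I\<in>Q. \<Sum>I'\<in>Q. E (\<lambda>\<omega>. F I \<omega> * F I' \<omega>))"
      unfolding E_def by (intro sum.cong refl sum.swap)
    finally show ?thesis .
  qed
  also have "\<dots> \<le> (\<Sum>I\<in>Q. m * real (card Q) * v)"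
  proof (rule sum_mono)
    fix I assume I: "I \<in> Q"
    have "(\<Sum>I'\<in>Q. E (\<lambda>\<omega>. F I \<omega> * F I' \<omega>)) = (\<Sum>I'\<in>R I \<inter> Q. E (\<lambda>\<omega>. F I \<omega> * F I' \<omega>))"
      using fin I orth by (intro sum.mono_neutral_right) (auto simp: E_def)
    also have "\<dots> \<le> (\<Sum>I'\<in>R I \<inter> Q. v)"
      using I by (intro sum_mono pair) auto
    also have "\<dots> \<le> m * real (card Q) * v"
      using R[OF I] \<open>0 \<le> v\<close> by (simp add: mult_right_mono)
    finally show "(\<Sum>I'\<in>Q. E (\<lambda>\<omega>. F I \<omega> * F I' \<omega>)) \<le> m * real (card Q) * v" .
  qed
  also have "\<dots> = m * v * (real (card Q))\<^sup>2" by (simp add: power2_eq_square)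
  finally have "E (\<lambda>\<omega>. (\<Sum>I\<in>Q. F I \<omega>)\<^sup>2) / (real (card Q))\<^sup>2 \<le> m * v"
    using c by (simp add: divide_le_eq)
  then show ?thesis
    unfolding E_def power_divide by (simp only: sum_divide_distrib times_divide_eq_right)
qed

lemma card_union_le: "finite \<A> \<Longrightarrow> (\<And>A. A \<in> \<A> \<Longrightarrow> card A \<le> N) \<Longrightarrow> card (\<Union>\<A>) \<le> card \<A> * N"
  by (rule order_trans[OF card_Union_le_sum_card]) (use sum_bounded_above[of \<A> card N] in simp)

text \<open>Two slots, at most two values in the chosen slot and n^3 completions give 4 n^3
  quadruples. Division by the lower bound 3/32 n^4 for all quadruples gives 128/3 over n, rounded up
  to 48.\<close>

lemma card_quads_meeting_pair:
  assumes "n \<ge> 4" "card P \<le> 2" "finite P"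
  shows "real (card ({(a, b, c, d). a \<in> P \<or> d \<in> P} \<inter> distinct_quads n))
     \<le> 48 / real n * real (card (distinct_quads n))"
    and "real (card ({(a, b, c, d). b \<in> P \<or> c \<in> P} \<inter> distinct_quads n))
     \<le> 48 / real n * real (card (distinct_quads n))"
proof -
  let ?N = "{1..n}"
  have bound: "real x \<le> 48 / real n * real (card (distinct_quads n))" if "x \<le> 2 * (card P * n ^ 3)" for x
  proof -
    have "real x \<le> real (2 * (card P * n ^ 3))" using that of_nat_mono by blast
    also have "\<dots> \<le> 4 * real n ^ 3" using mult_right_mono[of "real (card P)" 2 "real n ^ 3"] assms(2) by simp
    also have "\<dots> = 4 * (real n ^ 4) / real n" using assms(1) by (simp add: eval_nat_numeral)
    also have "\<dots> \<le> 48 * real (card (distinct_quads n)) / real n"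
      using card_distinct_quads[OF assms(1)] by (intro divide_right_mono) auto
    finally show ?thesis by simp
  qed
  have "card ({(a, b, c, d). a \<in> P \<or> d \<in> P} \<inter> distinct_quads n) \<le>
    card (\<Union>{P \<times> ?N \<times> ?N \<times> ?N, ?N \<times> ?N \<times> ?N \<times> P})"
    by (rule card_mono) (use assms(3) distinct_quads_subset in auto)
  also have "\<dots> \<le> card {P \<times> ?N \<times> ?N \<times> ?N, ?N \<times> ?N \<times> ?N \<times> P} * (card P * n ^ 3)"
    by (rule card_union_le) (auto simp: card_cartesian_product eval_nat_numeral)
  also have "\<dots> \<le> 2 * (card P * n ^ 3)"
    by (intro mult_right_mono) (simp_all add: card_insert_if)
  finally show "real (card ({(a, b, c, d). a \<in> P \<or> d \<in> P} \<inter> distinct_quads n))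
     \<le> 48 / real n * real (card (distinct_quads n))" by (rule bound)
  have "card ({(a, b, c, d). b \<in> P \<or> c \<in> P} \<inter> distinct_quads n) \<le>
    card (\<Union>{?N \<times> P \<times> ?N \<times> ?N, ?N \<times> ?N \<times> P \<times> ?N})"
    by (rule card_mono) (use assms(3) distinct_quads_subset in auto)
  also have "\<dots> \<le> card {?N \<times> P \<times> ?N \<times> ?N, ?N \<times> ?N \<times> P \<times> ?N} * (card P * n ^ 3)"
    by (rule card_union_le) (auto simp: card_cartesian_product eval_nat_numeral)
  also have "\<dots> \<le> 2 * (card P * n ^ 3)"
    by (intro mult_right_mono) (simp_all add: card_insert_if)
  finally show "real (card ({(a, b, c, d). b \<in> P \<or> c \<in> P} \<inter> distinct_quads n))
     \<le> 48 / real n * real (card (distinct_quads n))" by (rule bound)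
qed

text \<open>Disjoint pairs are met in different slots: twelve ordered choices of slots, at most four
  choices of values and n^2 completions. The constant is exact for this count, 512 * 3/32 =
  48.\<close>

lemma card_quads_meeting_two_pairs:
  assumes "n \<ge> 4" "card P \<le> 2" "finite P" "card P' \<le> 2" "finite P'" "P \<inter> P' = {}"
  shows "real (card ({(a, b, c, d). {a, b, c, d} \<inter> P \<noteq> {} \<and> {a, b, c, d} \<inter> P' \<noteq> {}} \<inter> distinct_quads n))
     \<le> 512 / (real n)\<^sup>2 * real (card (distinct_quads n))"
proof -
  let ?N = "{1..n}"
  let ?U = "{P \<times> P' \<times> ?N \<times> ?N, P \<times> ?N \<times> P' \<times> ?N, P \<times> ?N \<times> ?N \<times> P', ?N \<times> P \<times> P' \<times> ?N,
    ?N \<times> P \<times> ?N \<times> P', ?N \<times> ?N \<times> P \<times> P', P' \<times> P \<times> ?N \<times> ?N, P' \<times> ?N \<times> P \<times> ?N, P' \<times> ?N \<times> ?N \<times> P,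
    ?N \<times> P' \<times> P \<times> ?N, ?N \<times> P' \<times> ?N \<times> P, ?N \<times> ?N \<times> P' \<times> P}"
  have "card ({(a, b, c, d). {a, b, c, d} \<inter> P \<noteq> {} \<and> {a, b, c, d} \<inter> P' \<noteq> {}} \<inter> distinct_quads n) \<le> card (\<Union>?U)"
  proof (rule card_mono)
    show "finite (\<Union>?U)" using assms(3,5) by simp
    show "{(a, b, c, d). {a, b, c, d} \<inter> P \<noteq> {} \<and> {a, b, c, d} \<inter> P' \<noteq> {}} \<inter> distinct_quads n \<subseteq> \<Union>?U"
    proof (clarify)
      fix a b c d
      assume x: "{a, b, c, d} \<inter> P \<noteq> {}" "{a, b, c, d} \<inter> P' \<noteq> {}" "(a, b, c, d) \<in> distinct_quads n"
      have N: "a \<in> ?N" "b \<in> ?N" "c \<in> ?N" "d \<in> ?N" using x(3) distinct_quads_subset by blast+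
      have "a \<in> P \<or> b \<in> P \<or> c \<in> P \<or> d \<in> P" "a \<in> P' \<or> b \<in> P' \<or> c \<in> P' \<or> d \<in> P'"
        using x by blast+
      moreover have "\<not> (y \<in> P \<and> y \<in> P')" for y using assms(6) by blast
      ultimately show "(a, b, c, d) \<in> \<Union>?U"
        unfolding Union_insert Union_empty Un_iff mem_Times_iff fst_conv snd_conv using N by metis
    qed
  qed
  also have "\<dots> \<le> card ?U * (card P * card P' * n\<^sup>2)"
    by (rule card_union_le) (auto simp: card_cartesian_product power2_eq_square)
  also have "\<dots> \<le> 12 * (card P * card P' * n\<^sup>2)"
  proof (rule mult_right_mono)
    show "card ?U \<le> 12"
    by (rule order_trans[OF card_length[of "[P \<times> P' \<times> ?N \<times> ?N, P \<times> ?N \<times> P' \<times> ?N, P \<times> ?N \<times> ?N \<times> P', ?N \<times> P \<times> P' \<times> ?N,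
    ?N \<times> P \<times> ?N \<times> P', ?N \<times> ?N \<times> P \<times> P', P' \<times> P \<times> ?N \<times> ?N, P' \<times> ?N \<times> P \<times> ?N, P' \<times> ?N \<times> ?N \<times> P,
    ?N \<times> P' \<times> P \<times> ?N, ?N \<times> P' \<times> ?N \<times> P, ?N \<times> ?N \<times> P' \<times> P]", unfolded list.set]]) simp
  qed simp
  also have "\<dots> \<le> 12 * (2 * 2 * n\<^sup>2)"
    using assms by (intro mult_left_mono mult_right_mono mult_mono) auto
  finally have "real (card ({(a, b, c, d). {a, b, c, d} \<inter> P \<noteq> {} \<and> {a, b, c, d} \<inter> P' \<noteq> {}} \<inter> distinct_quads n))
     \<le> real (12 * (2 * 2 * n\<^sup>2))" using of_nat_mono by blast
  also have "\<dots> = 48 * (real n ^ 4) / (real n)\<^sup>2" using assms(1) by (simp add: eval_nat_numeral)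
  also have "\<dots> \<le> 512 * real (card (distinct_quads n)) / (real n)\<^sup>2"
    using card_distinct_quads[OF assms(1)] by (intro divide_right_mono) auto
  finally show ?thesis by simp
qed

subsection \<open>The test statistic of labelled data\<close>

text \<open>With one-hot vectors e1, ..., e4 of the labels this is the inner product of e1 - e4 and
  e2 - e3. The two sign changes and the symmetry proved below can be read off from that
  form.\<close>

definition contrast :: "'y \<Rightarrow> 'y \<Rightarrow> 'y \<Rightarrow> 'y \<Rightarrow> real" where
  "contrast y1 y2 y3 y4 = of_bool (y1 = y2) + of_bool (y3 = y4) - of_bool (y1 = y3) - of_bool (y2 = y4)"

definition label_kernel :: "'y \<times> 'z \<Rightarrow> 'y \<times> 'z \<Rightarrow> 'y \<times> 'z \<Rightarrow> 'y \<times> 'z \<Rightarrow> real" where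
  "label_kernel x1 x2 x3 x4 =
     contrast (fst x1) (fst x2) (fst x3) (fst x4) * contrast (snd x1) (snd x2) (snd x3) (snd x4)"

definition label_U :: "nat \<Rightarrow> (nat \<Rightarrow> 'y \<times> 'z) \<Rightarrow> real" where
  "label_U n X = (\<Sum>(i, j, k, l)\<in>distinct_quads n. label_kernel (X i) (X j) (X k) (X l))
     / real (card (distinct_quads n))"

definition label_U_perm :: "nat \<Rightarrow> (nat \<Rightarrow> 'y \<times> 'z) \<Rightarrow> (nat \<Rightarrow> nat) \<Rightarrow> real" where
  "label_U_perm n X \<pi> = label_U n (\<lambda>i. (fst (X i), snd (X (\<pi> i))))"

definition label_crit :: "nat \<Rightarrow> real \<Rightarrow> (nat \<Rightarrow> 'y \<times> 'z) \<Rightarrow> real" where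
  "label_crit n \<alpha> X =
     Inf {t. 1 / fact n * (\<Sum>\<pi> | \<pi> permutes {1..n}. if label_U_perm n X \<pi> \<le> t then 1 else 0) \<ge> 1 - \<alpha>}"

lemma contrast_swap_outer: "contrast y4 y2 y3 y1 = - contrast y1 y2 y3 y4"
  by (auto simp: contrast_def)

lemma contrast_swap_inner: "contrast y1 y3 y2 y4 = - contrast y1 y2 y3 y4"
  by (auto simp: contrast_def)

lemma contrast_swap_pairs: "contrast y2 y1 y4 y3 = contrast y1 y2 y3 y4"
  by (auto simp: contrast_def)

lemma label_kernel_swap_pairs: "label_kernel x2 x1 x4 x3 = label_kernel x1 x2 x3 x4"
  unfolding label_kernel_def
  using contrast_swap_pairs[of "fst x2" "fst x1" "fst x4" "fst x3"]
    contrast_swap_pairs[of "snd x2" "snd x1" "snd x4" "snd x3"] by simp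

lemma square_add4_le: "(a + b + c + d)\<^sup>2 \<le> 4 * (a\<^sup>2 + b\<^sup>2 + c\<^sup>2 + d\<^sup>2)" for a b c d :: real
  using zero_le_power2[of "a - b"] zero_le_power2[of "a - c"] zero_le_power2[of "a - d"]
    zero_le_power2[of "b - c"] zero_le_power2[of "b - d"] zero_le_power2[of "c - d"]
  by (simp add: power2_eq_square algebra_simps)

lemma contrast_square_le:
  "(contrast y1 y2 y3 y4)\<^sup>2 \<le> 4 * (of_bool (y1 = y2) + of_bool (y3 = y4) + of_bool (y1 = y3) + of_bool (y2 = y4))"
  using square_add4_le[of "of_bool (y1 = y2)" "of_bool (y3 = y4)" "- of_bool (y1 = y3)" "- of_bool (y2 = y4)"]
  by (simp add: contrast_def)

section \<open>Mean and conditional means of the kernel\<close>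

locale contingency_table =
  fixes A :: "'y set" and B :: "'z set" and w :: "'y \<times> 'z \<Rightarrow> real"
  assumes finite_A: "finite A" and finite_B: "finite B"
    and w_nonneg: "x \<in> A \<times> B \<Longrightarrow> 0 \<le> w x"
    and w_sum: "sum w (A \<times> B) = 1"
begin

definition row :: "'y \<Rightarrow> real" where "row y = (\<Sum>z\<in>B. w (y, z))"

definition col :: "'z \<Rightarrow> real" where "col z = (\<Sum>y\<in>A. w (y, z))"

definition dev :: "'y \<times> 'z \<Rightarrow> real" where "dev x = w x - row (fst x) * col (snd x)"

definition dependence :: real where "dependence = (\<Sum>x\<in>A \<times> B. (dev x)\<^sup>2)"

text \<open>With \<open>\<phi>, \<psi>\<close> the one-hot encodings of the labels, the kernel is the inner product of the
  matrices \<open>(\<phi>\<^sub>1 - \<phi>\<^sub>4) \<otimes> (\<psi>\<^sub>1 - \<psi>\<^sub>4)\<close> and \<open>(\<phi>\<^sub>2 - \<phi>\<^sub>3) \<otimes> (\<psi>\<^sub>2 - \<psi>\<^sub>3)\<close>, each with mean \<open>2 dev\<close>;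
  \<open>dev_pair\<close> is the inner product of \<open>dev\<close> with one of them.\<close>

definition dev_pair :: "'y \<times> 'z \<Rightarrow> 'y \<times> 'z \<Rightarrow> real" where
  "dev_pair x x' = dev (fst x, snd x) - dev (fst x, snd x') - dev (fst x', snd x) + dev (fst x', snd x')"

text \<open>The inner product of the two matrices that form \<open>label_kernel\<close>, after
  subtracting the mean \<open>2 dev\<close> from each. Hence it has mean zero in the outer pair for
  a fixed inner pair, and conversely.\<close>

definition degenerate_kernel :: "'y \<times> 'z \<Rightarrow> 'y \<times> 'z \<Rightarrow> 'y \<times> 'z \<Rightarrow> 'y \<times> 'z \<Rightarrow> real" where
  "degenerate_kernel x1 x2 x3 x4 =
     label_kernel x1 x2 x3 x4 - 2 * dev_pair x1 x4 - 2 * dev_pair x2 x3 + 4 * dependence"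

abbreviation "S \<equiv> A \<times> B"

abbreviation "E J F \<equiv> sample_mean S w J F"

lemma finite_S: "finite S" using finite_A finite_B by simp

lemma row_nonneg: "y \<in> A \<Longrightarrow> 0 \<le> row y" unfolding row_def by (intro sum_nonneg w_nonneg) auto

lemma col_nonneg: "z \<in> B \<Longrightarrow> 0 \<le> col z" unfolding col_def by (intro sum_nonneg w_nonneg) auto

lemma sum_w_first: "(\<Sum>x\<in>S. w x * f (fst x)) = (\<Sum>y\<in>A. row y * f y)"
  unfolding row_def sum_distrib_right by (simp add: sum.cartesian_product case_prod_unfold)

lemma sum_w_second: "(\<Sum>x\<in>S. w x * f (snd x)) = (\<Sum>z\<in>B. col z * f z)"
proof -
  have "(\<Sum>x\<in>S. w x * f (snd x)) = (\<Sum>y\<in>A. \<Sum>z\<in>B. w (y, z) * f z)"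
    by (simp add: sum.cartesian_product case_prod_unfold)
  also have "\<dots> = (\<Sum>z\<in>B. \<Sum>y\<in>A. w (y, z) * f z)" by (rule sum.swap)
  finally show ?thesis by (simp add: col_def sum_distrib_right)
qed

lemma sum_row: "sum row A = 1"
  using sum_w_first[of "\<lambda>_. 1"] w_sum by simp

lemma sum_col: "sum col B = 1"
  using sum_w_second[of "\<lambda>_. 1"] w_sum by simp

lemma sum_first_eq: "y \<in> A \<Longrightarrow> (\<Sum>x\<in>S. w x * of_bool (y = fst x)) = row y"
  using sum_w_first[of "\<lambda>y'. of_bool (y = y')"] finite_A by (simp add: of_bool_def if_distrib cong: if_cong)

lemma sum_second_eq: "z \<in> B \<Longrightarrow> (\<Sum>x\<in>S. w x * of_bool (z = snd x)) = col z"
  using sum_w_second[of "\<lambda>z'. of_bool (z = z')"] finite_B by (simp add: of_bool_def if_distrib cong: if_cong)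

lemma sum_both_eq:
  assumes "y \<in> A" "z \<in> B"
  shows "(\<Sum>x\<in>S. w x * (of_bool (y = fst x) * of_bool (z = snd x))) = w (y, z)"
proof -
  have "(\<Sum>x\<in>S. w x * (of_bool (y = fst x) * of_bool (z = snd x))) = (\<Sum>x\<in>S. if x = (y, z) then w x else 0)"
    by (intro sum.cong) auto
  then show ?thesis using assms finite_S by simp
qed

lemma sum_cross:
  "(\<Sum>x\<in>S. w x * (\<Sum>x'\<in>S. w x' * f (fst x) (snd x'))) = (\<Sum>c\<in>S. row (fst c) * col (snd c) * f (fst c) (snd c))"
  "(\<Sum>x\<in>S. w x * (\<Sum>x'\<in>S. w x' * f (fst x') (snd x))) = (\<Sum>c\<in>S. row (fst c) * col (snd c) * f (fst c) (snd c))"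
proof -
  have "(\<Sum>x\<in>S. w x * (\<Sum>x'\<in>S. w x' * f (fst x) (snd x'))) = (\<Sum>y\<in>A. row y * (\<Sum>z\<in>B. col z * f y z))"
    by (simp add: sum_w_second sum_w_first[of "\<lambda>y. \<Sum>z\<in>B. col z * f y z"])
  also have "\<dots> = (\<Sum>c\<in>S. row (fst c) * col (snd c) * f (fst c) (snd c))"
    by (simp add: sum_distrib_left sum.cartesian_product case_prod_unfold mult_ac)
  finally show 1: "(\<Sum>x\<in>S. w x * (\<Sum>x'\<in>S. w x' * f (fst x) (snd x'))) =
    (\<Sum>c\<in>S. row (fst c) * col (snd c) * f (fst c) (snd c))" .
  have "(\<Sum>x\<in>S. w x * (\<Sum>x'\<in>S. w x' * f (fst x') (snd x))) =
     (\<Sum>x'\<in>S. w x' * (\<Sum>x\<in>S. w x * f (fst x') (snd x)))"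
    unfolding sum_distrib_left by (subst sum.swap) (simp add: mult_ac)
  with 1 show "(\<Sum>x\<in>S. w x * (\<Sum>x'\<in>S. w x' * f (fst x') (snd x))) =
    (\<Sum>c\<in>S. row (fst c) * col (snd c) * f (fst c) (snd c))" by simp
qed

text \<open>For independent copies the mean product of differences is twice the covariance. This is
  how deviations from independence enter.\<close>

lemma sum_differences:
  fixes u v :: "'y \<times> 'z \<Rightarrow> real"
  shows "(\<Sum>x\<in>S. w x * (\<Sum>x'\<in>S. w x' * ((u x - u x') * (v x - v x')))) =
    2 * ((\<Sum>x\<in>S. w x * (u x * v x)) - (\<Sum>x\<in>S. w x * u x) * (\<Sum>x\<in>S. w x * v x))"
proof -
  have "(\<Sum>x'\<in>S. w x' * ((u x - u x') * (v x - v x'))) =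
    u x * v x - u x * (\<Sum>x\<in>S. w x * v x) - v x * (\<Sum>x\<in>S. w x * u x) + (\<Sum>x\<in>S. w x * (u x * v x))" for x
  proof -
    have "(\<Sum>x'\<in>S. w x' * ((u x - u x') * (v x - v x'))) =
      (\<Sum>x'\<in>S. u x * v x * w x' - u x * (w x' * v x') - v x * (w x' * u x') + w x' * (u x' * v x'))"
      by (intro sum.cong) (auto simp: algebra_simps)
    then show ?thesis
      by (simp add: sum.distrib sum_subtractf sum_distrib_left[symmetric] w_sum)
  qed
  note inner = this
  define U V UV where "U = (\<Sum>x\<in>S. w x * u x)" and "V = (\<Sum>x\<in>S. w x * v x)"
    and "UV = (\<Sum>x\<in>S. w x * (u x * v x))"
  have "(\<Sum>x\<in>S. w x * (\<Sum>x'\<in>S. w x' * ((u x - u x') * (v x - v x')))) =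
    (\<Sum>x\<in>S. w x * (u x * v x) - V * (w x * u x) - U * (w x * v x) + UV * w x)"
    unfolding inner U_def[symmetric] V_def[symmetric] UV_def[symmetric]
    by (intro sum.cong) (auto simp: algebra_simps)
  also have "\<dots> = UV - V * U - U * V + UV"
    by (simp only: sum.distrib sum_subtractf sum_distrib_left[symmetric] w_sum)
       (simp add: U_def V_def UV_def)
  finally show ?thesis by (simp add: U_def V_def UV_def algebra_simps)
qed

text \<open>For a fixed outer pair the kernel is a product of differences of the form in
  \<open>sum_differences\<close>, with u and v differences of label indicators. Their covariance is
  a signed sum of four covariances of a Y-indicator with a Z-indicator, and each of these is a value
  of \<open>dev\<close>.\<close>

lemma mean_kernel_inner:
  assumes "x1 \<in> S" "x4 \<in> S"
  shows "(\<Sum>x2\<in>S. w x2 * (\<Sum>x3\<in>S. w x3 * label_kernel x1 x2 x3 x4)) = 2 * dev_pair x1 x4"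
proof -
  define u v where "u x = of_bool (fst x1 = fst x) - (of_bool (fst x4 = fst x) :: real)"
    and "v x = of_bool (snd x1 = snd x) - (of_bool (snd x4 = snd x) :: real)" for x :: "'y \<times> 'z"
  have "label_kernel x1 x2 x3 x4 = (u x2 - u x3) * (v x2 - v x3)" for x2 x3
    by (simp add: label_kernel_def contrast_def u_def v_def eq_commute algebra_simps)
  moreover have "(\<Sum>x\<in>S. w x * u x) = row (fst x1) - row (fst x4)"
    using assms unfolding u_def by (auto simp: right_diff_distrib sum_subtractf sum_first_eq mem_Times_iff)
  moreover have "(\<Sum>x\<in>S. w x * v x) = col (snd x1) - col (snd x4)"
    using assms unfolding v_def by (auto simp: right_diff_distrib sum_subtractf sum_second_eq mem_Times_iff)
  moreover have "(\<Sum>x\<in>S. w x * (u x * v x)) =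
    w (fst x1, snd x1) - w (fst x1, snd x4) - w (fst x4, snd x1) + w (fst x4, snd x4)"
    using assms unfolding u_def v_def left_diff_distrib right_diff_distrib sum_subtractf sum.distrib
    by (subst (1 2 3 4) sum_both_eq) (auto simp: mem_Times_iff)
  ultimately show ?thesis
    by (simp only: sum_differences) (simp add: dev_pair_def dev_def algebra_simps)
qed

lemma mean_kernel_outer:
  assumes "x2 \<in> S" "x3 \<in> S"
  shows "(\<Sum>x1\<in>S. w x1 * (\<Sum>x4\<in>S. w x4 * label_kernel x1 x2 x3 x4)) = 2 * dev_pair x2 x3"
  using mean_kernel_inner[OF assms] by (subst label_kernel_swap_pairs[symmetric])

text \<open>The two terms with both labels from one draw average \<open>dev\<close> against
  \<open>w\<close>, the two mixed terms against \<open>row * col\<close>. The difference of these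
  weights is again \<open>dev\<close>, which produces the sum of squares. With
  \<open>mean_kernel_inner\<close> the kernel gets mean 4 \<open>dependence\<close>.\<close>

lemma mean_dev_pair: "(\<Sum>x\<in>S. w x * (\<Sum>x'\<in>S. w x' * dev_pair x x')) = 2 * dependence"
proof -
  define m where "m = (\<Sum>x\<in>S. w x * dev x)"
  have "(\<Sum>x'\<in>S. w x' * dev_pair x x') = dev x - (\<Sum>x'\<in>S. w x' * dev (fst x, snd x'))
         - (\<Sum>x'\<in>S. w x' * dev (fst x', snd x)) + m" for x
  proof -
    have "(\<Sum>x'\<in>S. w x' * dev_pair x x') = (\<Sum>x'\<in>S. dev x * w x' - w x' * dev (fst x, snd x')
         - w x' * dev (fst x', snd x) + w x' * dev x')"
      by (intro sum.cong) (auto simp: dev_pair_def algebra_simps)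
    then show ?thesis
      by (simp add: sum.distrib sum_subtractf sum_distrib_left[symmetric] w_sum m_def)
  qed
  note inner = this
  have "(\<Sum>x\<in>S. w x * (\<Sum>x'\<in>S. w x' * dev_pair x x')) =
     m - (\<Sum>x\<in>S. w x * (\<Sum>x'\<in>S. w x' * dev (fst x, snd x')))
     - (\<Sum>x\<in>S. w x * (\<Sum>x'\<in>S. w x' * dev (fst x', snd x))) + m"
    unfolding inner distrib_left right_diff_distrib sum.distrib sum_subtractf
    by (simp add: sum_distrib_right[symmetric] w_sum m_def)
  also have "\<dots> = 2 * (\<Sum>x\<in>S. w x * dev x - row (fst x) * col (snd x) * dev x)"
    using sum_cross[of "\<lambda>y z. dev (y, z)"] by (simp add: m_def sum_subtractf)
  finally show ?thesis
    by (simp add: dependence_def dev_def power2_eq_square algebra_simps)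
qed

lemma mean_degenerate_outer:
  assumes "x2 \<in> S" "x3 \<in> S"
  shows "(\<Sum>x1\<in>S. w x1 * (\<Sum>x4\<in>S. w x4 * degenerate_kernel x1 x2 x3 x4)) = 0"
proof -
  have "(\<Sum>x1\<in>S. w x1 * (\<Sum>x4\<in>S. w x4 * degenerate_kernel x1 x2 x3 x4)) =
    (\<Sum>x1\<in>S. w x1 * (\<Sum>x4\<in>S. w x4 * label_kernel x1 x2 x3 x4))
    - 2 * (\<Sum>x1\<in>S. w x1 * (\<Sum>x4\<in>S. w x4 * dev_pair x1 x4))
    - (\<Sum>x1\<in>S. w x1 * (\<Sum>x4\<in>S. w x4 * (2 * dev_pair x2 x3 - 4 * dependence)))"
    unfolding degenerate_kernel_def
    by (simp add: algebra_simps sum.distrib sum_subtractf sum_distrib_left)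
  also have "\<dots> = 0"
    unfolding mean_kernel_outer[OF assms] mean_dev_pair
    by (simp add: sum_distrib_right[symmetric] w_sum)
  finally show ?thesis .
qed

lemma degenerate_kernel_swap_pairs: "degenerate_kernel x2 x1 x4 x3 = degenerate_kernel x1 x2 x3 x4"
  unfolding degenerate_kernel_def by (subst label_kernel_swap_pairs) simp

lemma mean_degenerate_inner:
  assumes "x1 \<in> S" "x4 \<in> S"
  shows "(\<Sum>x2\<in>S. w x2 * (\<Sum>x3\<in>S. w x3 * degenerate_kernel x1 x2 x3 x4)) = 0"
  using mean_degenerate_outer[OF assms] by (subst degenerate_kernel_swap_pairs[symmetric])

end

section \<open>Second moments for tables with small cells\<close>

text \<open>For a density bounded by M, \<open>a\<close> and \<open>b\<close> will be M divided by
  the number of Y-bins and of Z-bins. The bound on \<open>w\<close> is a separate assumption because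
  bounds on rows and columns do not imply it: mass on a diagonal violates it.\<close>

locale bounded_contingency_table = contingency_table +
  fixes a b :: real
  assumes row_le: "y \<in> A \<Longrightarrow> row y \<le> a" and col_le: "z \<in> B \<Longrightarrow> col z \<le> b"
    and w_le: "x \<in> S \<Longrightarrow> w x \<le> a * b" and a_nonneg: "0 \<le> a" and b_nonneg: "0 \<le> b"
begin

lemma coincidence_same:
  assumes "finite J" "i \<in> J" "j \<in> J" "i \<noteq> j"
  shows "E J (\<lambda>X. of_bool (fst (X i) = fst (X j)) * of_bool (snd (X i) = snd (X j))) \<le> a * b"
proof -
  have "E J (\<lambda>X. of_bool (fst (X i) = fst (X j)) * of_bool (snd (X i) = snd (X j))) =
    (\<Sum>x\<in>S. w x * (\<Sum>y\<in>S. w y * (of_bool (fst x = fst y) * of_bool (snd x = snd y))))"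
    using assms w_sum by (intro sample_mean_two_index) auto
  also have "\<dots> = (\<Sum>x\<in>S. w x * w x)"
    by (intro sum.cong refl) (auto simp: sum_both_eq mem_Times_iff)
  also have "\<dots> \<le> (\<Sum>x\<in>S. w x * (a * b))"
    by (intro sum_mono mult_left_mono w_le w_nonneg)
  finally show ?thesis by (simp add: sum_distrib_right[symmetric] w_sum)
qed

lemma coincidence_first:
  assumes "finite J" "i \<in> J" "j \<in> J" "i \<noteq> j"
  shows "E J (\<lambda>X. of_bool (fst (X i) = fst (X j))) \<le> a"
proof -
  have "E J (\<lambda>X. of_bool (fst (X i) = fst (X j))) = (\<Sum>x\<in>S. w x * (\<Sum>y\<in>S. w y * of_bool (fst x = fst y)))"
    using assms w_sum by (intro sample_mean_two_index) auto
  also have "\<dots> = (\<Sum>x\<in>S. w x * row (fst x))"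
    by (intro sum.cong refl) (auto simp: sum_first_eq)
  also have "\<dots> \<le> (\<Sum>x\<in>S. w x * a)"
    by (intro sum_mono mult_left_mono row_le w_nonneg) auto
  finally show ?thesis by (simp add: sum_distrib_right[symmetric] w_sum)
qed

text \<open>Index \<open>k\<close> does not occur in the Y-coincidence, so its draw can be averaged
  first and yields a column sum, at most \<open>b\<close>. This also works when \<open>l\<close> is
  \<open>i\<close> or \<open>j\<close>.\<close>

lemma coincidence_apart:
  assumes "finite J" "i \<in> J" "j \<in> J" "i \<noteq> j" "k \<in> J" "l \<in> J" "k \<noteq> l" "k \<noteq> i" "k \<noteq> j"
  shows "E J (\<lambda>X. of_bool (fst (X i) = fst (X j)) * of_bool (snd (X k) = snd (X l))) \<le> a * b"
proof -
  have "E J (\<lambda>X. of_bool (fst (X i) = fst (X j)) * of_bool (snd (X k) = snd (X l))) =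
    E (J - {k}) (\<lambda>X. of_bool (fst (X i) = fst (X j)) * (\<Sum>x\<in>S. w x * of_bool (snd (X l) = snd x)))"
    using assms by (subst sample_mean_peel[of _ k]) (auto simp: sum_distrib_left mult_ac eq_commute[of "snd (_ l)"])
  also have "\<dots> \<le> E (J - {k}) (\<lambda>X. b * of_bool (fst (X i) = fst (X j)))"
  proof (rule sample_mean_mono[OF w_nonneg])
    fix X assume "X \<in> PiE (J - {k}) (\<lambda>_. S)"
    then have "snd (X l) \<in> B" using assms(6,7) by (auto simp: PiE_iff mem_Times_iff)
    then show "of_bool (fst (X i) = fst (X j)) * (\<Sum>x\<in>S. w x * of_bool (snd (X l) = snd x))
      \<le> b * of_bool (fst (X i) = fst (X j))"
      by (simp add: sum_second_eq col_le)
  qed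
  also have "\<dots> \<le> b * a"
    unfolding sample_mean_cmult using assms b_nonneg by (intro mult_left_mono coincidence_first) auto
  finally show ?thesis by (simp add: mult.commute)
qed

text \<open>If the index pairs agree as sets, the bound on single cells applies; otherwise one index
  of the Z-pair is free and \<open>coincidence_apart\<close> applies, possibly after exchanging
  \<open>k\<close> and \<open>l\<close>. Permuted data need every such overlap.\<close>

lemma coincidence_le:
  assumes "finite J" "i \<in> J" "j \<in> J" "i \<noteq> j" "k \<in> J" "l \<in> J" "k \<noteq> l"
  shows "E J (\<lambda>X. of_bool (fst (X i) = fst (X j)) * of_bool (snd (X k) = snd (X l))) \<le> a * b"
proof (cases "k = i \<or> k = j")
  case False
  then show ?thesis using assms by (intro coincidence_apart) auto
next
  case True
  show ?thesis
  proof (cases "l = i \<or> l = j")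
    case False
    then show ?thesis
      using coincidence_apart[of J i j l k] assms by (simp add: eq_commute[of "snd (_ l)"])
  next
    case True
    with \<open>k = i \<or> k = j\<close> assms(7) have "k = i \<and> l = j \<or> k = j \<and> l = i" by auto
    then show ?thesis
      using coincidence_same[of J i j] assms by (auto simp: eq_commute[of "snd (_ j)"])
  qed
qed

text \<open>The Y-factor and the Z-factor have separate quadruples because under a permutation the
  Z-indices are images that may overlap the Y-indices in any way. Each squared contrast is at most 4
  times a sum of 4 coincidences, so the constant is 4 * 4 * 16.\<close>

lemma kernel_second_moment:
  assumes "finite J" "{i, j, k, l} \<subseteq> J" "distinct [i, j, k, l]" "{i', j', k', l'} \<subseteq> J" "distinct [i', j', k', l']"
  shows "E J (\<lambda>X. (contrast (fst (X i)) (fst (X j)) (fst (X k)) (fst (X l)) *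
     contrast (snd (X i')) (snd (X j')) (snd (X k')) (snd (X l')))\<^sup>2) \<le> 256 * (a * b)"
proof -
  let ?P = "{(i, j), (k, l), (i, k), (j, l)}" and ?P' = "{(i', j'), (k', l'), (i', k'), (j', l')}"
  have sumP: "(\<Sum>p\<in>?P. f p) = f (i, j) + f (k, l) + f (i, k) + f (j, l)" for f :: "'c \<times> 'c \<Rightarrow> real"
    using assms(3) by (auto simp: add.assoc)
  have sumP': "(\<Sum>p\<in>?P'. f p) = f (i', j') + f (k', l') + f (i', k') + f (j', l')" for f :: "'c \<times> 'c \<Rightarrow> real"
    using assms(5) by (auto simp: add.assoc)
  let ?y = "\<lambda>p X. of_bool (fst (X (fst p)) = fst (X (snd p))) :: real"
  let ?z = "\<lambda>p X. of_bool (snd (X (fst p)) = snd (X (snd p))) :: real"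
  have "E J (\<lambda>X. (contrast (fst (X i)) (fst (X j)) (fst (X k)) (fst (X l)) *
     contrast (snd (X i')) (snd (X j')) (snd (X k')) (snd (X l')))\<^sup>2) \<le>
     E J (\<lambda>X. 16 * (\<Sum>p\<in>?P. \<Sum>p'\<in>?P'. ?y p X * ?z p' X))"
  proof (rule sample_mean_mono[OF w_nonneg])
    fix X :: "'c \<Rightarrow> 'a \<times> 'b"
    have "(contrast (fst (X i)) (fst (X j)) (fst (X k)) (fst (X l)))\<^sup>2 \<le> 4 * (\<Sum>p\<in>?P. ?y p X)"
      using contrast_square_le[of "fst (X i)" "fst (X j)" "fst (X k)" "fst (X l)"] unfolding sumP by simp
    moreover have "(contrast (snd (X i')) (snd (X j')) (snd (X k')) (snd (X l')))\<^sup>2 \<le> 4 * (\<Sum>p\<in>?P'. ?z p X)"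
      using contrast_square_le[of "snd (X i')" "snd (X j')" "snd (X k')" "snd (X l')"] unfolding sumP' by simp
    ultimately have "(contrast (fst (X i)) (fst (X j)) (fst (X k)) (fst (X l)) *
     contrast (snd (X i')) (snd (X j')) (snd (X k')) (snd (X l')))\<^sup>2 \<le> (4 * (\<Sum>p\<in>?P. ?y p X)) * (4 * (\<Sum>p\<in>?P'. ?z p X))"
      unfolding power_mult_distrib by (intro mult_mono) (auto intro!: sum_nonneg)
    then show "(contrast (fst (X i)) (fst (X j)) (fst (X k)) (fst (X l)) *
     contrast (snd (X i')) (snd (X j')) (snd (X k')) (snd (X l')))\<^sup>2 \<le> 16 * (\<Sum>p\<in>?P. \<Sum>p'\<in>?P'. ?y p X * ?z p' X)"
      unfolding sum_product[symmetric] by simp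
  qed
  also have "\<dots> = 16 * (\<Sum>p\<in>?P. \<Sum>p'\<in>?P'. E J (\<lambda>X. ?y p X * ?z p' X))"
    unfolding sample_mean_cmult sample_mean_sum ..
  also have "\<dots> \<le> 16 * (\<Sum>p\<in>?P. \<Sum>p'\<in>?P'. a * b)"
  proof (intro mult_left_mono sum_mono)
    fix p p' assume "p \<in> ?P" "p' \<in> ?P'"
    then have "fst p \<in> J" "snd p \<in> J" "fst p \<noteq> snd p" "fst p' \<in> J" "snd p' \<in> J" "fst p' \<noteq> snd p'"
      using assms by auto
    then show "E J (\<lambda>X. ?y p X * ?z p' X) \<le> a * b"
      by (intro coincidence_le assms(1))
  qed simp
  also have "\<dots> = 256 * (a * b)"
    unfolding sumP sumP' by simp
  finally show ?thesis .
qed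

lemma row_le_1: "y \<in> A \<Longrightarrow> row y \<le> 1"
  using member_le_sum[of y A row] sum_row finite_A row_nonneg by simp

lemma col_le_1: "z \<in> B \<Longrightarrow> col z \<le> 1"
  using member_le_sum[of z B col] sum_col finite_B col_nonneg by simp

lemma row_col_le:
  assumes "x \<in> S"
  shows "0 \<le> row (fst x) * col (snd x)" "row (fst x) * col (snd x) \<le> a * b" "row (fst x) * col (snd x) \<le> 1"
proof -
  have x: "fst x \<in> A" "snd x \<in> B" using assms by auto
  show "0 \<le> row (fst x) * col (snd x)" using x row_nonneg col_nonneg by simp
  show "row (fst x) * col (snd x) \<le> a * b" using x row_nonneg col_nonneg row_le col_le a_nonneg by (intro mult_mono) auto
  show "row (fst x) * col (snd x) \<le> 1" using mult_mono[of "row (fst x)" 1 "col (snd x)" 1] x row_nonneg col_nonneg row_le_1 col_le_1 by auto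
qed

lemma dependence_nonneg: "0 \<le> dependence" unfolding dependence_def by (intro sum_nonneg) simp

text \<open>The absolute deviations sum to at most 2, so the sum of squares is at most twice the
  largest deviation. That one is bounded both by \<open>a * b\<close> and by 1.\<close>

lemma dependence_le: "dependence \<le> 2 * (a * b)" "dependence \<le> 2"
proof -
  have abs: "(\<Sum>x\<in>S. \<bar>dev x\<bar>) \<le> 2"
  proof -
    have "(\<Sum>x\<in>S. \<bar>dev x\<bar>) \<le> (\<Sum>x\<in>S. w x + row (fst x) * col (snd x))"
      using w_nonneg row_col_le(1) by (intro sum_mono) (force simp: dev_def)
    also have "\<dots> = 1 + (\<Sum>y\<in>A. row y) * (\<Sum>z\<in>B. col z)"
      by (simp add: sum.distrib w_sum sum_product sum.cartesian_product case_prod_unfold)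
    finally show ?thesis by (simp add: sum_row sum_col)
  qed
  have w1: "w x \<le> 1" if "x \<in> S" for x
    using member_le_sum[of x S w] w_sum finite_S w_nonneg that by simp
  have gen: "dependence \<le> 2 * c" if c: "0 \<le> c" "\<And>x. x \<in> S \<Longrightarrow> w x \<le> c \<and> row (fst x) * col (snd x) \<le> c" for c
  proof -
    have "dependence \<le> (\<Sum>x\<in>S. c * \<bar>dev x\<bar>)"
      unfolding dependence_def
    proof (rule sum_mono)
      fix x assume x: "x \<in> S"
      have "\<bar>dev x\<bar> \<le> c" using c(2)[OF x] w_nonneg[OF x] row_col_le(1)[OF x] by (simp add: dev_def abs_le_iff)
      from mult_right_mono[OF this, of "\<bar>dev x\<bar>"] show "(dev x)\<^sup>2 \<le> c * \<bar>dev x\<bar>"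
        by (simp add: power2_eq_square)
    qed
    also have "\<dots> \<le> c * 2" unfolding sum_distrib_left[symmetric] using abs c(1) by (intro mult_left_mono)
    finally show ?thesis by simp
  qed
  show "dependence \<le> 2 * (a * b)" by (rule gen) (use w_le row_col_le a_nonneg b_nonneg in auto)
  show "dependence \<le> 2" using gen[of 1] w1 row_col_le by auto
qed

text \<open>Each of the four terms averages the square of \<open>dev\<close> against
  \<open>w\<close> or against \<open>row * col\<close>, and both weights are at most
  \<open>a * b\<close>. Keeping the factor \<open>dependence\<close> is essential: it makes the
  variance contribution of order 1/n small when the alternative is weak.\<close>

lemma dev_pair_second_moment:
  assumes "finite J" "i \<in> J" "l \<in> J" "i \<noteq> l"
  shows "E J (\<lambda>X. (dev_pair (X i) (X l))\<^sup>2) \<le> 16 * (a * b * dependence)"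
proof -
  define D where "D y z = (dev (y, z))\<^sup>2" for y z
  have one: "E J (\<lambda>X. D (fst (X i)) (snd (X i))) \<le> a * b * dependence" if "i \<in> J" for i
  proof -
    have "E J (\<lambda>X. D (fst (X i)) (snd (X i))) = (\<Sum>x\<in>S. w x * D (fst x) (snd x))"
      using assms(1) that w_sum by (intro sample_mean_one_index[where f = "\<lambda>x. D (fst x) (snd x)"]) auto
    also have "\<dots> \<le> (\<Sum>x\<in>S. a * b * D (fst x) (snd x))"
      by (intro sum_mono mult_right_mono w_le) (auto simp: D_def)
    finally show ?thesis by (simp add: D_def dependence_def sum_distrib_left)
  qed
  have two: "E J (\<lambda>X. D (fst (X i)) (snd (X l))) \<le> a * b * dependence" if "i \<in> J" "l \<in> J" "i \<noteq> l" for i l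
  proof -
    have "E J (\<lambda>X. D (fst (X i)) (snd (X l))) = (\<Sum>x\<in>S. w x * (\<Sum>x'\<in>S. w x' * D (fst x) (snd x')))"
      using assms(1) that w_sum by (intro sample_mean_two_index[where f = "\<lambda>x x'. D (fst x) (snd x')"]) auto
    also have "\<dots> = (\<Sum>c\<in>S. row (fst c) * col (snd c) * D (fst c) (snd c))"
      by (rule sum_cross)
    also have "\<dots> \<le> (\<Sum>x\<in>S. a * b * D (fst x) (snd x))"
      by (intro sum_mono mult_right_mono row_col_le) (auto simp: D_def)
    finally show ?thesis by (simp add: D_def dependence_def sum_distrib_left)
  qed
  have "E J (\<lambda>X. (dev_pair (X i) (X l))\<^sup>2) \<le>
    E J (\<lambda>X. 4 * (D (fst (X i)) (snd (X i)) + D (fst (X i)) (snd (X l)) + D (fst (X l)) (snd (X i)) + D (fst (X l)) (snd (X l))))"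
  proof (rule sample_mean_mono[OF w_nonneg])
    fix X :: "'c \<Rightarrow> 'a \<times> 'b"
    show "(dev_pair (X i) (X l))\<^sup>2 \<le> 4 * (D (fst (X i)) (snd (X i)) + D (fst (X i)) (snd (X l)) + D (fst (X l)) (snd (X i)) + D (fst (X l)) (snd (X l)))"
      using square_add4_le[of "dev (fst (X i), snd (X i))" "- dev (fst (X i), snd (X l))" "- dev (fst (X l), snd (X i))" "dev (fst (X l), snd (X l))"]
      by (simp add: dev_pair_def D_def)
  qed
  also have "\<dots> \<le> 16 * (a * b * dependence)"
    unfolding sample_mean_cmult sample_mean_add
    using one[OF assms(2)] one[OF assms(3)] two[OF assms(2-4)] two[OF assms(3,2)] assms(4) by auto
  finally show ?thesis .
qed

text \<open>Crude centring by (x - y)^2 at most 2 x^2 + 2 y^2. With \<open>dependence\<close> at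
  most 2 \<open>a * b\<close> the constant is 2 * 16 + 8 * 2.\<close>

lemma centred_dev_pair_second_moment:
  assumes "finite J" "i \<in> J" "l \<in> J" "i \<noteq> l"
  shows "E J (\<lambda>X. (dev_pair (X i) (X l) - 2 * dependence)\<^sup>2) \<le> 48 * (a * b * dependence)"
proof -
  have "E J (\<lambda>X. (dev_pair (X i) (X l) - 2 * dependence)\<^sup>2) \<le>
    E J (\<lambda>X. 2 * (dev_pair (X i) (X l))\<^sup>2 + 8 * (dependence * dependence))"
  proof (rule sample_mean_mono[OF w_nonneg])
    fix X :: "'c \<Rightarrow> 'a \<times> 'b"
    show "(dev_pair (X i) (X l) - 2 * dependence)\<^sup>2 \<le> 2 * (dev_pair (X i) (X l))\<^sup>2 + 8 * (dependence * dependence)"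
      using zero_le_power2[of "dev_pair (X i) (X l) + 2 * dependence"] by (simp add: power2_eq_square algebra_simps)
  qed
  also have "\<dots> = 2 * E J (\<lambda>X. (dev_pair (X i) (X l))\<^sup>2) + 8 * (dependence * dependence)"
    by (simp add: sample_mean_add sample_mean_cmult sample_mean_const assms(1) w_sum)
  also have "\<dots> \<le> 2 * (16 * (a * b * dependence)) + 8 * (2 * (a * b) * dependence)"
    using dev_pair_second_moment[OF assms] dependence_le dependence_nonneg
    by (intro add_mono mult_left_mono mult_right_mono) auto
  finally show ?thesis by simp
qed

text \<open>Here a factor \<open>dependence\<close> may be lost, so it is replaced by its bound 2:
  the constant is 4 * (256 + 128 + 128 + 64).\<close>

lemma degenerate_second_moment:
  assumes "finite J" "{i, j, k, l} \<subseteq> J" "distinct [i, j, k, l]"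
  shows "E J (\<lambda>X. (degenerate_kernel (X i) (X j) (X k) (X l))\<^sup>2) \<le> 2304 * (a * b)"
proof -
  have "E J (\<lambda>X. (degenerate_kernel (X i) (X j) (X k) (X l))\<^sup>2) \<le>
    E J (\<lambda>X. 4 * ((label_kernel (X i) (X j) (X k) (X l))\<^sup>2 + 4 * (dev_pair (X i) (X l))\<^sup>2
       + 4 * (dev_pair (X j) (X k))\<^sup>2 + 16 * (dependence * dependence)))"
  proof (rule sample_mean_mono[OF w_nonneg])
    fix X :: "'c \<Rightarrow> 'a \<times> 'b"
    show "(degenerate_kernel (X i) (X j) (X k) (X l))\<^sup>2 \<le> 4 * ((label_kernel (X i) (X j) (X k) (X l))\<^sup>2 + 4 * (dev_pair (X i) (X l))\<^sup>2
       + 4 * (dev_pair (X j) (X k))\<^sup>2 + 16 * (dependence * dependence))"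
      using square_add4_le[of "label_kernel (X i) (X j) (X k) (X l)" "- 2 * dev_pair (X i) (X l)" "- 2 * dev_pair (X j) (X k)" "4 * dependence"]
      by (simp add: degenerate_kernel_def power_mult_distrib power2_eq_square)
  qed
  also have "\<dots> = 4 * (E J (\<lambda>X. (label_kernel (X i) (X j) (X k) (X l))\<^sup>2) + 4 * E J (\<lambda>X. (dev_pair (X i) (X l))\<^sup>2)
       + 4 * E J (\<lambda>X. (dev_pair (X j) (X k))\<^sup>2) + 16 * (dependence * dependence))"
    by (simp add: sample_mean_add sample_mean_cmult sample_mean_const assms(1) w_sum)
  also have "\<dots> \<le> 4 * (256 * (a * b) + 4 * (16 * (a * b * 2)) + 4 * (16 * (a * b * 2)) + 16 * (2 * (a * b) * 2))"
  proof -
    have 1: "E J (\<lambda>X. (label_kernel (X i) (X j) (X k) (X l))\<^sup>2) \<le> 256 * (a * b)"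
      unfolding label_kernel_def using assms by (intro kernel_second_moment)
    have 2: "E J (\<lambda>X. (dev_pair (X i) (X l))\<^sup>2) \<le> 16 * (a * b * 2)" if "i \<in> J" "l \<in> J" "i \<noteq> l" for i l
    proof -
      have "a * b * dependence \<le> a * b * 2"
        using dependence_le a_nonneg b_nonneg by (intro mult_left_mono) auto
      then show ?thesis using dev_pair_second_moment[OF assms(1) that] by simp
    qed
    have 3: "dependence * dependence \<le> 2 * (a * b) * 2"
      using dependence_le dependence_nonneg a_nonneg b_nonneg by (intro mult_mono) auto
    show ?thesis using 1 2[of i l] 2[of j k] 3 assms(2,3) by (intro mult_left_mono add_mono) auto
  qed
  finally show ?thesis by simp
qed

end

section \<open>Random permutations and the critical value\<close>

lemma permutes_quad:
  assumes "\<pi> permutes {1..n}" "{i, j, k, l} \<subseteq> {1..n}" "distinct [i, j, k, l]"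
  shows "{\<pi> i, \<pi> j, \<pi> k, \<pi> l} \<subseteq> {1..n}" "distinct [\<pi> i, \<pi> j, \<pi> k, \<pi> l]"
  using assms permutes_in_image[OF assms(1)] permutes_inj[OF assms(1), THEN inj_eq] by auto

text \<open>Exchanging the partners of \<open>i\<close> and \<open>l\<close>, or of \<open>j\<close> and \<open>k\<close>, reverses the sign of the
  contrast of the second components.\<close>

lemma sum_permutes_contrast_zero:
  fixes g :: "(nat \<Rightarrow> nat) \<Rightarrow> real"
  assumes ij: "{i, j, k, l} \<subseteq> {1..n}" "distinct [i, j, k, l]"
    and uv: "(u, v) = (i, l) \<or> (u, v) = (j, k)"
    and g: "\<And>\<pi>. g (\<pi> \<circ> Transposition.transpose u v) = g \<pi>"
  shows "(\<Sum>\<pi> | \<pi> permutes {1..n}. contrast (z (\<pi> i)) (z (\<pi> j)) (z (\<pi> k)) (z (\<pi> l)) * g \<pi>) = 0"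
proof -
  let ?f = "\<lambda>\<pi>. contrast (z (\<pi> i)) (z (\<pi> j)) (z (\<pi> k)) (z (\<pi> l)) * g \<pi>"
  have t: "Transposition.transpose u v permutes {1..n}" using ij(1) uv by (auto intro: permutes_swap_id)
  have "?f (\<pi> \<circ> Transposition.transpose u v) = - ?f \<pi>" for \<pi>
    using uv
  proof
    assume "(u, v) = (i, l)"
    then show ?thesis unfolding g using ij(2)
      by (simp add: contrast_swap_outer[of "z (\<pi> l)"])
  next
    assume "(u, v) = (j, k)"
    then show ?thesis unfolding g using ij(2)
      by (simp add: contrast_swap_inner[of "z (\<pi> i)" "z (\<pi> k)"])
  qed
  moreover have "(\<Sum>\<pi> | \<pi> permutes {1..n}. ?f \<pi>) = (\<Sum>\<pi> | \<pi> permutes {1..n}. ?f (\<pi> \<circ> Transposition.transpose u v))"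
    by (rule sum_permutations_compose_right[OF t])
  ultimately show ?thesis by (simp add: sum_negf)
qed

lemma card_permutes: "card {\<pi>. \<pi> permutes {1..n}} = fact n"
  using card_permutations[of "{1..n}" n] by simp

text \<open>The permutation distribution function is a right-continuous step function with finitely
  many jumps, so the set under the infimum is nonempty, bounded below and contains its infimum. The
  first fact bounds the critical value from above for the power, the second counts the permutations
  below it for the level.\<close>

lemma label_crit_facts:
  fixes X :: "nat \<Rightarrow> 'y \<times> 'z" and n :: nat and \<alpha> :: real
  assumes "0 < \<alpha>" "\<alpha> < 1"
  defines "U \<equiv> label_U_perm n X" and "Perms \<equiv> {\<pi>. \<pi> permutes {1..n}}"
  shows "real (card {\<pi> \<in> Perms. U \<pi> \<le> t}) \<ge> (1 - \<alpha>) * fact n \<Longrightarrow> label_crit n \<alpha> X \<le> t"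
    and "real (card {\<pi> \<in> Perms. U \<pi> \<le> label_crit n \<alpha> X}) \<ge> (1 - \<alpha>) * fact n"
proof -
  have fin: "finite Perms" unfolding Perms_def by (rule finite_permutations) simp
  define T where "T = {t. real (card {\<pi> \<in> Perms. U \<pi> \<le> t}) \<ge> (1 - \<alpha>) * fact n}"
  have crit: "label_crit n \<alpha> X = Inf T"
  proof -
    have "(\<Sum>\<pi> | \<pi> permutes {1..n}. if U \<pi> \<le> t then 1 else (0::real)) = real (card {\<pi> \<in> Perms. U \<pi> \<le> t})" for t
      using fin by (subst sum.inter_filter[symmetric]) (auto simp: Perms_def)
    then show ?thesis
      unfolding label_crit_def U_def[symmetric] T_def by (simp add: field_simps)
  qed
  have ne: "T \<noteq> {}"
  proof -
    have "{\<pi> \<in> Perms. U \<pi> \<le> Max (U ` Perms)} = Perms" using fin by auto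
    then have "Max (U ` Perms) \<in> T"
      using assms(1) card_permutes[of n] by (simp add: T_def Perms_def)
    then show ?thesis by auto
  qed
  have bdd: "bdd_below T"
  proof (rule bdd_belowI)
    fix t assume "t \<in> T"
    then have "card {\<pi> \<in> Perms. U \<pi> \<le> t} > 0"
      using assms(2) mult_pos_pos[of "1 - \<alpha>" "fact n"] unfolding T_def
      by (metis (mono_tags, lifting) diff_gt_0_iff_gt fact_gt_zero gr0I mem_Collect_eq not_le of_nat_0)
    then obtain \<pi> where "\<pi> \<in> Perms" "U \<pi> \<le> t" by (auto simp: card_gt_0_iff)
    then show "Min (U ` Perms) \<le> t" using fin by (meson Min_le finite_imageI imageI order_trans)
  qed
  show "label_crit n \<alpha> X \<le> t" if "real (card {\<pi> \<in> Perms. U \<pi> \<le> t}) \<ge> (1 - \<alpha>) * fact n"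
    unfolding crit using that bdd by (intro cInf_lower) (auto simp: T_def)
  let ?V = "{\<pi> \<in> Perms. U \<pi> > Inf T}"
  have "Inf T \<in> T"
  proof -
    \<comment> \<open>Only finitely many permuted values exceed the infimum. An admissible t below
      the smallest of them counts no permutation that the infimum itself does not count.\<close>
    have "\<exists>t\<in>T. \<forall>\<pi>\<in>?V. t < U \<pi>"
    proof (cases "?V = {}")
      case True
      then show ?thesis using ne by blast
    next
      case False
      then have "Inf T < Min (U ` ?V)" using fin by (subst Min_gr_iff) auto
      then obtain t where "t \<in> T" "t < Min (U ` ?V)" using cInf_lessD[OF ne] by blast
      moreover have "t < U \<pi>" if "\<pi> \<in> ?V" for \<pi>
      proof -
        have "Min (U ` ?V) \<le> U \<pi>" using fin that by (intro Min_le) auto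
        then show ?thesis using \<open>t < Min (U ` ?V)\<close> by linarith
      qed
      ultimately show ?thesis by blast
    qed
    then obtain t where t: "t \<in> T" "\<And>\<pi>. \<pi> \<in> Perms \<Longrightarrow> Inf T < U \<pi> \<Longrightarrow> t < U \<pi>" by auto
    have "card {\<pi> \<in> Perms. U \<pi> \<le> t} \<le> card {\<pi> \<in> Perms. U \<pi> \<le> Inf T}"
      using fin t(2) by (intro card_mono) (auto simp: not_less[symmetric])
    then have "real (card {\<pi> \<in> Perms. U \<pi> \<le> t}) \<le> real (card {\<pi> \<in> Perms. U \<pi> \<le> Inf T})"
      by (rule of_nat_mono)
    moreover have "(1 - \<alpha>) * fact n \<le> real (card {\<pi> \<in> Perms. U \<pi> \<le> t})"
      using t(1) unfolding T_def by (rule CollectD)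
    ultimately have "(1 - \<alpha>) * fact n \<le> real (card {\<pi> \<in> Perms. U \<pi> \<le> Inf T})"
      by linarith
    then show ?thesis by (subst T_def) (rule CollectI)
  qed
  then show "real (card {\<pi> \<in> Perms. U \<pi> \<le> label_crit n \<alpha> X}) \<ge> (1 - \<alpha>) * fact n"
    unfolding crit by (subst (asm) T_def) (rule CollectD)
qed

text \<open>By Markov's inequality for the squares, at most \<alpha> n! permutations have a
  statistic above t, so the remaining ones suffice for the quantile.\<close>

lemma label_crit_le_Chebyshev:
  fixes X :: "nat \<Rightarrow> 'y \<times> 'z"
  assumes "0 < \<alpha>" "\<alpha> < 1" "0 < t"
    and Q: "(\<Sum>\<pi> | \<pi> permutes {1..n}. (label_U_perm n X \<pi>)\<^sup>2) / fact n \<le> \<alpha> * t\<^sup>2"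
  shows "label_crit n \<alpha> X \<le> t"
proof (rule label_crit_facts(1)[OF assms(1,2)])
  let ?P = "{\<pi>. \<pi> permutes {1..n}}"
  have fin: "finite ?P" by (rule finite_permutations) simp
  have "t\<^sup>2 * real (card {\<pi> \<in> ?P. label_U_perm n X \<pi> > t}) = (\<Sum>\<pi>\<in>{\<pi> \<in> ?P. label_U_perm n X \<pi> > t}. t\<^sup>2)"
    by simp
  also have "\<dots> \<le> (\<Sum>\<pi>\<in>{\<pi> \<in> ?P. label_U_perm n X \<pi> > t}. (label_U_perm n X \<pi>)\<^sup>2)"
    using assms(3) by (intro sum_mono power_mono) auto
  also have "\<dots> \<le> (\<Sum>\<pi>\<in>?P. (label_U_perm n X \<pi>)\<^sup>2)"
    using fin by (intro sum_mono2) auto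
  also have "\<dots> \<le> t\<^sup>2 * (\<alpha> * fact n)" using Q by (simp add: field_simps)
  finally have "real (card {\<pi> \<in> ?P. label_U_perm n X \<pi> > t}) \<le> \<alpha> * fact n"
    using assms(3) by simp
  moreover have "card {\<pi> \<in> ?P. label_U_perm n X \<pi> > t} + card {\<pi> \<in> ?P. label_U_perm n X \<pi> \<le> t} = card ?P"
    using fin by (subst card_Un_disjoint[symmetric]) (auto intro!: arg_cong[of _ _ card])
  then have "real (card {\<pi> \<in> ?P. label_U_perm n X \<pi> > t}) + real (card {\<pi> \<in> ?P. label_U_perm n X \<pi> \<le> t}) = fact n"
    unfolding card_permutes of_nat_add[symmetric] by (simp only: of_nat_fact)
  ultimately show "(1 - \<alpha>) * fact n \<le> real (card {\<pi> \<in> ?P. label_U_perm n X \<pi> \<le> t})"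
    by (simp add: algebra_simps)
qed

section \<open>Variance of the statistic and power for labelled data\<close>

context bounded_contingency_table
begin

lemma quad_average_second_moment:
  fixes F :: "nat \<times> nat \<times> nat \<times> nat \<Rightarrow> (nat \<Rightarrow> 'a \<times> 'b) \<Rightarrow> real"
  assumes "\<And>I I'. I \<in> distinct_quads n \<Longrightarrow> I' \<in> distinct_quads n \<Longrightarrow> I' \<notin> R I \<Longrightarrow>
      E {1..n} (\<lambda>X. F I X * F I' X) = 0"
    and "\<And>I. I \<in> distinct_quads n \<Longrightarrow> E {1..n} (\<lambda>X. (F I X)\<^sup>2) \<le> v"
    and "\<And>I. I \<in> distinct_quads n \<Longrightarrow>
      real (card (R I \<inter> distinct_quads n)) \<le> m * real (card (distinct_quads n))"
    and "0 \<le> v" "0 \<le> m"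
  shows "E {1..n} (\<lambda>X. ((\<Sum>I\<in>distinct_quads n. F I X) / real (card (distinct_quads n)))\<^sup>2) \<le> m * v"
proof -
  have p: "0 \<le> (\<Prod>i\<in>{1..n}. w (X i))" if "X \<in> PiE {1..n} (\<lambda>_. S)" for X
    by (intro prod_nonneg w_nonneg PiE_mem[OF that])
  show ?thesis
    using assms(1,2) unfolding sample_mean_def
    by (intro second_moment_average[where R = R] finite_distinct_quads p assms(3-5))
qed

text \<open>The selectors \<open>p\<close> and \<open>q\<close> let one proof serve for the pair of
  outer indices and for the pair of inner indices. Terms with disjoint pairs are orthogonal because
  the centred \<open>dev_pair\<close> has mean zero.\<close>

lemma dev_pair_average_second_moment:
  fixes p q :: "nat \<times> nat \<times> nat \<times> nat \<Rightarrow> nat"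
  assumes pq: "\<And>I. I \<in> distinct_quads n \<Longrightarrow> p I \<in> {1..n} \<and> q I \<in> {1..n} \<and> p I \<noteq> q I"
    and R: "\<And>I. I \<in> distinct_quads n \<Longrightarrow>
      real (card ({I'. p I' \<in> {p I, q I} \<or> q I' \<in> {p I, q I}} \<inter> distinct_quads n))
      \<le> 48 / real n * real (card (distinct_quads n))"
  shows "E {1..n} (\<lambda>X. ((\<Sum>I\<in>distinct_quads n. dev_pair (X (p I)) (X (q I)) - 2 * dependence)
      / real (card (distinct_quads n)))\<^sup>2) \<le> 48 / real n * (48 * (a * b * dependence))"
proof (rule quad_average_second_moment[where R = "\<lambda>I. {I'. p I' \<in> {p I, q I} \<or> q I' \<in> {p I, q I}}"])
  have centred: "(\<Sum>x\<in>S. w x * (\<Sum>x'\<in>S. w x' * ((dev_pair x x' - 2 * dependence) * c))) = 0" for c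
  proof -
    have "(\<Sum>x\<in>S. w x * (\<Sum>x'\<in>S. w x' * ((dev_pair x x' - 2 * dependence) * c))) =
      ((\<Sum>x\<in>S. w x * (\<Sum>x'\<in>S. w x' * dev_pair x x')) - (\<Sum>x\<in>S. w x * (\<Sum>x'\<in>S. w x' * (2 * dependence)))) * c"
      by (simp add: sum_subtractf[symmetric] sum_distrib_left sum_distrib_right algebra_simps)
    also have "\<dots> = 0" unfolding mean_dev_pair by (simp add: sum_distrib_right[symmetric] w_sum)
    finally show ?thesis .
  qed
  fix I assume I: "I \<in> distinct_quads n"
  show "E {1..n} (\<lambda>X. (dev_pair (X (p I)) (X (q I)) - 2 * dependence)\<^sup>2) \<le> 48 * (a * b * dependence)"
    using pq[OF I] by (intro centred_dev_pair_second_moment) auto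
  fix I' assume "I' \<in> distinct_quads n" "I' \<notin> {I'. p I' \<in> {p I, q I} \<or> q I' \<in> {p I, q I}}"
  then show "E {1..n} (\<lambda>X. (dev_pair (X (p I)) (X (q I)) - 2 * dependence) *
      (dev_pair (X (p I')) (X (q I')) - 2 * dependence)) = 0"
    using pq[OF I] by (intro sample_mean_indep_zero[of _ "p I" "q I"]) (auto simp: centred)
qed (use R a_nonneg b_nonneg dependence_nonneg in auto)

text \<open>A Hoeffding-type decomposition: the centred kernel is twice a centred
  \<open>dev_pair\<close> in the outer pair, plus twice one in the inner pair, plus the degenerate
  part. The former need one shared index to be correlated, which gives 1/n with the factor
  \<open>dependence\<close>; the latter needs an index in each of its two pairs, which gives
  1/n^2.\<close>

lemma U_second_moment:
  assumes "n \<ge> 4"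
  shows "E {1..n} (\<lambda>X. (label_U n X - 4 * dependence)\<^sup>2)
    \<le> 55296 * (a * b * dependence) / real n + 3538944 * (a * b) / (real n)\<^sup>2"
proof -
  let ?J = "{1..n}" and ?Q = "distinct_quads n"
  define F1 F2 G :: "nat \<times> nat \<times> nat \<times> nat \<Rightarrow> (nat \<Rightarrow> 'a \<times> 'b) \<Rightarrow> real"
    where "F1 = (\<lambda>(i, j, k, l) X. dev_pair (X i) (X l) - 2 * dependence)"
      and "F2 = (\<lambda>(i, j, k, l) X. dev_pair (X j) (X k) - 2 * dependence)"
      and "G = (\<lambda>(i, j, k, l) X. degenerate_kernel (X i) (X j) (X k) (X l))"
  have abd: "0 \<le> a * b" using a_nonneg b_nonneg by simp
  have m1: "E ?J (\<lambda>X. ((\<Sum>I\<in>?Q. F1 I X) / real (card ?Q))\<^sup>2) \<le> 48 / real n * (48 * (a * b * dependence))"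
  proof -
    have "real (card ({I'. fst I' \<in> {fst I, snd (snd (snd I))} \<or> snd (snd (snd I')) \<in> {fst I, snd (snd (snd I))}} \<inter> ?Q))
      \<le> 48 / real n * real (card ?Q)" for I :: "nat \<times> nat \<times> nat \<times> nat"
      using card_quads_meeting_pair(1)[OF assms, of "{fst I, snd (snd (snd I))}"] by (simp add: case_prod_unfold card_insert_if)
    then show ?thesis
      unfolding F1_def case_prod_unfold by (intro dev_pair_average_second_moment) (auto simp: distinct_quads_def)
  qed
  have m2: "E ?J (\<lambda>X. ((\<Sum>I\<in>?Q. F2 I X) / real (card ?Q))\<^sup>2) \<le> 48 / real n * (48 * (a * b * dependence))"
  proof -
    have "real (card ({I'. fst (snd I') \<in> {fst (snd I), fst (snd (snd I))} \<or> fst (snd (snd I')) \<in> {fst (snd I), fst (snd (snd I))}} \<inter> ?Q))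
      \<le> 48 / real n * real (card ?Q)" for I :: "nat \<times> nat \<times> nat \<times> nat"
      using card_quads_meeting_pair(2)[OF assms, of "{fst (snd I), fst (snd (snd I))}"] by (simp add: case_prod_unfold card_insert_if)
    then show ?thesis
      unfolding F2_def case_prod_unfold by (intro dev_pair_average_second_moment) (auto simp: distinct_quads_def)
  qed
  have m3: "E ?J (\<lambda>X. ((\<Sum>I\<in>?Q. G I X) / real (card ?Q))\<^sup>2) \<le> 512 / (real n)\<^sup>2 * (2304 * (a * b))"
  proof (rule quad_average_second_moment[where R = "\<lambda>(i, j, k, l). {(a, b, c, d). {a, b, c, d} \<inter> {i, l} \<noteq> {} \<and> {a, b, c, d} \<inter> {j, k} \<noteq> {}}"])
    fix I I' assume I: "I \<in> ?Q" "I' \<in> ?Q" "I' \<notin> (case I of (i, j, k, l) \<Rightarrow>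
       {(a, b, c, d). {a, b, c, d} \<inter> {i, l} \<noteq> {} \<and> {a, b, c, d} \<inter> {j, k} \<noteq> {}})"
    obtain i j k l i' j' k' l' where eq: "I = (i, j, k, l)" "I' = (i', j', k', l')" by (metis prod_cases4)
    have d: "{i, j, k, l} \<subseteq> ?J" "distinct [i, j, k, l]" using I(1) by (auto simp: eq distinct_quads_def)
    \<comment> \<open>The second quadruple misses the outer or the inner pair of the first.
      Averaging over the missed pair leaves the second factor constant and annihilates the
      first.\<close>
    from I(3) consider "{i', j', k', l'} \<inter> {i, l} = {}" | "{i', j', k', l'} \<inter> {j, k} = {}" by (auto simp: eq)
    then show "E ?J (\<lambda>X. G I X * G I' X) = 0"
    proof cases
      case 1
      have zero: "(\<Sum>x\<in>S. w x * (\<Sum>y\<in>S. w y * (degenerate_kernel x (X j) (X k) y * c))) = 0"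
        if "X \<in> PiE (?J - {l} - {i}) (\<lambda>_. S)" for X c
      proof -
        have "X j \<in> S" "X k \<in> S" using d by (auto intro!: PiE_mem[OF that])
        from mean_degenerate_outer[OF this] have "(\<Sum>x\<in>S. w x * (\<Sum>y\<in>S. w y * degenerate_kernel x (X j) (X k) y)) * c = 0" by simp
        then show ?thesis by (simp only: sum_distrib_right mult.assoc)
      qed
      show ?thesis
      proof (rule sample_mean_indep_zero[of _ i l])
        fix X assume X: "X \<in> PiE (?J - {l} - {i}) (\<lambda>_. S)"
        have "G I (X(i := x, l := y)) * G I' (X(i := x, l := y)) = degenerate_kernel x (X j) (X k) y * G I' X" for x y
        proof -
          have "i \<noteq> l" "j \<noteq> i" "j \<noteq> l" "k \<noteq> i" "k \<noteq> l" "i' \<noteq> i" "i' \<noteq> l" "j' \<noteq> i" "j' \<noteq> l" "k' \<noteq> i" "k' \<noteq> l" "l' \<noteq> i" "l' \<noteq> l"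
            using 1 d(2) by auto
          then show ?thesis by (simp add: eq G_def)
        qed
        then show "(\<Sum>x\<in>S. w x * (\<Sum>y\<in>S. w y * (G I (X(i := x, l := y)) * G I' (X(i := x, l := y))))) = 0"
          by (simp only: zero[OF X])
      qed (use d in auto)
    next
      case 2
      have zero: "(\<Sum>x\<in>S. w x * (\<Sum>y\<in>S. w y * (degenerate_kernel (X i) x y (X l) * c))) = 0"
        if "X \<in> PiE (?J - {k} - {j}) (\<lambda>_. S)" for X c
      proof -
        have "X i \<in> S" "X l \<in> S" using d by (auto intro!: PiE_mem[OF that])
        from mean_degenerate_inner[OF this] have "(\<Sum>x\<in>S. w x * (\<Sum>y\<in>S. w y * degenerate_kernel (X i) x y (X l))) * c = 0" by simp
        then show ?thesis by (simp only: sum_distrib_right mult.assoc)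
      qed
      show ?thesis
      proof (rule sample_mean_indep_zero[of _ j k])
        fix X assume X: "X \<in> PiE (?J - {k} - {j}) (\<lambda>_. S)"
        have "G I (X(j := x, k := y)) * G I' (X(j := x, k := y)) = degenerate_kernel (X i) x y (X l) * G I' X" for x y
        proof -
          have "j \<noteq> k" "i \<noteq> j" "i \<noteq> k" "l \<noteq> j" "l \<noteq> k" "i' \<noteq> j" "i' \<noteq> k" "j' \<noteq> j" "j' \<noteq> k" "k' \<noteq> j" "k' \<noteq> k" "l' \<noteq> j" "l' \<noteq> k"
            using 2 d(2) by auto
          then show ?thesis by (simp add: eq G_def)
        qed
        then show "(\<Sum>x\<in>S. w x * (\<Sum>y\<in>S. w y * (G I (X(j := x, k := y)) * G I' (X(j := x, k := y))))) = 0"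
          by (simp only: zero[OF X])
      qed (use d in auto)
    qed
  next
    fix I assume I: "I \<in> ?Q"
    obtain i j k l where eq: "I = (i, j, k, l)" by (metis prod_cases4)
    show "E ?J (\<lambda>X. (G I X)\<^sup>2) \<le> 2304 * (a * b)"
      using I unfolding eq G_def prod.case by (intro degenerate_second_moment) (auto simp: distinct_quads_def)
    show "real (card ((case I of (i, j, k, l) \<Rightarrow> {(a, b, c, d). {a, b, c, d} \<inter> {i, l} \<noteq> {} \<and> {a, b, c, d} \<inter> {j, k} \<noteq> {}}) \<inter> ?Q))
      \<le> 512 / (real n)\<^sup>2 * real (card ?Q)"
      using I unfolding eq prod.case
      by (intro card_quads_meeting_two_pairs assms) (auto simp: card_insert_if distinct_quads_def)
  qed (use abd in auto)
  \<comment> \<open>The square of a sum of three terms is at most three times the sum of the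
    squares; the coefficients 2, 2, 1 of the decomposition turn into 12, 12, 3.\<close>
  have "E ?J (\<lambda>X. (label_U n X - 4 * dependence)\<^sup>2) \<le> E ?J (\<lambda>X. 12 * ((\<Sum>I\<in>?Q. F1 I X) / real (card ?Q))\<^sup>2
    + 12 * ((\<Sum>I\<in>?Q. F2 I X) / real (card ?Q))\<^sup>2 + 3 * ((\<Sum>I\<in>?Q. G I X) / real (card ?Q))\<^sup>2)"
  proof (rule sample_mean_mono[OF w_nonneg])
    fix X :: "nat \<Rightarrow> 'a \<times> 'b"
    have "0 < 3 * real n ^ 4" using assms by simp
    then have c: "real (card ?Q) > 0" using card_distinct_quads[OF assms] by linarith
    define f1 f2 g where "f1 = (\<Sum>I\<in>?Q. F1 I X) / real (card ?Q)" and "f2 = (\<Sum>I\<in>?Q. F2 I X) / real (card ?Q)"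
      and "g = (\<Sum>I\<in>?Q. G I X) / real (card ?Q)"
    have "label_U n X = (\<Sum>I\<in>?Q. 2 * F1 I X + 2 * F2 I X + G I X + 4 * dependence) / real (card ?Q)"
      unfolding label_U_def
      by (intro arg_cong2[where f = "(/)"] sum.cong refl) (auto simp: F1_def F2_def G_def degenerate_kernel_def)
    also have "\<dots> = 2 * f1 + 2 * f2 + g + 4 * dependence"
      using c by (auto simp: f1_def f2_def g_def sum.distrib sum_distrib_left[symmetric] add_divide_distrib)
    finally have "(label_U n X - 4 * dependence)\<^sup>2 = (2 * f1 + 2 * f2 + g)\<^sup>2" by simp
    also have "\<dots> \<le> 12 * f1\<^sup>2 + 12 * f2\<^sup>2 + 3 * g\<^sup>2"
      using zero_le_power2[of "2 * f1 - 2 * f2"] zero_le_power2[of "2 * f1 - g"] zero_le_power2[of "2 * f2 - g"]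
      by (simp add: power2_eq_square algebra_simps)
    finally show "(label_U n X - 4 * dependence)\<^sup>2 \<le> 12 * ((\<Sum>I\<in>?Q. F1 I X) / real (card ?Q))\<^sup>2
    + 12 * ((\<Sum>I\<in>?Q. F2 I X) / real (card ?Q))\<^sup>2 + 3 * ((\<Sum>I\<in>?Q. G I X) / real (card ?Q))\<^sup>2"
      by (simp only: f1_def f2_def g_def)
  qed
  also have "\<dots> \<le> 12 * (48 / real n * (48 * (a * b * dependence))) + 12 * (48 / real n * (48 * (a * b * dependence)))
     + 3 * (512 / (real n)\<^sup>2 * (2304 * (a * b)))"
    unfolding sample_mean_add sample_mean_cmult
    by (intro add_mono mult_left_mono m1 m2 m3) auto
  finally show ?thesis by simp
qed

text \<open>Data and uniform permutation are treated as one weighted finite set. Orthogonality then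
  already holds for fixed data, from the permutation alone, and so without independence of Y and Z;
  the data are only needed for the size of a single kernel. The constant is 512 * 256.\<close>

lemma permuted_U_second_moment:
  assumes "n \<ge> 4"
  shows "E {1..n} (\<lambda>X. (\<Sum>\<pi> | \<pi> permutes {1..n}. (label_U_perm n X \<pi>)\<^sup>2) / fact n)
    \<le> 131072 * (a * b) / (real n)\<^sup>2"
proof -
  let ?J = "{1..n}" and ?Q = "distinct_quads n" and ?P = "{\<pi>. \<pi> permutes {1..n}}"
  let ?\<Omega> = "PiE ?J (\<lambda>_. S) \<times> ?P" and ?p = "\<lambda>(X, \<pi>). (\<Prod>i\<in>?J. w (X i)) / fact n"
  define F :: "nat \<times> nat \<times> nat \<times> nat \<Rightarrow> (nat \<Rightarrow> 'a \<times> 'b) \<times> (nat \<Rightarrow> nat) \<Rightarrow> real"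
    where "F = (\<lambda>(i, j, k, l) (X, \<pi>). contrast (fst (X i)) (fst (X j)) (fst (X k)) (fst (X l)) *
      contrast (snd (X (\<pi> i))) (snd (X (\<pi> j))) (snd (X (\<pi> k))) (snd (X (\<pi> l))))"
  have fold: "(\<Sum>\<omega>\<in>?\<Omega>. ?p \<omega> * f \<omega>) = E ?J (\<lambda>X. (\<Sum>\<pi>\<in>?P. f (X, \<pi>)) / fact n)" for f
    unfolding sample_mean_def
    by (simp add: sum_distrib_left sum_divide_distrib sum.cartesian_product case_prod_unfold)
  have fold': "(\<Sum>\<omega>\<in>?\<Omega>. ?p \<omega> * f \<omega>) = (\<Sum>\<pi>\<in>?P. E ?J (\<lambda>X. f (X, \<pi>))) / fact n" for f
  proof -
    have "E ?J (\<lambda>X. (\<Sum>\<pi>\<in>?P. f (X, \<pi>)) / fact n) = E ?J (\<lambda>X. 1 / fact n * (\<Sum>\<pi>\<in>?P. f (X, \<pi>)))" by simp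
    then show ?thesis unfolding fold sample_mean_cmult sample_mean_sum by simp
  qed
  have "(\<Sum>\<omega>\<in>?\<Omega>. ?p \<omega> * ((\<Sum>I\<in>?Q. F I \<omega>) / real (card ?Q))\<^sup>2) \<le> 512 / (real n)\<^sup>2 * (256 * (a * b))"
  proof (rule second_moment_average[where R = "\<lambda>(i, j, k, l). {(a, b, c, d). {a, b, c, d} \<inter> {i, l} \<noteq> {} \<and> {a, b, c, d} \<inter> {j, k} \<noteq> {}}"])
    fix I I' assume I: "I \<in> ?Q" "I' \<in> ?Q" "I' \<notin> (case I of (i, j, k, l) \<Rightarrow>
       {(a, b, c, d). {a, b, c, d} \<inter> {i, l} \<noteq> {} \<and> {a, b, c, d} \<inter> {j, k} \<noteq> {}})"
    obtain i j k l i' j' k' l' where eq: "I = (i, j, k, l)" "I' = (i', j', k', l')" by (metis prod_cases4)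
    have d: "{i, j, k, l} \<subseteq> ?J" "distinct [i, j, k, l]" using I(1) by (auto simp: eq distinct_quads_def)
    \<comment> \<open>A pair of the first quadruple that the second one misses. Exchanging the
      partners of \<open>u\<close> and \<open>v\<close> flips the sign of the first kernel and
      leaves the second unchanged.\<close>
    define u v where "u = (if {i', j', k', l'} \<inter> {i, l} = {} then i else j)"
      and "v = (if {i', j', k', l'} \<inter> {i, l} = {} then l else k)"
    have uv: "(u, v) = (i, l) \<or> (u, v) = (j, k)" "{i', j', k', l'} \<inter> {u, v} = {}"
      using I(3) by (auto simp: eq u_def v_def)
    have "(\<Sum>\<pi>\<in>?P. F I (X, \<pi>) * F I' (X, \<pi>)) = 0" for X
    proof -
      define g where "g \<pi> = contrast (fst (X i)) (fst (X j)) (fst (X k)) (fst (X l)) * F I' (X, \<pi>)" for \<pi>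
      have "g (\<pi> \<circ> Transposition.transpose u v) = g \<pi>" for \<pi>
        using uv(2) by (simp add: g_def F_def eq Transposition.transpose_apply_other)
      from sum_permutes_contrast_zero[OF d uv(1), of g "\<lambda>i. snd (X i)", OF this] show ?thesis
        by (simp add: g_def F_def eq mult_ac)
    qed
    then show "(\<Sum>\<omega>\<in>?\<Omega>. ?p \<omega> * (F I \<omega> * F I' \<omega>)) = 0"
      unfolding fold by (simp add: sample_mean_def)
  next
    fix I assume I: "I \<in> ?Q"
    obtain i j k l where eq: "I = (i, j, k, l)" by (metis prod_cases4)
    have d: "{i, j, k, l} \<subseteq> ?J" "distinct [i, j, k, l]" using I(1) by (auto simp: eq distinct_quads_def)
    have "(\<Sum>\<pi>\<in>?P. E ?J (\<lambda>X. (F I (X, \<pi>))\<^sup>2)) \<le> (\<Sum>\<pi>\<in>?P. 256 * (a * b))"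
    proof (rule sum_mono)
      fix \<pi> assume "\<pi> \<in> ?P"
      then have "\<pi> permutes {1..n}" by simp
      from kernel_second_moment[OF _ d permutes_quad[OF this d]]
      show "E ?J (\<lambda>X. (F I (X, \<pi>))\<^sup>2) \<le> 256 * (a * b)"
        unfolding eq F_def prod.case by simp
    qed
    also have "\<dots> = 256 * (a * b) * fact n" using card_permutes[of n] by simp
    finally show "(\<Sum>\<omega>\<in>?\<Omega>. ?p \<omega> * (F I \<omega>)\<^sup>2) \<le> 256 * (a * b)"
      unfolding fold' by (simp add: divide_le_eq)
    show "real (card ((case I of (i, j, k, l) \<Rightarrow> {(a, b, c, d). {a, b, c, d} \<inter> {i, l} \<noteq> {} \<and> {a, b, c, d} \<inter> {j, k} \<noteq> {}}) \<inter> ?Q))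
      \<le> 512 / (real n)\<^sup>2 * real (card ?Q)"
      using d unfolding eq prod.case
      by (intro card_quads_meeting_two_pairs assms) (auto simp: card_insert_if)
  next
    fix \<omega> assume "\<omega> \<in> ?\<Omega>"
    then obtain X \<pi> where X: "\<omega> = (X, \<pi>)" "X \<in> PiE ?J (\<lambda>_. S)" by blast
    have "0 \<le> (\<Prod>i\<in>?J. w (X i))" by (intro prod_nonneg w_nonneg PiE_mem[OF X(2)])
    then show "0 \<le> ?p \<omega>" by (simp add: X(1))
  qed (use a_nonneg b_nonneg in auto)
  moreover have "label_U_perm n X \<pi> = (\<Sum>I\<in>?Q. F I (X, \<pi>)) / real (card ?Q)" for X \<pi>
    unfolding label_U_perm_def label_U_def F_def label_kernel_def
    by (intro arg_cong2[where f = "(/)"] sum.cong refl) auto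
  ultimately show ?thesis unfolding fold by simp
qed

text \<open>Acceptance forces the statistic to be at most t or the critical value to exceed t. The
  first event is a deviation from the mean by at least t, the second makes the permuted second
  moment exceed \<alpha> t^2; both are paid for by second moments.\<close>

lemma type_II_error:
  assumes "n \<ge> 4" "0 < \<alpha>" "\<alpha> < 1" "0 < dependence"
  shows "E {1..n} (\<lambda>X. of_bool (label_U n X \<le> label_crit n \<alpha> X))
    \<le> 10 ^ 6 * (a * b) * (1 / (real n * dependence) + 1 / (real n * dependence)\<^sup>2
        + 1 / (\<alpha> * (real n * dependence)\<^sup>2))"
proof -
  define Q where "Q X = (\<Sum>\<pi> | \<pi> permutes {1..n}. (label_U_perm n X \<pi>)\<^sup>2) / fact n" for X :: "nat \<Rightarrow> 'a \<times> 'b"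
  \<comment> \<open>Half of the mean 4 \<open>dependence\<close> of the statistic, so that the
    deviation in the first case is again at least t.\<close>
  define t where "t = 2 * dependence"
  have t: "t > 0" using assms by (simp add: t_def)
  have "E {1..n} (\<lambda>X. of_bool (label_U n X \<le> label_crit n \<alpha> X)) \<le>
    E {1..n} (\<lambda>X. 1 / t\<^sup>2 * (label_U n X - 4 * dependence)\<^sup>2 + 1 / (\<alpha> * t\<^sup>2) * Q X)"
  proof (rule sample_mean_mono[OF w_nonneg])
    fix X :: "nat \<Rightarrow> 'a \<times> 'b"
    have Q0: "0 \<le> Q X" unfolding Q_def by (intro divide_nonneg_nonneg sum_nonneg) auto
    have "1 \<le> 1 / t\<^sup>2 * (label_U n X - 4 * dependence)\<^sup>2 + 1 / (\<alpha> * t\<^sup>2) * Q X"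
      if U: "label_U n X \<le> label_crit n \<alpha> X"
    proof (cases "label_U n X \<le> t")
      case True
      have "t\<^sup>2 \<le> (4 * dependence - label_U n X)\<^sup>2"
        using True t by (intro power_mono) (auto simp: t_def)
      then have "1 \<le> 1 / t\<^sup>2 * (label_U n X - 4 * dependence)\<^sup>2"
        using t by (simp add: power2_commute field_simps)
      moreover have "0 \<le> 1 / (\<alpha> * t\<^sup>2) * Q X" using Q0 assms by simp
      ultimately show ?thesis by linarith
    next
      case False
      then have "\<not> label_crit n \<alpha> X \<le> t" using U by simp
      then have "\<not> Q X \<le> \<alpha> * t\<^sup>2" unfolding Q_def using label_crit_le_Chebyshev[OF assms(2,3) t] by blast
      then have "1 \<le> 1 / (\<alpha> * t\<^sup>2) * Q X" using t assms by (simp add: field_simps)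
      then show ?thesis by (simp add: add_increasing)
    qed
    moreover have "0 \<le> 1 / t\<^sup>2 * (label_U n X - 4 * dependence)\<^sup>2 + 1 / (\<alpha> * t\<^sup>2) * Q X"
      using Q0 assms by simp
    ultimately show "of_bool (label_U n X \<le> label_crit n \<alpha> X) \<le>
      1 / t\<^sup>2 * (label_U n X - 4 * dependence)\<^sup>2 + 1 / (\<alpha> * t\<^sup>2) * Q X" by (cases "label_U n X \<le> label_crit n \<alpha> X") auto
  qed
  also have "\<dots> \<le> 1 / t\<^sup>2 * (55296 * (a * b * dependence) / real n + 3538944 * (a * b) / (real n)\<^sup>2)
     + 1 / (\<alpha> * t\<^sup>2) * (131072 * (a * b) / (real n)\<^sup>2)"
    unfolding sample_mean_add sample_mean_cmult Q_def
    using assms by (intro add_mono mult_left_mono U_second_moment permuted_U_second_moment) auto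
  also have "\<dots> = (a * b) * (13824 * (1 / (real n * dependence)) + 884736 * (1 / (real n * dependence)\<^sup>2)
     + 32768 * (1 / (\<alpha> * (real n * dependence)\<^sup>2)))"
    using assms by (simp add: t_def field_simps power2_eq_square)
  also have "\<dots> \<le> (a * b) * (10 ^ 6 * (1 / (real n * dependence)) + 10 ^ 6 * (1 / (real n * dependence)\<^sup>2)
     + 10 ^ 6 * (1 / (\<alpha> * (real n * dependence)\<^sup>2)))"
    using assms a_nonneg b_nonneg by (intro mult_left_mono add_mono mult_right_mono) auto
  finally show ?thesis by (simp add: algebra_simps)
qed

end

subsection \<open>Exchangeability\<close>

text \<open>Composition with \<open>\<sigma>\<close> is a bijection of the permutation group, so the
  collection of permuted statistics does not change.\<close>

lemma label_crit_permuted: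
  assumes "\<sigma> permutes {1..n}"
  shows "label_crit n \<alpha> (\<lambda>i. (fst (X i), snd (X (\<sigma> i)))) = label_crit n \<alpha> X"
proof -
  have "(\<Sum>\<pi> | \<pi> permutes {1..n}. if label_U_perm n (\<lambda>i. (fst (X i), snd (X (\<sigma> i)))) \<pi> \<le> t then 1 else (0::real)) =
    (\<Sum>\<pi> | \<pi> permutes {1..n}. if label_U_perm n X \<pi> \<le> t then 1 else 0)" for t
    by (subst (2) setum_permutations_compose_left[OF assms]) (simp add: label_U_perm_def)
  then show ?thesis unfolding label_crit_def by simp
qed

lemma label_U_cong:
  assumes "\<And>i. i \<in> {1..n} \<Longrightarrow> X i = X' i"
  shows "label_U n X = label_U n X'"
  unfolding label_U_def
  by (intro arg_cong2[where f = "(/)"] sum.cong refl) (use assms in \<open>auto simp: distinct_quads_def\<close>)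

lemma label_U_perm_cong:
  assumes "\<And>i. i \<in> {1..n} \<Longrightarrow> X i = X' i" "\<pi> permutes {1..n}"
  shows "label_U_perm n X \<pi> = label_U_perm n X' \<pi>"
  unfolding label_U_perm_def
  by (intro label_U_cong) (use assms(1) permutes_in_image[OF assms(2)] in auto)

lemma label_crit_cong:
  assumes "\<And>i. i \<in> {1..n} \<Longrightarrow> X i = X' i"
  shows "label_crit n \<alpha> X = label_crit n \<alpha> X'"
proof -
  have "(\<Sum>\<pi> | \<pi> permutes {1..n}. if label_U_perm n X \<pi> \<le> t then 1 else (0::real)) =
    (\<Sum>\<pi> | \<pi> permutes {1..n}. if label_U_perm n X' \<pi> \<le> t then 1 else 0)" for t
    using label_U_perm_cong[OF assms] by (intro sum.cong) auto
  then show ?thesis unfolding label_crit_def by simp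
qed

text \<open>Under product weights the likelihood splits into a Y-part and a Z-part, and reindexing
  the Z-part does not change the product.\<close>

lemma sample_mean_permuted:
  fixes F :: "(nat \<Rightarrow> 'y \<times> 'z) \<Rightarrow> real"
  assumes w: "\<And>y z. y \<in> A \<Longrightarrow> z \<in> B \<Longrightarrow> w (y, z) = q y * r z"
    and \<sigma>: "\<sigma> permutes {1..n}"
    and F: "\<And>X X'. (\<And>i. i \<in> {1..n} \<Longrightarrow> X i = X' i) \<Longrightarrow> F X = F X'"
  shows "sample_mean (A \<times> B) w {1..n} (\<lambda>X. F (\<lambda>i. (fst (X i), snd (X (\<sigma> i))))) = sample_mean (A \<times> B) w {1..n} F"
proof -
  let ?\<Omega> = "PiE {1..n} (\<lambda>_. A \<times> B)"
  \<comment> \<open>The restriction keeps re-paired samples inside the extensional function space,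
    where the re-pairing is a bijection with inverse given by \<open>inv \<sigma>\<close>. The
    assumption on \<open>F\<close> absorbs the values outside the index set.\<close>
  define h :: "(nat \<Rightarrow> nat) \<Rightarrow> (nat \<Rightarrow> 'y \<times> 'z) \<Rightarrow> nat \<Rightarrow> 'y \<times> 'z" where
    "h \<tau> X = restrict (\<lambda>i. (fst (X i), snd (X (\<tau> i)))) {1..n}" for \<tau> X
  have h_in: "h \<tau> X \<in> ?\<Omega>" if "X \<in> ?\<Omega>" "\<tau> permutes {1..n}" for \<tau> X
    unfolding h_def restrict_PiE_iff using that permutes_in_image[OF that(2)] by (auto simp: PiE_iff mem_Times_iff)
  have h_inv: "h (inv \<tau>) (h \<tau> X) = X" if "X \<in> ?\<Omega>" "\<tau> permutes {1..n}" for \<tau> X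
  proof
    fix i
    have "inv \<tau> i \<in> {1..n} \<longleftrightarrow> i \<in> {1..n}" using permutes_in_image[OF permutes_inv[OF that(2)]] .
    then show "h (inv \<tau>) (h \<tau> X) i = X i"
      using that permutes_inverses(1)[OF that(2)] by (cases "i \<in> {1..n}") (auto simp: h_def PiE_iff extensional_def)
  qed
  have inv_inv: "inv (inv \<sigma>) = \<sigma>" using permutes_inv_inv[OF \<sigma>] .
  show ?thesis
    unfolding sample_mean_def
  proof (rule sum.reindex_bij_witness[where i = "h (inv \<sigma>)" and j = "h \<sigma>"])
    fix X assume X: "X \<in> ?\<Omega>"
    show "h (inv \<sigma>) (h \<sigma> X) = X" "h \<sigma> X \<in> ?\<Omega>" "h (inv \<sigma>) X \<in> ?\<Omega>"
      by (rule h_inv[OF X \<sigma>], rule h_in[OF X \<sigma>], rule h_in[OF X permutes_inv[OF \<sigma>]])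
    show "h \<sigma> (h (inv \<sigma>) X) = X" using h_inv[OF X permutes_inv[OF \<sigma>]] by (simp add: inv_inv)
    have "(\<Prod>i\<in>{1..n}. w (h \<sigma> X i)) = (\<Prod>i\<in>{1..n}. q (fst (X i)) * r (snd (X (\<sigma> i))))"
    proof (rule prod.cong[OF refl])
      fix i assume i: "i \<in> {1..n}"
      then have "\<sigma> i \<in> {1..n}" using permutes_in_image[OF \<sigma>] by simp
      with X i have "X i \<in> A \<times> B" "X (\<sigma> i) \<in> A \<times> B" by (blast dest: PiE_mem)+
      then show "w (h \<sigma> X i) = q (fst (X i)) * r (snd (X (\<sigma> i)))"
        using i w by (auto simp: h_def)
    qed
    also have "\<dots> = (\<Prod>i\<in>{1..n}. q (fst (X i))) * (\<Prod>i\<in>{1..n}. r (snd (X i)))"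
      using prod.permute[OF \<sigma>, of "\<lambda>i. r (snd (X i))"] by (simp add: prod.distrib o_def)
    also have "\<dots> = (\<Prod>i\<in>{1..n}. w (X i))"
      unfolding prod.distrib[symmetric]
    proof (rule prod.cong[OF refl])
      fix i assume "i \<in> {1..n}"
      with X have "X i \<in> A \<times> B" by (blast dest: PiE_mem)
      then show "q (fst (X i)) * r (snd (X i)) = w (X i)" using w by (cases "X i") auto
    qed
    finally show "(\<Prod>i\<in>{1..n}. w (h \<sigma> X i)) * F (h \<sigma> X) = (\<Prod>i\<in>{1..n}. w (X i)) * F (\<lambda>i. (fst (X i), snd (X (\<sigma> i))))"
      using F[of "h \<sigma> X" "\<lambda>i. (fst (X i), snd (X (\<sigma> i)))"] by (simp add: h_def)
  qed
qed

text \<open>By exchangeability the rejection probability equals its average over all re-pairings of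
  the data. These share one critical value, so for fixed data the average is the fraction of
  permuted statistics above it, at most \<alpha>.\<close>

lemma (in contingency_table) type_I_error:
  assumes w: "\<And>y z. y \<in> A \<Longrightarrow> z \<in> B \<Longrightarrow> w (y, z) = q y * r z" and "0 < \<alpha>" "\<alpha> < 1"
  shows "E {1..n} (\<lambda>X. of_bool (label_U n X > label_crit n \<alpha> X)) \<le> \<alpha>"
proof -
  let ?P = "{\<pi>. \<pi> permutes {1..n}}"
  define F :: "(nat \<Rightarrow> 'y \<times> 'z) \<Rightarrow> real" where "F X = of_bool (label_U n X > label_crit n \<alpha> X)" for X
  have cong: "F X = F X'" if "\<And>i. i \<in> {1..n} \<Longrightarrow> X i = X' i" for X X'
    using label_U_cong[of n X X'] label_crit_cong[of n X X' \<alpha>] that by (simp add: F_def)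
  have fin: "finite ?P" by (rule finite_permutations) simp
  have "fact n * E {1..n} F = (\<Sum>\<pi>\<in>?P. E {1..n} F)" using card_permutes[of n] by simp
  also have "\<dots> = (\<Sum>\<pi>\<in>?P. E {1..n} (\<lambda>X. F (\<lambda>i. (fst (X i), snd (X (\<pi> i))))))"
    by (intro sum.cong refl sample_mean_permuted[symmetric, where F = F and q = q and r = r]) (auto intro: w cong)
  also have "\<dots> = E {1..n} (\<lambda>X. \<Sum>\<pi>\<in>?P. F (\<lambda>i. (fst (X i), snd (X (\<pi> i)))))"
    by (simp add: sample_mean_sum)
  also have "\<dots> \<le> E {1..n} (\<lambda>X. \<alpha> * fact n)"
  proof (rule sample_mean_mono[OF w_nonneg])
    fix X :: "nat \<Rightarrow> 'y \<times> 'z"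
    have "(\<Sum>\<pi>\<in>?P. F (\<lambda>i. (fst (X i), snd (X (\<pi> i))))) =
      (\<Sum>\<pi>\<in>?P. of_bool (\<not> label_U_perm n X \<pi> \<le> label_crit n \<alpha> X))"
      by (intro sum.cong) (auto simp: F_def label_crit_permuted label_U_perm_def not_le)
    also have "\<dots> = real (card ?P) - real (card {\<pi> \<in> ?P. label_U_perm n X \<pi> \<le> label_crit n \<alpha> X})"
      using fin by (simp add: of_bool_not_iff sum_subtractf Collect_conj_eq)
    also have "\<dots> \<le> \<alpha> * fact n"
      using label_crit_facts(2)[OF assms(2,3), of n X] unfolding card_permutes by (simp add: algebra_simps)
    finally show "(\<Sum>\<pi>\<in>?P. F (\<lambda>i. (fst (X i), snd (X (\<pi> i))))) \<le> \<alpha> * fact n" .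
  qed
  also have "\<dots> = fact n * \<alpha>" by (simp add: sample_mean_const w_sum)
  finally show ?thesis by (simp add: F_def[abs_def])
qed

subsection \<open>Recovering polynomials from bin averages\<close>

lemma pderiv_sum: "pderiv (sum f A) = (\<Sum>i\<in>A. pderiv (f i))"
  by (induction A rule: infinite_finite_induct) (auto simp: pderiv_add)

lemma poly_antiderivative:
  fixes q :: "real poly"
  shows "\<exists>P. pderiv P = q \<and> degree P \<le> Suc (degree q)"
proof (intro exI conjI)
  let ?P = "\<Sum>k\<le>degree q. monom (coeff q k / real (Suc k)) (Suc k)"
  have "pderiv ?P = (\<Sum>k\<le>degree q. monom (coeff q k) k)"
    by (simp add: pderiv_sum pderiv_monom)
  then show "pderiv ?P = q" by (simp add: poly_as_sum_of_monoms)
  show "degree ?P \<le> Suc (degree q)"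
    by (intro degree_sum_le) (auto intro: order_trans[OF degree_monom_le])
qed

lemma Lagrange_basis:
  "\<exists>lag :: nat \<Rightarrow> real poly. \<forall>j\<le>K. degree (lag j) \<le> K \<and> (\<forall>i\<le>K. poly (lag j) (real i) = of_bool (i = j))"
proof (intro exI allI impI conjI)
  let ?lag = "\<lambda>j. \<Prod>i\<in>{..K} - {j}. smult (1 / (real j - real i)) [:- real i, 1:]"
  fix j assume j: "j \<le> K"
  have "degree (?lag j) \<le> (\<Sum>i\<in>{..K} - {j}. degree (smult (1 / (real j - real i)) [:- real i, 1:]))"
    using degree_prod_sum_le[of "{..K} - {j}" "\<lambda>i. smult (1 / (real j - real i)) [:- real i, 1:]"]
    by (simp add: o_def)
  also have "\<dots> \<le> (\<Sum>i\<in>{..K} - {j}. 1)"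
    by (intro sum_mono) (auto intro: order_trans[OF degree_smult_le])
  also have "\<dots> = K" using j by simp
  finally show "degree (?lag j) \<le> K" .
  fix i assume i: "i \<le> K"
  show "poly (?lag j) (real i) = of_bool (i = j)"
  proof (cases "i = j")
    case True
    have "poly (smult (1 / (real j - real m)) [:- real m, 1:]) (real i) = 1" if "m \<in> {..K} - {j}" for m
    proof -
      have "poly (smult (1 / (real j - real m)) [:- real m, 1:]) (real i) = (real i - real m) / (real j - real m)"
        by (simp add: diff_divide_distrib)
      then show ?thesis using that True by simp
    qed
    then show ?thesis using True by (simp add: poly_prod del: poly_smult)
  next
    case False
    then show ?thesis using i by (auto simp: poly_prod intro!: prod_zero)
  qed
qed

text \<open>Bin integrals of a polynomial are increments of its antiderivative P. The K increments
  determine P at the nodes 0, ..., K up to a constant, Lagrange interpolation recovers P - P(0), and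
  differentiation recovers the polynomial.\<close>

lemma bin_weights:
  "\<exists>W :: nat \<Rightarrow> real poly. \<forall>P x. degree P \<le> K \<longrightarrow>
     poly (pderiv P) x = (\<Sum>i<K. poly (W i) x * (poly P (real i + 1) - poly P (real i)))"
proof -
  obtain lag :: "nat \<Rightarrow> real poly" where lag: "\<And>j. j \<le> K \<Longrightarrow> degree (lag j) \<le> K"
    "\<And>i j. i \<le> K \<Longrightarrow> j \<le> K \<Longrightarrow> poly (lag j) (real i) = of_bool (i = j)"
    using Lagrange_basis[of K] by metis
  have interpolation: "P = (\<Sum>j\<le>K. smult (poly P (real j)) (lag j))" if "degree P \<le> K" for P :: "real poly"
  proof (rule poly_eqI_degree[where A = "real ` {..K}"])
    fix x assume "x \<in> real ` {..K}"
    then obtain i where i: "i \<le> K" "x = real i" by auto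
    have "poly (\<Sum>j\<le>K. smult (poly P (real j)) (lag j)) x = (\<Sum>j\<le>K. if i = j then poly P (real j) else 0)"
      unfolding poly_sum by (intro sum.cong) (auto simp: i lag(2))
    then show "poly P x = poly (\<Sum>j\<le>K. smult (poly P (real j)) (lag j)) x" using i by simp
  next
    have c: "card (real ` {..K}) = Suc K" by (simp add: card_image)
    show "degree P < card (real ` {..K})" using that c by simp
    have "degree (\<Sum>j\<le>K. smult (poly P (real j)) (lag j)) \<le> K"
      by (intro degree_sum_le) (auto intro: lag(1))
    then show "degree (\<Sum>j\<le>K. smult (poly P (real j)) (lag j)) < card (real ` {..K})" using c by simp
  qed
  \<comment> \<open>Summation by parts: the value at node j, relative to node 0, contains the
    increment over [i, i+1] exactly when i < j.\<close>
  define W where "W i = (\<Sum>j\<in>{i<..K}. pderiv (lag j))" for i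
  have "poly (pderiv P) x = (\<Sum>i<K. poly (W i) x * (poly P (real i + 1) - poly P (real i)))"
    if P: "degree P \<le> K" for P x
  proof -
    let ?P = "P - [:poly P 0:]"
    let ?d = "\<lambda>i. poly P (real (Suc i)) - poly P (real i)"
    have "degree ?P \<le> K" using P by (intro degree_diff_le) auto
    from interpolation[OF this]
    have "pderiv ?P = pderiv (\<Sum>j\<le>K. smult (poly ?P (real j)) (lag j))" by metis
    then have "pderiv P = pderiv (\<Sum>j\<le>K. smult (poly ?P (real j)) (lag j))"
      by (simp add: pderiv_diff pderiv_pCons)
    also have "\<dots> = (\<Sum>j\<le>K. smult (poly P (real j) - poly P 0) (pderiv (lag j)))"
      by (simp add: pderiv_sum pderiv_smult)
    finally have "poly (pderiv P) x = (\<Sum>j\<le>K. (poly P (real j) - poly P 0) * poly (pderiv (lag j)) x)"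
      by (simp add: poly_sum)
    also have "\<dots> = (\<Sum>j\<le>K. \<Sum>i<j. ?d i * poly (pderiv (lag j)) x)"
    proof (intro sum.cong refl)
      fix j
      have "poly P (real j) - poly P 0 = (\<Sum>i<j. ?d i)"
        using sum_lessThan_telescope[of "\<lambda>i. poly P (real i)" j] by simp
      then show "(poly P (real j) - poly P 0) * poly (pderiv (lag j)) x = (\<Sum>i<j. ?d i * poly (pderiv (lag j)) x)"
        by (simp only: sum_distrib_right)
    qed
    also have "\<dots> = (\<Sum>i<K. \<Sum>j\<in>{i<..K}. ?d i * poly (pderiv (lag j)) x)"
      unfolding sum.Sigma[OF finite_atMost ballI[OF finite_lessThan]] sum.Sigma[OF finite_lessThan ballI[OF finite_greaterThanAtMost]]
      by (rule sum.reindex_bij_witness[where i = "\<lambda>(i, j). (j, i)" and j = "\<lambda>(j, i). (i, j)"]) auto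
    also have "\<dots> = (\<Sum>i<K. poly (W i) x * ?d i)"
      by (simp add: W_def poly_sum sum_distrib_left sum_distrib_right mult.commute)
    finally show ?thesis by (simp only: of_nat_Suc add.commute[of 1])
  qed
  then show ?thesis by blast
qed

definition coord_bin :: "nat \<Rightarrow> real \<Rightarrow> int" where
  "coord_bin \<kappa> t = min \<lfloor>real \<kappa> * t\<rfloor> (int \<kappa> - 1)"

definition bin_set :: "nat \<Rightarrow> int \<Rightarrow> real set" where
  "bin_set \<kappa> j = {t \<in> {0..1}. coord_bin \<kappa> t = j}"

lemma measurable_coord_bin [measurable]: "coord_bin \<kappa> \<in> borel \<rightarrow>\<^sub>M count_space UNIV"
  unfolding coord_bin_def[abs_def] by measurable

lemma bin_set_measurable [measurable]: "bin_set \<kappa> j \<in> sets borel"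
proof -
  have "bin_set \<kappa> j = {0..1} \<inter> (coord_bin \<kappa> -` {j} \<inter> space borel)" by (auto simp: bin_set_def)
  then show ?thesis by (metis measurable_sets[OF measurable_coord_bin] UNIV_I sets_count_space Pow_UNIV sets.Int atLeastAtMost_borel)
qed

lemma bin_set_subset: "\<kappa> \<ge> 1 \<Longrightarrow> bin_set \<kappa> j \<subseteq> {real_of_int j / real \<kappa>..(real_of_int j + 1) / real \<kappa>}"
proof
  fix t assume k: "\<kappa> \<ge> 1" and t: "t \<in> bin_set \<kappa> j"
  then have t01: "0 \<le> t" "t \<le> 1" and j: "min \<lfloor>real \<kappa> * t\<rfloor> (int \<kappa> - 1) = j"
    by (auto simp: bin_set_def coord_bin_def)
  have kt: "real \<kappa> * t \<le> real \<kappa>" using t01 k by (simp add: mult_left_le)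
  have "real_of_int j \<le> real \<kappa> * t" using j by linarith
  moreover have "real \<kappa> * t \<le> real_of_int j + 1"
  proof (cases "\<lfloor>real \<kappa> * t\<rfloor> \<le> int \<kappa> - 1")
    case True
    then have "j = \<lfloor>real \<kappa> * t\<rfloor>" using j by simp
    then show ?thesis by linarith
  next
    case False
    then have "j = int \<kappa> - 1" using j by simp
    then show ?thesis using kt by simp
  qed
  ultimately show "t \<in> {real_of_int j / real \<kappa>..(real_of_int j + 1) / real \<kappa>}"
    using k by (simp add: field_simps)
qed

lemma bin_set_superset:
  assumes "\<kappa> \<ge> 1" "0 \<le> j" "j < int \<kappa>" "real_of_int j / real \<kappa> < t" "t < (real_of_int j + 1) / real \<kappa>"
  shows "t \<in> bin_set \<kappa> j"
proof -
  have 1: "real_of_int j < real \<kappa> * t" "real \<kappa> * t < real_of_int j + 1"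
    using assms by (auto simp: field_simps)
  then have "\<lfloor>real \<kappa> * t\<rfloor> = j" by linarith
  moreover have "0 \<le> t" using assms(1,2,4) by (smt (verit) divide_nonneg_nonneg of_int_0_le_iff of_nat_0_le_iff)
  moreover have "t \<le> 1"
  proof -
    have "real \<kappa> * t \<le> real \<kappa> * 1" using 1(2) assms(3) by linarith
    then show ?thesis using assms(1) by (simp only: mult_le_cancel_left_pos of_nat_0_less_iff)
  qed
  ultimately show ?thesis using assms(3) by (auto simp: bin_set_def coord_bin_def)
qed

text \<open>A bin differs from the closed interval only at the endpoints, a null set, so the
  fundamental theorem of calculus applies.\<close>

lemma integral_bin_set:
  assumes "\<kappa> \<ge> 1" "0 \<le> j" "j < int \<kappa>"
    and F: "\<And>t. (F has_real_derivative f t) (at t)" and f: "\<And>t. isCont f t"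
  shows "(LINT t|lborel. indicator (bin_set \<kappa> j) t * f t) =
    F ((real_of_int j + 1) / real \<kappa>) - F (real_of_int j / real \<kappa>)"
proof -
  let ?a = "real_of_int j / real \<kappa>" and ?b = "(real_of_int j + 1) / real \<kappa>"
  have "?a \<le> ?b" by (simp add: divide_right_mono)
  have "AE t in lborel. t \<noteq> ?a \<and> t \<noteq> ?b" using AE_lborel_singleton[of ?a] AE_lborel_singleton[of ?b] by auto
  then have "AE t in lborel. indicator (bin_set \<kappa> j) t * f t = f t * indicator {?a..?b} t"
  proof eventually_elim
    case (elim t)
    have "t \<in> bin_set \<kappa> j \<longleftrightarrow> t \<in> {?a..?b}"
      using bin_set_subset[OF assms(1)] bin_set_superset[OF assms(1-3), of t] elim by force
    then show ?case by (auto simp: indicator_def)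
  qed
  moreover have "f \<in> borel_measurable borel"
    by (intro borel_measurable_continuous_onI continuous_at_imp_continuous_on) (simp add: f)
  ultimately have "(LINT t|lborel. indicator (bin_set \<kappa> j) t * f t) = (LINT t|lborel. f t * indicator {?a..?b} t)"
    by (intro integral_cong_AE) auto
  also have "\<dots> = F ?b - F ?a"
    by (rule integral_FTC_Icc_real[OF \<open>?a \<le> ?b\<close>]) (auto simp: F f)
  finally show ?thesis .
qed

lemma measure_bin_set:
  assumes "\<kappa> \<ge> 1" "0 \<le> j" "j < int \<kappa>"
  shows "(LINT t|lborel. indicator (bin_set \<kappa> j) t) = 1 / real \<kappa>"
  using integral_bin_set[OF assms, of "\<lambda>t. t" "\<lambda>_. 1"] assms(1) by (simp add: field_simps)

lemma integrable_bin_indicator: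
  fixes f :: "real \<Rightarrow> real"
  assumes "f \<in> borel_measurable borel" "\<And>t. t \<in> {0..1} \<Longrightarrow> \<bar>f t\<bar> \<le> B"
  shows "integrable lborel (\<lambda>t. indicator (bin_set \<kappa> j) t * f t)"
proof (rule Bochner_Integration.integrable_bound[where f = "\<lambda>t::real. B * indicator {0..1} t"])
  show "integrable lborel (\<lambda>t::real. B * indicator {0..1} t)"
    by (intro integrable_mult_right integrable_real_indicator) auto
  show "AE t in lborel. norm (indicator (bin_set \<kappa> j) t * f t) \<le> norm (B * indicator {0..1} t)"
    using assms(2) by (intro AE_I2) (force simp: indicator_def bin_set_def)
qed (use assms(1) in measurable)

text \<open>The window has the length of K bins, which is the number of averages that determine a
  polynomial of degree less than K. The polynomial may change with the window, the error may
  not.\<close>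

definition locally_polynomial :: "nat \<Rightarrow> nat \<Rightarrow> real \<Rightarrow> (real \<Rightarrow> real) \<Rightarrow> bool" where
  "locally_polynomial \<kappa> K E \<phi> \<longleftrightarrow> (\<forall>a. 0 \<le> a \<longrightarrow> a + real K / real \<kappa> \<le> 1 \<longrightarrow>
     (\<exists>q. degree q < K \<and> (\<forall>\<tau>\<in>{a..a + real K / real \<kappa>}. \<bar>\<phi> \<tau> - poly q \<tau>\<bar> \<le> E)))"

text \<open>\<open>R t\<close> is the kernel of a quasi-interpolant: constant on bins, so that
  integration against it uses bin averages only; supported near t; and exact on polynomials of
  degree less than K, as E = 0 in the last clause shows. C acts as a Lebesgue constant.\<close>

definition reconstructs :: "nat \<Rightarrow> nat \<Rightarrow> real \<Rightarrow> (real \<Rightarrow> real \<Rightarrow> real) \<Rightarrow> bool" where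
  "reconstructs \<kappa> K C R \<longleftrightarrow> (\<forall>t\<in>{0..1}.
    R t \<in> borel_measurable borel \<and>
    (\<forall>t'. \<bar>R t t'\<bar> \<le> C * real \<kappa>) \<and>
    (\<forall>t'. R t t' \<noteq> 0 \<longrightarrow> t' \<in> {0..1} \<and> \<bar>coord_bin \<kappa> t' - coord_bin \<kappa> t\<bar> < int K) \<and>
    (\<forall>t'\<in>{0..1}. \<forall>t''\<in>{0..1}. coord_bin \<kappa> t' = coord_bin \<kappa> t'' \<longrightarrow> R t t' = R t t'') \<and>
    (LINT t'|lborel. \<bar>R t t'\<bar>) \<le> C \<and>
    (\<forall>\<phi> E. \<phi> \<in> borel_measurable borel \<longrightarrow> (\<exists>B. \<forall>\<tau>\<in>{0..1}. \<bar>\<phi> \<tau>\<bar> \<le> B) \<longrightarrow>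
      locally_polynomial \<kappa> K E \<phi> \<longrightarrow>
      \<bar>\<phi> t - (LINT t'|lborel. R t t' * \<phi> t')\<bar> \<le> (1 + C) * E))"

text \<open>After rescaling, a block of K bins is [0, K] with unit bins, and the polynomials of
  \<open>bin_weights\<close> give the kernel. C is the supremum on [0, K] of the sum of their
  absolute values, hence the same for all \<kappa>.\<close>

lemma reconstruction_kernel:
  fixes K :: nat
  assumes "K \<ge> 1"
  shows "\<exists>C\<ge>1. \<forall>\<kappa>\<ge>K. \<exists>R. reconstructs \<kappa> K C R"
proof -
  obtain W :: "nat \<Rightarrow> real poly" where W: "\<And>P x. degree P \<le> K \<Longrightarrow>
     poly (pderiv P) x = (\<Sum>i<K. poly (W i) x * (poly P (real i + 1) - poly P (real i)))"
    using bin_weights[of K] by blast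
  have "continuous_on {0..real K} (\<lambda>x. \<Sum>i<K. \<bar>poly (W i) x\<bar>)" by (intro continuous_intros)
  then have "bounded ((\<lambda>x. \<Sum>i<K. \<bar>poly (W i) x\<bar>) ` {0..real K})"
    by (intro compact_imp_bounded compact_continuous_image) auto
  then obtain C0 where C0: "\<And>x. x \<in> {0..real K} \<Longrightarrow> (\<Sum>i<K. \<bar>poly (W i) x\<bar>) \<le> C0"
    unfolding bounded_iff by fastforce
  define C where "C = max 1 C0"
  have C: "(\<Sum>i<K. \<bar>poly (W i) x\<bar>) \<le> C" if "x \<in> {0..real K}" for x
    using C0[OF that] by (simp add: C_def)
  show ?thesis
  proof (intro exI conjI allI impI)
    show "C \<ge> 1" by (simp add: C_def)
    fix \<kappa> assume \<kappa>K: "K \<le> \<kappa>"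
    then have \<kappa>: "\<kappa> \<ge> 1" using assms by simp
    \<comment> \<open>First bin of the block used for t. Near the right end the block is pushed back
      to stay inside [0, 1], so t may lie in any bin of the block.\<close>
    define j where "j t = min (coord_bin \<kappa> t) (int \<kappa> - int K)" for t
    define R where "R t t' = (\<Sum>i<K. real \<kappa> * poly (W i) (real \<kappa> * t - real_of_int (j t)) *
        indicator (bin_set \<kappa> (j t + int i)) t')" for t t'
    show "reconstructs \<kappa> K C R"
      unfolding reconstructs_def
    proof
      fix t :: real assume t: "t \<in> {0..1}"
      define x where "x = real \<kappa> * t - real_of_int (j t)"
      have kt: "real \<kappa> * t \<le> real \<kappa>" "0 \<le> real \<kappa> * t" using t \<kappa> by (auto simp: mult_left_le)
      have "t \<in> bin_set \<kappa> (coord_bin \<kappa> t)" using t by (simp add: bin_set_def)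
      then have "t \<in> {real_of_int (coord_bin \<kappa> t) / real \<kappa>..(real_of_int (coord_bin \<kappa> t) + 1) / real \<kappa>}"
        using bin_set_subset[OF \<kappa>] by blast
      then have cb: "real_of_int (coord_bin \<kappa> t) \<le> real \<kappa> * t" "real \<kappa> * t \<le> real_of_int (coord_bin \<kappa> t) + 1"
        using \<kappa> by (auto simp: field_simps)
      have cb': "0 \<le> coord_bin \<kappa> t" "coord_bin \<kappa> t \<le> int \<kappa> - 1"
        using kt \<kappa> by (auto simp: coord_bin_def)
      have j: "0 \<le> j t" "j t \<le> int \<kappa> - int K" "j t \<le> coord_bin \<kappa> t" "coord_bin \<kappa> t < j t + int K"
        using cb' \<kappa>K assms by (auto simp: j_def)
      have x: "x \<in> {0..real K}"
      proof (cases "coord_bin \<kappa> t \<le> int \<kappa> - int K")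
        case True
        then have "j t = coord_bin \<kappa> t" by (simp add: j_def)
        moreover have "1 \<le> real K" using assms by simp
        ultimately show ?thesis unfolding x_def using cb by simp
      next
        case False
        then have "j t = int \<kappa> - int K" by (simp add: j_def)
        moreover have "real_of_int (j t) \<le> real_of_int (coord_bin \<kappa> t)" using j(3) by simp
        ultimately show ?thesis unfolding x_def using cb(1) kt(1) by simp
      qed
      have bound: "\<bar>R t t'\<bar> \<le> real \<kappa> * (\<Sum>i<K. \<bar>poly (W i) x\<bar> * indicator (bin_set \<kappa> (j t + int i)) t')" for t'
        unfolding R_def x_def[symmetric] sum_distrib_left
        by (rule order_trans[OF sum_abs], rule sum_mono) (simp add: abs_mult indicator_def)
      have meas: "R t \<in> borel_measurable borel" unfolding R_def[abs_def] by measurable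
      have le: "\<bar>R t t'\<bar> \<le> C * real \<kappa>" for t'
      proof -
        have "(\<Sum>i<K. \<bar>poly (W i) x\<bar> * indicator (bin_set \<kappa> (j t + int i)) t') \<le> (\<Sum>i<K. \<bar>poly (W i) x\<bar>)"
          by (intro sum_mono) (auto simp: indicator_def)
        also have "\<dots> \<le> C" by (rule C[OF x])
        finally have "real \<kappa> * (\<Sum>i<K. \<bar>poly (W i) x\<bar> * indicator (bin_set \<kappa> (j t + int i)) t') \<le> real \<kappa> * C"
          by (rule mult_left_mono) simp
        then show ?thesis using bound[of t'] by (subst mult.commute) (rule order_trans)
      qed
      have supp: "\<exists>i<K. t' \<in> bin_set \<kappa> (j t + int i)" if "R t t' \<noteq> 0" for t'
      proof (rule ccontr)
        assume "\<not> ?thesis"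
        then have "R t t' = 0" unfolding R_def by (intro sum.neutral) auto
        with that show False by simp
      qed
      have near: "t' \<in> {0..1} \<and> \<bar>coord_bin \<kappa> t' - coord_bin \<kappa> t\<bar> < int K" if "R t t' \<noteq> 0" for t'
        using supp[OF that] j by (auto simp: bin_set_def)
      have const: "R t t' = R t t''" if "t' \<in> {0..1}" "t'' \<in> {0..1}" "coord_bin \<kappa> t' = coord_bin \<kappa> t''" for t' t''
        unfolding R_def using that by (intro sum.cong refl) (auto simp: indicator_def bin_set_def)
      have bins: "0 \<le> j t + int i" "j t + int i < int \<kappa>" if "i < K" for i
        using j that by auto
      have int1: "integrable lborel (\<lambda>t'. indicator (bin_set \<kappa> i) t' :: real)" for i
        using integrable_bin_indicator[of "\<lambda>_. 1" 1 \<kappa> i] by simp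
      have int_R: "integrable lborel (R t)"
        unfolding R_def[abs_def] by (intro Bochner_Integration.integrable_sum integrable_mult_right int1)
      have L1: "(LINT t'|lborel. \<bar>R t t'\<bar>) \<le> C"
      proof -
        have "(LINT t'|lborel. \<bar>R t t'\<bar>) \<le> (LINT t'|lborel. real \<kappa> * (\<Sum>i<K. \<bar>poly (W i) x\<bar> * indicator (bin_set \<kappa> (j t + int i)) t'))"
          by (intro integral_mono bound integrable_abs int_R integrable_mult_right Bochner_Integration.integrable_sum int1)
        also have "\<dots> = real \<kappa> * (\<Sum>i<K. \<bar>poly (W i) x\<bar> * (LINT t'|lborel. indicator (bin_set \<kappa> (j t + int i)) t'))"
          unfolding Bochner_Integration.integral_mult_right_zero
            Bochner_Integration.integral_sum[OF integrable_mult_right[OF int1]] ..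
        also have "\<dots> = real \<kappa> * (\<Sum>i<K. \<bar>poly (W i) x\<bar> * (1 / real \<kappa>))"
          by (intro arg_cong[where f = "\<lambda>s. real \<kappa> * s"] sum.cong refl) (simp only: measure_bin_set[OF \<kappa> bins] lessThan_iff)
        also have "\<dots> = (\<Sum>i<K. \<bar>poly (W i) x\<bar>)" using \<kappa> by (simp add: sum_divide_distrib[symmetric])
        finally show ?thesis using C[OF x] by linarith
      qed
      \<comment> \<open>In block coordinates each bin integral is an increment of an antiderivative
        between consecutive integers, divided by \<kappa>; the factor \<kappa> in R cancels this,
        and \<open>bin_weights\<close> recombines the increments.\<close>
      have reproduce: "(LINT t'|lborel. R t t' * poly q t') = poly q t" if "degree q < K" for q
      proof -
        define q' where "q' = pcompose q [:real_of_int (j t) / real \<kappa>, 1 / real \<kappa>:]"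
        have q': "poly q' y = poly q ((real_of_int (j t) + y) / real \<kappa>)" for y
          by (simp add: q'_def poly_pcompose add_divide_distrib)
        have "degree q' < K" using that \<kappa> by (simp add: q'_def degree_pcompose)
        then obtain P where P: "pderiv P = q'" "degree P \<le> K"
          using poly_antiderivative[of q'] by (metis Suc_leI le_trans)
        define F where "F y = poly P (real \<kappa> * y - real_of_int (j t)) / real \<kappa>" for y
        have F: "(F has_real_derivative poly q y) (at y)" for y
        proof -
          have "(F has_real_derivative poly q' (real \<kappa> * y - real_of_int (j t)) * real \<kappa> / real \<kappa>) (at y)"
            unfolding F_def[abs_def] P(1)[symmetric]
            by (intro DERIV_cdivide DERIV_chain2[OF poly_DERIV]) (auto intro!: derivative_eq_intros)
          then show ?thesis using \<kappa> by (simp add: q')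
        qed
        have bq: "\<exists>B. \<forall>y\<in>{0..1}. \<bar>poly q y\<bar> \<le> B"
        proof -
          have "bounded (poly q ` {0..1})"
            by (intro compact_imp_bounded compact_continuous_image continuous_intros) auto
          then show ?thesis unfolding bounded_iff by auto
        qed
        then obtain B where B: "\<And>y. y \<in> {0..1} \<Longrightarrow> \<bar>poly q y\<bar> \<le> B" by blast
        have "(LINT t'|lborel. R t t' * poly q t') =
          (LINT t'|lborel. (\<Sum>i<K. (real \<kappa> * poly (W i) x) * (indicator (bin_set \<kappa> (j t + int i)) t' * poly q t')))"
          unfolding R_def x_def[symmetric] by (simp only: sum_distrib_right mult.assoc)
        also have "\<dots> = (\<Sum>i<K. real \<kappa> * poly (W i) x * (LINT t'|lborel. indicator (bin_set \<kappa> (j t + int i)) t' * poly q t'))"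
        proof (subst Bochner_Integration.integral_sum)
          have "poly q \<in> borel_measurable borel" by (intro borel_measurable_continuous_onI continuous_intros)
          then show "integrable lborel (\<lambda>t'. real \<kappa> * poly (W i) x * (indicator (bin_set \<kappa> (j t + int i)) t' * poly q t'))" for i
            by (intro integrable_mult_right integrable_bin_indicator[OF _ B])
        qed simp
        also have "\<dots> = (\<Sum>i<K. real \<kappa> * poly (W i) x * (F ((real_of_int (j t + int i) + 1) / real \<kappa>) - F (real_of_int (j t + int i) / real \<kappa>)))"
          by (intro sum.cong refl arg_cong2[where f = "(*)"] integral_bin_set[OF \<kappa> bins F]) auto
        also have "\<dots> = (\<Sum>i<K. poly (W i) x * (poly P (real i + 1) - poly P (real i)))"
        proof (intro sum.cong refl)
          fix i
          have F_ends: "F ((real_of_int (j t + int i) + 1) / real \<kappa>) = poly P (real i + 1) / real \<kappa>"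
            "F (real_of_int (j t + int i) / real \<kappa>) = poly P (real i) / real \<kappa>"
            using \<kappa> by (simp_all add: F_def)
          show "real \<kappa> * poly (W i) x * (F ((real_of_int (j t + int i) + 1) / real \<kappa>) - F (real_of_int (j t + int i) / real \<kappa>))
            = poly (W i) x * (poly P (real i + 1) - poly P (real i))"
            unfolding F_ends diff_divide_distrib[symmetric] using \<kappa> by simp
        qed
        also have "\<dots> = poly q' x" using W[OF P(2), of x] P(1) by simp
        also have "\<dots> = poly q t" using \<kappa> by (simp add: q' x_def)
        finally show ?thesis .
      qed
      have approx: "\<bar>\<phi> t - (LINT t'|lborel. R t t' * \<phi> t')\<bar> \<le> (1 + C) * E"
        if \<phi>: "\<phi> \<in> borel_measurable borel" "\<exists>B. \<forall>\<tau>\<in>{0..1}. \<bar>\<phi> \<tau>\<bar> \<le> B"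
          and q: "locally_polynomial \<kappa> K E \<phi>" for \<phi> E
      proof -
        define a where "a = real_of_int (j t) / real \<kappa>"
        have "real_of_int (j t) + real K \<le> real \<kappa>" using j(2) by linarith
        then have "0 \<le> a" "a + real K / real \<kappa> \<le> 1" using j(1) \<kappa> by (auto simp: a_def field_simps)
        with q[unfolded locally_polynomial_def] obtain q where q: "degree q < K" "\<And>\<tau>. \<tau> \<in> {a..a + real K / real \<kappa>} \<Longrightarrow> \<bar>\<phi> \<tau> - poly q \<tau>\<bar> \<le> E"
          by blast
        have ta: "t \<in> {a..a + real K / real \<kappa>}" using x \<kappa> by (auto simp: a_def x_def field_simps)
        have E0: "0 \<le> E" using q(2)[OF ta] by linarith
        have in_block: "t' \<in> {a..a + real K / real \<kappa>}" if nz: "R t t' \<noteq> 0" for t'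
        proof -
          obtain i where i: "i < K" "t' \<in> bin_set \<kappa> (j t + int i)" using supp[OF nz] by auto
          have "real i + 1 \<le> real K" using i(1) by linarith
          then have "real_of_int (j t) \<le> real_of_int (j t + int i)" "real_of_int (j t + int i) + 1 \<le> real_of_int (j t) + real K" by auto
          then have "a \<le> real_of_int (j t + int i) / real \<kappa>" "(real_of_int (j t + int i) + 1) / real \<kappa> \<le> a + real K / real \<kappa>"
            unfolding a_def add_divide_distrib[symmetric] by (intro divide_right_mono; simp)+
          then show ?thesis using bin_set_subset[OF \<kappa>] i(2) by fastforce
        qed
        obtain B where B: "\<And>\<tau>. \<tau> \<in> {0..1} \<Longrightarrow> \<bar>\<phi> \<tau>\<bar> \<le> B" using \<phi>(2) by blast
        have int\<phi>: "integrable lborel (\<lambda>t'. R t t' * \<phi> t')"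
        proof (rule Bochner_Integration.integrable_bound[where f = "\<lambda>t'. B * R t t'"])
          show "integrable lborel (\<lambda>t'. B * R t t')" using int_R by simp
          show "AE t' in lborel. norm (R t t' * \<phi> t') \<le> norm (B * R t t')"
          proof (rule AE_I2)
            fix t'
            show "norm (R t t' * \<phi> t') \<le> norm (B * R t t')"
            proof (cases "R t t' = 0")
              case False
              then have "\<bar>\<phi> t'\<bar> \<le> B" using near B by blast
              from mult_right_mono[OF this, of "\<bar>R t t'\<bar>"] have "\<bar>R t t'\<bar> * \<bar>\<phi> t'\<bar> \<le> \<bar>B\<bar> * \<bar>R t t'\<bar>"
                by (metis abs_ge_self abs_ge_zero mult.commute mult_right_mono order_trans)
              then show ?thesis by (simp add: abs_mult)
            qed simp
          qed
        qed (use \<phi>(1) meas in measurable)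
        have cont: "continuous_on {0..1} (poly q)" by (intro continuous_intros)
        then have "bounded (poly q ` {0..1})" by (intro compact_imp_bounded compact_continuous_image) auto
        then obtain B' where B': "\<And>\<tau>. \<tau> \<in> {0..1} \<Longrightarrow> \<bar>poly q \<tau>\<bar> \<le> B'" unfolding bounded_iff by fastforce
        have intq: "integrable lborel (\<lambda>t'. R t t' * poly q t')"
        proof (rule Bochner_Integration.integrable_bound[where f = "\<lambda>t'. B' * R t t'"])
          show "integrable lborel (\<lambda>t'. B' * R t t')" using int_R by simp
          show "AE t' in lborel. norm (R t t' * poly q t') \<le> norm (B' * R t t')"
          proof (rule AE_I2)
            fix t'
            show "norm (R t t' * poly q t') \<le> norm (B' * R t t')"
            proof (cases "R t t' = 0")
              case False
              then have "\<bar>poly q t'\<bar> \<le> B'" using near B' by blast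
              from mult_right_mono[OF this, of "\<bar>R t t'\<bar>"] have "\<bar>R t t'\<bar> * \<bar>poly q t'\<bar> \<le> \<bar>B'\<bar> * \<bar>R t t'\<bar>"
                by (metis abs_ge_self abs_ge_zero mult.commute mult_right_mono order_trans)
              then show ?thesis by (simp add: abs_mult)
            qed simp
          qed
          have "poly q \<in> borel_measurable borel" by (intro borel_measurable_continuous_onI continuous_intros)
          then show "(\<lambda>t'. R t t' * poly q t') \<in> borel_measurable lborel" using meas by measurable
        qed
        \<comment> \<open>The kernel reproduces q, so the error is that of q at t, at most E, plus
          the integral of the kernel against \<phi> - q, at most C E.\<close>
        have "\<phi> t - (LINT t'|lborel. R t t' * \<phi> t') = (\<phi> t - poly q t) - (LINT t'|lborel. R t t' * (\<phi> t' - poly q t'))"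
          using int\<phi> intq reproduce[OF q(1)] by (simp add: right_diff_distrib)
        moreover have "\<bar>LINT t'|lborel. R t t' * (\<phi> t' - poly q t')\<bar> \<le> C * E"
        proof -
          have "\<bar>LINT t'|lborel. R t t' * (\<phi> t' - poly q t')\<bar> \<le> (LINT t'|lborel. \<bar>R t t' * (\<phi> t' - poly q t')\<bar>)"
            by (rule integral_abs_bound)
          also have "\<dots> \<le> (LINT t'|lborel. \<bar>R t t'\<bar> * E)"
          proof (rule integral_mono)
            show "integrable lborel (\<lambda>t'. \<bar>R t t' * (\<phi> t' - poly q t')\<bar>)"
              using int\<phi> intq by (simp add: right_diff_distrib)
            show "integrable lborel (\<lambda>t'. \<bar>R t t'\<bar> * E)" using int_R by simp
            fix t'
            show "\<bar>R t t' * (\<phi> t' - poly q t')\<bar> \<le> \<bar>R t t'\<bar> * E"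
            proof (cases "R t t' = 0")
              case False
              then show ?thesis using q(2)[OF in_block] by (simp add: abs_mult mult_left_mono)
            qed simp
          qed
          also have "\<dots> \<le> C * E" using L1 E0 by (simp add: mult_right_mono)
          finally show ?thesis .
        qed
        ultimately show ?thesis using q(2)[OF ta] by (simp add: algebra_simps)
      qed
      show "R t \<in> borel_measurable borel \<and>
    (\<forall>t'. \<bar>R t t'\<bar> \<le> C * real \<kappa>) \<and>
    (\<forall>t'. R t t' \<noteq> 0 \<longrightarrow> t' \<in> {0..1} \<and> \<bar>coord_bin \<kappa> t' - coord_bin \<kappa> t\<bar> < int K) \<and>
    (\<forall>t'\<in>{0..1}. \<forall>t''\<in>{0..1}. coord_bin \<kappa> t' = coord_bin \<kappa> t'' \<longrightarrow> R t t' = R t t'') \<and>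
    (LINT t'|lborel. \<bar>R t t'\<bar>) \<le> C \<and>
    (\<forall>\<phi> E. \<phi> \<in> borel_measurable borel \<longrightarrow> (\<exists>B. \<forall>\<tau>\<in>{0..1}. \<bar>\<phi> \<tau>\<bar> \<le> B) \<longrightarrow>
      locally_polynomial \<kappa> K E \<phi> \<longrightarrow>
      \<bar>\<phi> t - (LINT t'|lborel. R t t' * \<phi> t')\<bar> \<le> (1 + C) * E)"
        by (intro conjI allI ballI impI meas le L1 approx const) (use near in auto)
    qed
  qed
qed

subsection \<open>Reconstruction on the unit cube\<close>

text \<open>Passage from functions on \<open>Basis\<close> to points, under which the Lebesgue
  integral becomes one over a product measure and coordinates can be integrated one at a
  time.\<close>

definition of_coords :: "('a::euclidean_space \<Rightarrow> real) \<Rightarrow> 'a" where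
  "of_coords u = (\<Sum>b\<in>Basis. u b *\<^sub>R b)"

lemma of_coords_inner [simp]: "b \<in> Basis \<Longrightarrow> of_coords u \<bullet> b = u b"
  by (simp add: of_coords_def inner_sum_left_Basis)

lemma of_coords_inner_self [simp]: "of_coords (\<lambda>b. x \<bullet> b) = x"
  by (simp add: of_coords_def euclidean_representation)

lemma of_coords_cong: "(\<And>b. b \<in> Basis \<Longrightarrow> u b = v b) \<Longrightarrow> of_coords u = of_coords v"
  by (simp add: of_coords_def)

lemma of_coords_update:
  assumes "b \<in> Basis"
  shows "of_coords u + (t - of_coords u \<bullet> b) *\<^sub>R b = of_coords (u(b := t))"
proof (rule euclidean_eqI)
  fix c :: 'a assume "c \<in> Basis"
  then show "(of_coords u + (t - of_coords u \<bullet> b) *\<^sub>R b) \<bullet> c = of_coords (u(b := t)) \<bullet> c"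
    using assms by (auto simp: inner_add_left inner_Basis)
qed

lemma of_coords_in_unit_cube: "of_coords u \<in> unit_cube \<longleftrightarrow> (\<forall>b\<in>Basis. u b \<in> {0..1})"
  by (simp add: mem_box)

lemma lborel_integral_coords:
  fixes f :: "'a::euclidean_space \<Rightarrow> real"
  assumes "f \<in> borel_measurable borel"
  shows "(LINT x|lborel. f x) = (LINT u|PiM Basis (\<lambda>_. lborel). f (of_coords u))"
  unfolding lborel_def[where 'a = 'a] lborel_eq_real[symmetric] of_coords_def
  using assms by (subst integral_distr) (auto intro!: borel_measurable_sum)

lemma reconstructsD:
  assumes "reconstructs \<kappa> K C R" "t \<in> {0..1}"
  shows "R t \<in> borel_measurable borel" "\<bar>R t t'\<bar> \<le> C * real \<kappa>"
    "R t t' \<noteq> 0 \<Longrightarrow> t' \<in> {0..1}" "R t t' \<noteq> 0 \<Longrightarrow> \<bar>coord_bin \<kappa> t' - coord_bin \<kappa> t\<bar> < int K"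
    "t' \<in> {0..1} \<Longrightarrow> t'' \<in> {0..1} \<Longrightarrow> coord_bin \<kappa> t' = coord_bin \<kappa> t'' \<Longrightarrow> R t t' = R t t''"
    "(LINT t'|lborel. \<bar>R t t'\<bar>) \<le> C"
    "\<phi> \<in> borel_measurable borel \<Longrightarrow> (\<And>\<tau>. \<bar>\<phi> \<tau>\<bar> \<le> B) \<Longrightarrow> locally_polynomial \<kappa> K E \<phi> \<Longrightarrow>
      \<bar>\<phi> t - (LINT t'|lborel. R t t' * \<phi> t')\<bar> \<le> (1 + C) * E"
  using assms unfolding reconstructs_def by blast+

lemma reconstructs_integrable:
  assumes "reconstructs \<kappa> K C R" "t \<in> {0..1}"
  shows "integrable lborel (R t)"
proof (rule Bochner_Integration.integrable_bound[where f = "\<lambda>t'::real. C * real \<kappa> * indicator {0..1} t'"])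
  show "integrable lborel (\<lambda>t'::real. C * real \<kappa> * indicator {0..1} t')"
    by (intro integrable_mult_right integrable_real_indicator) auto
  show "AE t' in lborel. norm (R t t') \<le> norm (C * real \<kappa> * indicator {0..1} t')"
  proof (rule AE_I2)
    fix t'
    show "norm (R t t') \<le> norm (C * real \<kappa> * indicator {0..1} t')"
    proof (cases "R t t' = 0")
      case False
      then show ?thesis using reconstructsD(2,3)[OF assms, of t'] by (simp add: indicator_def)
    qed simp
  qed
qed (use reconstructsD(1)[OF assms] in simp)

text \<open>The coordinates are smoothed one after another. With the coordinates in S already
  smoothed, one more changes the value by at most the one-dimensional error times the L1 norm C^|S|
  of the kernel so far; since C is at least 1, every step is bounded by the last exponent.\<close>

lemma reconstruction_error:
  fixes g :: "'a::euclidean_space \<Rightarrow> real"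
  assumes R: "reconstructs \<kappa> K C R" and "1 \<le> C" "0 \<le> E"
    and g[measurable]: "g \<in> borel_measurable borel" and B: "\<And>x. \<bar>g x\<bar> \<le> B"
    and lp: "\<And>x b. x \<in> unit_cube \<Longrightarrow> b \<in> Basis \<Longrightarrow> locally_polynomial \<kappa> K E (coord_line b x g)"
    and x: "x \<in> unit_cube"
  shows "\<bar>g x - (LINT x'|lborel. (\<Prod>b\<in>Basis. R (x \<bullet> b) (x' \<bullet> b)) * g x')\<bar>
    \<le> real DIM('a) * (C ^ DIM('a) * ((1 + C) * E))"
proof -
  interpret product_sigma_finite "\<lambda>_::'a. lborel :: real measure"
    by standard
  define u where "u b = x \<bullet> b" for b
  have u: "u b \<in> {0..1}" if "b \<in> Basis" for b using x that by (simp add: u_def mem_box)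
  note RD = reconstructsD[OF R u]
  \<comment> \<open>Coordinates in S are integration variables, the others stay at those of x. So
    \<open>T {}\<close> is g x and \<open>T Basis\<close> is the full reconstruction.\<close>
  define m where "m S v = of_coords (\<lambda>b. if b \<in> S then v b else u b)" for S and v :: "'a \<Rightarrow> real"
  define T where "T S = (LINT v|PiM S (\<lambda>_. lborel). (\<Prod>b\<in>S. R (u b) (v b)) * g (m S v))" for S
  have B0: "0 \<le> B" using B[of 0] by linarith
  have m_meas: "(\<lambda>v. m S v) \<in> borel_measurable (PiM S (\<lambda>_. lborel))" for S
    unfolding m_def of_coords_def
  proof (intro borel_measurable_sum borel_measurable_scaleR)
    fix b show "(\<lambda>v. if b \<in> S then v b else u b) \<in> borel_measurable (PiM S (\<lambda>_. lborel))"
      by (cases "b \<in> S") auto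
  qed simp
  have P_meas: "(\<lambda>v. \<Prod>b\<in>S. R (u b) (v b)) \<in> borel_measurable (PiM S (\<lambda>_. lborel))" if "S \<subseteq> Basis" for S
  proof (rule borel_measurable_prod)
    fix b assume "b \<in> S"
    then have "R (u b) \<in> borel_measurable borel" "(\<lambda>v. v b) \<in> PiM S (\<lambda>_. lborel) \<rightarrow>\<^sub>M borel"
      using that RD(1) by auto
    then show "(\<lambda>v. R (u b) (v b)) \<in> borel_measurable (PiM S (\<lambda>_. lborel))"
      by (rule measurable_compose[rotated])
  qed
  have P_int: "integrable (PiM S (\<lambda>_. lborel)) (\<lambda>v. \<Prod>b\<in>S. R (u b) (v b))" if "S \<subseteq> Basis" for S
    using that finite_subset[OF that finite_Basis] reconstructs_integrable[OF R] u
    by (intro product_integrable_prod) auto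
  have int_bounded: "integrable (PiM S (\<lambda>_. lborel)) (\<lambda>v. (\<Prod>b\<in>S. R (u b) (v b)) * h v)"
    if "S \<subseteq> Basis" "h \<in> borel_measurable (PiM S (\<lambda>_. lborel))" "\<And>v. (\<Prod>b\<in>S. R (u b) (v b)) \<noteq> 0 \<Longrightarrow> \<bar>h v\<bar> \<le> B'" for S h B'
  proof (rule Bochner_Integration.integrable_bound[where f = "\<lambda>v. B' * (\<Prod>b\<in>S. R (u b) (v b))"])
    show "AE v in PiM S (\<lambda>_. lborel). norm ((\<Prod>b\<in>S. R (u b) (v b)) * h v) \<le> norm (B' * (\<Prod>b\<in>S. R (u b) (v b)))"
    proof (rule AE_I2)
      fix v
      show "norm ((\<Prod>b\<in>S. R (u b) (v b)) * h v) \<le> norm (B' * (\<Prod>b\<in>S. R (u b) (v b)))"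
      proof (cases "(\<Prod>b\<in>S. R (u b) (v b)) = 0")
        case False
        then have "\<bar>h v\<bar> \<le> \<bar>B'\<bar>" using that(3)[OF False] by linarith
        from mult_left_mono[OF this, of "\<bar>\<Prod>b\<in>S. R (u b) (v b)\<bar>"] show ?thesis
          by (simp only: real_norm_def abs_mult) (simp only: mult.commute abs_ge_zero)
      qed simp
    qed
  qed (use P_int[OF that(1)] P_meas[OF that(1)] that(2) in auto)
  have main: "\<bar>g x - T S\<bar> \<le> real (card S) * (C ^ card S * ((1 + C) * E))" if "S \<subseteq> Basis" for S
    using finite_subset[OF that finite_Basis] that
  proof (induction S rule: finite_induct)
    case empty
    have "m {} v = x" for v by (simp add: m_def u_def)
    then have "T {} = g x"
      unfolding T_def by (simp add: PiM_empty lebesgue_integral_count_space_finite)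
    then show ?case by simp
  next
    case (insert b S)
    then have S: "S \<subseteq> Basis" and b: "b \<in> Basis" by auto
    define \<phi> where "\<phi> v t = g (m (insert b S) (v(b := t)))" for v t
    have \<phi>_line: "\<phi> v = coord_line b (m S v) g" for v
    proof
      fix t
      show "\<phi> v t = coord_line b (m S v) g t"
        unfolding \<phi>_def coord_line_def m_def of_coords_update[OF b]
        by (rule arg_cong[where f = g], rule of_coords_cong) auto
    qed
    have \<phi>_u: "\<phi> v (u b) = g (m S v)" for v
      unfolding \<phi>_def m_def by (rule arg_cong[where f = g], rule of_coords_cong) (use insert(2) in auto)
    have \<phi>_meas2: "(\<lambda>(v, t). \<phi> v t) \<in> borel_measurable (PiM S (\<lambda>_. lborel) \<Otimes>\<^sub>M lborel)"
    proof -
      have "(\<lambda>(v, t). v(b := t)) \<in> PiM S (\<lambda>_. lborel :: real measure) \<Otimes>\<^sub>M lborel \<rightarrow>\<^sub>M PiM (insert b S) (\<lambda>_. lborel)"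
        by (rule measurable_add_dim)
      from measurable_compose[OF measurable_compose[OF this m_meas] g]
      show ?thesis by (simp add: \<phi>_def case_prod_unfold)
    qed
    have \<phi>_meas: "\<phi> v \<in> borel_measurable borel" for v
    proof -
      have "(\<lambda>t. m S v + (t - m S v \<bullet> b) *\<^sub>R b) \<in> borel_measurable borel" by measurable
      from measurable_compose[OF this g] show ?thesis unfolding \<phi>_line coord_line_def .
    qed
    define I where "I v = (LINT t|lborel. R (u b) t * \<phi> v t)" for v
    have I_meas: "I \<in> borel_measurable (PiM S (\<lambda>_. lborel))"
    proof -
      have "(\<lambda>(v, t). R (u b) t * \<phi> v t) \<in> borel_measurable (PiM S (\<lambda>_. lborel) \<Otimes>\<^sub>M lborel)"
      proof -
        have "R (u b) \<in> borel_measurable lborel" using RD(1)[OF b] by simp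
        then have "(\<lambda>p. R (u b) (snd p)) \<in> borel_measurable (PiM S (\<lambda>_. lborel :: real measure) \<Otimes>\<^sub>M lborel)"
          by (rule measurable_compose[OF measurable_snd])
        with \<phi>_meas2 show ?thesis by (simp add: case_prod_unfold)
      qed
      then show ?thesis unfolding I_def[abs_def] by measurable
    qed
    have I_le: "\<bar>I v\<bar> \<le> C * B" for v
    proof -
      have "\<bar>I v\<bar> \<le> (LINT t|lborel. \<bar>R (u b) t * \<phi> v t\<bar>)" unfolding I_def by (rule integral_abs_bound)
      also have "\<dots> \<le> (LINT t|lborel. \<bar>R (u b) t\<bar> * B)"
      proof (rule integral_mono')
        show "integrable lborel (\<lambda>t. \<bar>R (u b) t\<bar> * B)"
          using reconstructs_integrable[OF R u[OF b]] by simp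
        show "\<bar>R (u b) t * \<phi> v t\<bar> \<le> \<bar>R (u b) t\<bar> * B" for t
          unfolding abs_mult \<phi>_def by (intro mult_left_mono B) auto
      qed (use B0 in auto)
      also have "\<dots> \<le> C * B" using RD(6)[OF b] B0 by (simp add: mult_right_mono)
      finally show ?thesis .
    qed
    have T_insert: "T (insert b S) = (LINT v|PiM S (\<lambda>_. lborel). (\<Prod>c\<in>S. R (u c) (v c)) * I v)"
    proof -
      have "T (insert b S) = (LINT v|PiM S (\<lambda>_. lborel). LINT t|lborel. (\<Prod>c\<in>insert b S. R (u c) ((v(b := t)) c)) * \<phi> v t)"
        unfolding T_def \<phi>_def
        by (rule product_integral_insert[OF insert(1,2)])
           (rule int_bounded[OF insert.prems measurable_compose[OF m_meas g]], rule B)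
      also have "\<dots> = (LINT v|PiM S (\<lambda>_. lborel). LINT t|lborel. (\<Prod>c\<in>S. R (u c) (v c)) * (R (u b) t * \<phi> v t))"
      proof -
        have "(\<Prod>c\<in>insert b S. R (u c) ((v(b := t)) c)) = (\<Prod>c\<in>S. R (u c) (v c)) * R (u b) t" for v t
        proof -
          have "(\<Prod>c\<in>S. R (u c) ((v(b := t)) c)) = (\<Prod>c\<in>S. R (u c) (v c))"
            using insert(2) by (intro prod.cong) auto
          then show ?thesis using insert(1,2) by simp
        qed
        then show ?thesis by (simp only: mult.assoc)
      qed
      also have "\<dots> = (LINT v|PiM S (\<lambda>_. lborel). (\<Prod>c\<in>S. R (u c) (v c)) * I v)"
        by (simp add: I_def)
      finally show ?thesis .
    qed
    have T_S: "T S = (LINT v|PiM S (\<lambda>_. lborel). (\<Prod>c\<in>S. R (u c) (v c)) * \<phi> v (u b))"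
      unfolding T_def \<phi>_u ..
    have \<phi>u_meas: "(\<lambda>v. \<phi> v (u b)) \<in> borel_measurable (PiM S (\<lambda>_. lborel))"
      unfolding \<phi>_u by (rule measurable_compose[OF m_meas g])
    have step: "\<bar>T S - T (insert b S)\<bar> \<le> C ^ card S * ((1 + C) * E)"
    proof -
      have i1: "integrable (PiM S (\<lambda>_. lborel)) (\<lambda>v. (\<Prod>c\<in>S. R (u c) (v c)) * \<phi> v (u b))"
        by (rule int_bounded[OF S \<phi>u_meas]) (unfold \<phi>_def, rule B)
      have i2: "integrable (PiM S (\<lambda>_. lborel)) (\<lambda>v. (\<Prod>c\<in>S. R (u c) (v c)) * I v)"
        by (rule int_bounded[OF S I_meas]) (rule I_le)
      have "T S - T (insert b S) = (LINT v|PiM S (\<lambda>_. lborel). (\<Prod>c\<in>S. R (u c) (v c)) * (\<phi> v (u b) - I v))"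
        unfolding T_S T_insert right_diff_distrib
        by (rule Bochner_Integration.integral_diff[OF i1 i2, symmetric])
      also have "\<bar>\<dots>\<bar> \<le> (LINT v|PiM S (\<lambda>_. lborel). \<bar>(\<Prod>c\<in>S. R (u c) (v c)) * (\<phi> v (u b) - I v)\<bar>)"
        by (rule integral_abs_bound)
      also have "\<dots> \<le> (LINT v|PiM S (\<lambda>_. lborel). (\<Prod>c\<in>S. \<bar>R (u c) (v c)\<bar>) * ((1 + C) * E))"
      proof (rule integral_mono')
        show "integrable (PiM S (\<lambda>_. lborel)) (\<lambda>v. (\<Prod>c\<in>S. \<bar>R (u c) (v c)\<bar>) * ((1 + C) * E))"
          using integrable_abs[OF P_int[OF S]] by (simp add: abs_prod)
        fix v
        show "0 \<le> (\<Prod>c\<in>S. \<bar>R (u c) (v c)\<bar>) * ((1 + C) * E)"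
          using assms(2,3) by (intro mult_nonneg_nonneg prod_nonneg) auto
        show "\<bar>(\<Prod>c\<in>S. R (u c) (v c)) * (\<phi> v (u b) - I v)\<bar> \<le> (\<Prod>c\<in>S. \<bar>R (u c) (v c)\<bar>) * ((1 + C) * E)"
        proof (cases "(\<Prod>c\<in>S. R (u c) (v c)) = 0")
          case True
          then show ?thesis using assms(2,3) by (simp only: mult_zero_left abs_zero) (intro mult_nonneg_nonneg prod_nonneg, auto)
        next
          case False
          \<comment> \<open>Where the kernel does not vanish the integration variables lie in
            [0, 1], so the line runs through a point of the cube and the local approximation is
            available.\<close>
          then have "R (u c) (v c) \<noteq> 0" if "c \<in> S" for c using that insert(1) by (auto simp: prod_zero_iff)
          then have "v c \<in> {0..1}" if "c \<in> S" for c using that S RD(3)[of c "v c"] by blast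
          then have "m S v \<in> unit_cube" unfolding m_def of_coords_in_unit_cube using u by auto
          then have "locally_polynomial \<kappa> K E (\<phi> v)" unfolding \<phi>_line by (rule lp[OF _ b])
          from RD(7)[OF b \<phi>_meas _ this, of B] have "\<bar>\<phi> v (u b) - I v\<bar> \<le> (1 + C) * E"
            by (simp add: I_def \<phi>_def B)
          then show ?thesis unfolding abs_mult abs_prod by (intro mult_left_mono prod_nonneg) auto
        qed
      qed
      also have "\<dots> = (LINT v|PiM S (\<lambda>_. lborel). (\<Prod>c\<in>S. \<bar>R (u c) (v c)\<bar>)) * ((1 + C) * E)"
        by simp
      also have "(LINT v|PiM S (\<lambda>_. lborel). (\<Prod>c\<in>S. \<bar>R (u c) (v c)\<bar>)) = (\<Prod>c\<in>S. LINT t|lborel. \<bar>R (u c) t\<bar>)"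
        using S u reconstructs_integrable[OF R] by (intro product_integral_prod insert(1)) auto
      also have "(\<Prod>c\<in>S. LINT t|lborel. \<bar>R (u c) t\<bar>) * ((1 + C) * E) \<le> (\<Prod>c\<in>S. C) * ((1 + C) * E)"
        using assms(2,3) S RD(6) by (intro mult_right_mono prod_mono) auto
      finally show ?thesis by simp
    qed
    have "\<bar>g x - T (insert b S)\<bar> \<le> real (card S) * (C ^ card S * ((1 + C) * E)) + C ^ card S * ((1 + C) * E)"
      using insert.IH[OF S] step by linarith
    also have "\<dots> = real (card (insert b S)) * (C ^ card S * ((1 + C) * E))"
      using insert(1,2) by (simp add: algebra_simps)
    also have "\<dots> \<le> real (card (insert b S)) * (C ^ card (insert b S) * ((1 + C) * E))"
      using assms(2,3) insert(1,2) by (intro mult_left_mono mult_right_mono power_increasing) auto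
    finally show ?case .
  qed
  have "T Basis = (LINT x'|lborel. (\<Prod>b\<in>Basis. R (x \<bullet> b) (x' \<bullet> b)) * g x')"
  proof -
    have "(\<lambda>x'. (\<Prod>b\<in>Basis. R (x \<bullet> b) (x' \<bullet> b)) * g x') \<in> borel_measurable borel"
    proof (intro borel_measurable_times borel_measurable_prod g)
      fix b :: 'a assume b: "b \<in> Basis"
      show "(\<lambda>x'. R (x \<bullet> b) (x' \<bullet> b)) \<in> borel_measurable borel"
        using measurable_compose[OF _ RD(1)[OF b], of "\<lambda>x'. x' \<bullet> b" borel] by (simp add: u_def)
    qed
    from lborel_integral_coords[OF this] show ?thesis
      unfolding T_def m_def by (auto intro!: Bochner_Integration.integral_cong arg_cong2[where f = "(*)"] prod.cong
        arg_cong[where f = g] of_coords_cong simp: u_def)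
  qed
  with main[of Basis] show ?thesis by simp
qed

section \<open>From the L2 norm to integrals over cells\<close>

definition cell :: "nat \<Rightarrow> ('a::euclidean_space \<Rightarrow> int) \<Rightarrow> 'a set" where
  "cell \<kappa> c = {x \<in> unit_cube. \<forall>b\<in>Basis. coord_bin \<kappa> (x \<bullet> b) = c b}"

definition cells :: "nat \<Rightarrow> ('a::euclidean_space \<Rightarrow> int) set" where
  "cells \<kappa> = PiE Basis (\<lambda>_. {0..<int \<kappa>})"

lemma finite_cells [simp]: "finite (cells \<kappa>)"
  unfolding cells_def by (intro finite_PiE) auto

lemma coord_bin_range: "\<kappa> \<ge> 1 \<Longrightarrow> t \<in> {0..1} \<Longrightarrow> coord_bin \<kappa> t \<in> {0..<int \<kappa>}"
  by (auto simp: coord_bin_def)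

lemma coord_bin_measurable_inner [measurable]:
  "(\<lambda>x :: 'a::euclidean_space. coord_bin \<kappa> (x \<bullet> b)) \<in> borel \<rightarrow>\<^sub>M count_space UNIV"
  by (rule measurable_compose[OF _ measurable_coord_bin]) measurable

lemma cell_measurable [measurable]: "cell \<kappa> (c :: 'a::euclidean_space \<Rightarrow> int) \<in> sets borel"
proof -
  have "cell \<kappa> c = unit_cube \<inter> (\<Inter>b\<in>Basis. (\<lambda>x. coord_bin \<kappa> (x \<bullet> b)) -` {c b} \<inter> space borel)"
    by (auto simp: cell_def)
  also have "\<dots> \<in> sets borel"
    by (intro sets.Int sets.finite_INT measurable_sets[OF coord_bin_measurable_inner]) auto
  finally show ?thesis .
qed

lemma indicator_cube_cells:
  fixes x :: "'a::euclidean_space"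
  assumes "\<kappa> \<ge> 1"
  shows "indicator unit_cube x = (\<Sum>c\<in>cells \<kappa>. indicator (cell \<kappa> c) x :: real)"
proof (cases "x \<in> unit_cube")
  case False
  then show ?thesis by (simp add: cell_def)
next
  case True
  define c0 where "c0 = restrict (\<lambda>b. coord_bin \<kappa> (x \<bullet> b)) Basis"
  have "x \<bullet> b \<in> {0..1}" if "b \<in> Basis" for b using True that by (simp add: mem_box)
  then have "c0 \<in> cells \<kappa>"
    unfolding cells_def c0_def restrict_PiE_iff using coord_bin_range[OF assms] by blast
  moreover have "x \<in> cell \<kappa> c \<longleftrightarrow> c = c0" if "c \<in> cells \<kappa>" for c
  proof
    assume "x \<in> cell \<kappa> c"
    then show "c = c0"
      using that by (intro PiE_ext[OF _ \<open>c0 \<in> cells \<kappa>\<close>[unfolded cells_def]]) (auto simp: cells_def cell_def c0_def)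
  qed (use True in \<open>auto simp: cell_def c0_def\<close>)
  then have "(\<Sum>c\<in>cells \<kappa>. indicator (cell \<kappa> c) x :: real) = (\<Sum>c\<in>cells \<kappa>. if c = c0 then 1 else 0)"
    by (intro sum.cong) (auto simp: indicator_def)
  ultimately show ?thesis using True by simp
qed

text \<open>At a point x the reconstruction combines the integrals over nearby cells with
  coefficients at most (C \<kappa>)^D. Squaring gives \<kappa>^(2D), and integrating over the points
  near a given cell gains a volume of order \<kappa>^(-D), which leaves \<kappa>^D.\<close>

lemma L2_le_cell_integrals:
  fixes g :: "'a::euclidean_space \<Rightarrow> real"
  assumes "1 \<le> K" "K \<le> \<kappa>" and R: "reconstructs \<kappa> K C R" and "1 \<le> C" "0 \<le> E"
    and g[measurable]: "g \<in> borel_measurable borel" and B: "\<And>x. \<bar>g x\<bar> \<le> B"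
    and lp: "\<And>x b. x \<in> unit_cube \<Longrightarrow> b \<in> Basis \<Longrightarrow> locally_polynomial \<kappa> K E (coord_line b x g)"
  defines "D \<equiv> DIM('a)"
  shows "(LINT x|lborel. indicator unit_cube x * (g x)\<^sup>2)
    \<le> 2 * (2 * real K * C) ^ (2 * D) * real \<kappa> ^ D * (\<Sum>c\<in>cells \<kappa>. (LINT x|lborel. indicator (cell \<kappa> c) x * g x)\<^sup>2)
      + 2 * (real D * (C ^ D * ((1 + C) * E)))\<^sup>2"
proof -
  have \<kappa>: "\<kappa> \<ge> 1" using assms by simp
  define a where "a c = (LINT x|lborel. indicator (cell \<kappa> c) x * g x)" for c
  define E' where "E' = real D * (C ^ D * ((1 + C) * E))"
  define near where "near c = {x \<in> unit_cube. \<forall>b\<in>Basis. \<bar>coord_bin \<kappa> (x \<bullet> b) - c b\<bar> < int K}" for c :: "'a \<Rightarrow> int"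
  have near_meas: "near c \<in> sets borel" for c
  proof -
    have "near c = unit_cube \<inter> (\<Inter>b\<in>Basis. (\<lambda>x. coord_bin \<kappa> (x \<bullet> b)) -` {j. \<bar>j - c b\<bar> < int K} \<inter> space borel)"
      by (auto simp: near_def)
    also have "\<dots> \<in> sets borel"
      by (intro sets.Int sets.finite_INT measurable_sets[OF coord_bin_measurable_inner]) auto
    finally show ?thesis .
  qed
  have B0: "0 \<le> B" using B[of 0] by linarith
  have int_cell: "integrable lborel (\<lambda>x. indicator (cell \<kappa> c) x * g x)" for c :: "'a \<Rightarrow> int"
  proof (rule Bochner_Integration.integrable_bound[where f = "\<lambda>x::'a. B * indicator unit_cube x"])
    show "AE x in lborel. norm (indicator (cell \<kappa> c) x * g x) \<le> norm (B * indicator unit_cube x)"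
    proof (rule AE_I2)
      fix x show "norm (indicator (cell \<kappa> c) x * g x) \<le> norm (B * indicator unit_cube x)"
        using B[of x] by (auto simp: indicator_def cell_def)
    qed
    show "integrable lborel (\<lambda>x::'a. B * indicator unit_cube x)"
      by (intro integrable_mult_right integrable_real_indicator) (auto simp: emeasure_lborel_cbox_eq)
  qed measurable
  have pointwise: "\<bar>g x\<bar> \<le> (C * real \<kappa>) ^ D * (\<Sum>c\<in>cells \<kappa>. indicator (near c) x * \<bar>a c\<bar>) + E'"
    if x: "x \<in> unit_cube" for x
  proof -
    have x01: "x \<bullet> b \<in> {0..1}" if "b \<in> Basis" for b using x that by (simp add: mem_box)
    note RD = reconstructsD[OF R x01]
    \<comment> \<open>The constant value of the product kernel on a cell, read off at the lower
      corner c / \<kappa>, which belongs to that cell's bins in every coordinate.\<close>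
    define \<rho> where "\<rho> c = (\<Prod>b\<in>Basis. R (x \<bullet> b) (real_of_int (c b) / real \<kappa>))" for c :: "'a \<Rightarrow> int"
    have rep: "real_of_int (c b) / real \<kappa> \<in> {0..1}" "coord_bin \<kappa> (real_of_int (c b) / real \<kappa>) = c b"
      if "c \<in> cells \<kappa>" "b \<in> Basis" for c :: "'a \<Rightarrow> int" and b
    proof -
      have c: "0 \<le> c b" "c b < int \<kappa>" using that by (auto simp: cells_def PiE_iff)
      then have "real_of_int (c b) \<le> real \<kappa>" by linarith
      with c \<kappa> show "real_of_int (c b) / real \<kappa> \<in> {0..1}" by (auto simp: divide_le_eq)
      show "coord_bin \<kappa> (real_of_int (c b) / real \<kappa>) = c b" using c \<kappa> by (simp add: coord_bin_def)
    qed
    have kernel: "(\<Prod>b\<in>Basis. R (x \<bullet> b) (x' \<bullet> b)) * g x' = (\<Sum>c\<in>cells \<kappa>. \<rho> c * (indicator (cell \<kappa> c) x' * g x'))" for x'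
    proof -
      have on_cell: "(\<Prod>b\<in>Basis. R (x \<bullet> b) (x' \<bullet> b)) = \<rho> c" if c: "c \<in> cells \<kappa>" "x' \<in> cell \<kappa> c" for c
        unfolding \<rho>_def
      proof (rule prod.cong[OF refl])
        fix b :: 'a assume b: "b \<in> Basis"
        show "R (x \<bullet> b) (x' \<bullet> b) = R (x \<bullet> b) (real_of_int (c b) / real \<kappa>)"
          using c(2) b rep[OF c(1) b] by (intro RD(5)) (auto simp: cell_def mem_box)
      qed
      have "(\<Prod>b\<in>Basis. R (x \<bullet> b) (x' \<bullet> b)) = (\<Prod>b\<in>Basis. R (x \<bullet> b) (x' \<bullet> b)) * indicator unit_cube x'"
      proof (cases "x' \<in> unit_cube")
        case False
        then obtain b where b: "b \<in> Basis" "x' \<bullet> b \<notin> {0..1}" by (auto simp: mem_box)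
        then have "R (x \<bullet> b) (x' \<bullet> b) = 0" using RD(3) by blast
        then show ?thesis using b(1) False by (auto intro!: prod_zero)
      qed simp
      also have "\<dots> = (\<Sum>c\<in>cells \<kappa>. (\<Prod>b\<in>Basis. R (x \<bullet> b) (x' \<bullet> b)) * indicator (cell \<kappa> c) x')"
        unfolding indicator_cube_cells[OF \<kappa>] sum_distrib_left ..
      also have "\<dots> = (\<Sum>c\<in>cells \<kappa>. \<rho> c * indicator (cell \<kappa> c) x')"
        by (intro sum.cong refl) (auto simp: indicator_def on_cell)
      finally show ?thesis by (simp only: sum_distrib_right mult.assoc)
    qed
    have "(LINT x'|lborel. (\<Prod>b\<in>Basis. R (x \<bullet> b) (x' \<bullet> b)) * g x') = (\<Sum>c\<in>cells \<kappa>. \<rho> c * a c)"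
      unfolding kernel a_def using int_cell by (subst Bochner_Integration.integral_sum) auto
    with reconstruction_error[OF R assms(4,5) g B lp x]
    have "\<bar>g x - (\<Sum>c\<in>cells \<kappa>. \<rho> c * a c)\<bar> \<le> E'" by (simp add: E'_def D_def)
    moreover have "\<bar>\<Sum>c\<in>cells \<kappa>. \<rho> c * a c\<bar> \<le> (\<Sum>c\<in>cells \<kappa>. (C * real \<kappa>) ^ D * (indicator (near c) x * \<bar>a c\<bar>))"
    proof (rule order_trans[OF sum_abs], rule sum_mono)
      fix c :: "'a \<Rightarrow> int" assume c: "c \<in> cells \<kappa>"
      have "\<bar>\<rho> c\<bar> \<le> (C * real \<kappa>) ^ D * indicator (near c) x"
      proof (cases "x \<in> near c")
        case True
        have "\<bar>\<rho> c\<bar> \<le> (\<Prod>b\<in>(Basis::'a set). C * real \<kappa>)"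
          unfolding \<rho>_def abs_prod by (intro prod_mono) (use RD(2) in auto)
        then show ?thesis using True by (simp add: D_def)
      next
        case False
        then obtain b where b: "b \<in> Basis" "\<not> \<bar>coord_bin \<kappa> (x \<bullet> b) - c b\<bar> < int K" using x by (auto simp: near_def)
        then have "R (x \<bullet> b) (real_of_int (c b) / real \<kappa>) = 0"
          using RD(4)[OF b(1), of "real_of_int (c b) / real \<kappa>"] rep[OF c b(1)] by (metis abs_minus_commute)
        then have "\<rho> c = 0" unfolding \<rho>_def using b(1) by (auto intro!: prod_zero)
        then show ?thesis using False by simp
      qed
      from mult_right_mono[OF this, of "\<bar>a c\<bar>"]
      show "\<bar>\<rho> c * a c\<bar> \<le> (C * real \<kappa>) ^ D * (indicator (near c) x * \<bar>a c\<bar>)"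
        by (simp add: abs_mult mult.assoc)
    qed
    ultimately show ?thesis unfolding sum_distrib_left[symmetric] by linarith
  qed
  \<comment> \<open>Cauchy-Schwarz over the at most (2K - 1)^D cells near x. Using the locality is
    essential: over all cells it would cost another factor \<kappa>^D.\<close>
  have count: "(\<Sum>c\<in>cells \<kappa>. indicator (near c) x * \<bar>a c\<bar>)\<^sup>2 \<le> (2 * real K) ^ D * (\<Sum>c\<in>cells \<kappa>. indicator (near c) x * (a c)\<^sup>2)" for x
  proof -
    define N where "N = {c \<in> cells \<kappa>. x \<in> near c}"
    have "N \<subseteq> PiE Basis (\<lambda>b. {coord_bin \<kappa> (x \<bullet> b) - int K<..<coord_bin \<kappa> (x \<bullet> b) + int K})"
      by (auto simp: N_def near_def cells_def PiE_iff abs_less_iff extensional_def)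
    then have "card N \<le> card (PiE (Basis::'a set) (\<lambda>b. {coord_bin \<kappa> (x \<bullet> b) - int K<..<coord_bin \<kappa> (x \<bullet> b) + int K}))"
      by (intro card_mono finite_PiE) auto
    also have "\<dots> = (\<Prod>b\<in>(Basis::'a set). 2 * K - 1)"
    proof -
      have "nat (2 * int K - 1) = 2 * K - 1" by linarith
      then show ?thesis by (subst card_PiE) auto
    qed
    also have "\<dots> = (2 * K - 1) ^ D" by (simp add: D_def)
    also have "\<dots> \<le> (2 * K) ^ D" by (rule power_mono) auto
    finally have N: "real (card N) \<le> (2 * real K) ^ D" by (metis of_nat_le_iff of_nat_mult of_nat_numeral of_nat_power)
    have *: "(\<Sum>c\<in>cells \<kappa>. indicator (near c) x * f c) = (\<Sum>c\<in>N. f c)" for f :: "('a \<Rightarrow> int) \<Rightarrow> real"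
      unfolding N_def sum.inter_filter[OF finite_cells] by (intro sum.cong) (auto simp: indicator_def)
    have "(\<Sum>c\<in>N. \<bar>a c\<bar>)\<^sup>2 \<le> (\<Sum>c\<in>N. (\<bar>a c\<bar>)\<^sup>2) * real (card N)" by (rule sum_squared_le_sum_of_squares)
    also have "\<dots> \<le> (\<Sum>c\<in>N. (a c)\<^sup>2) * (2 * real K) ^ D"
      unfolding power2_abs by (intro mult_left_mono N sum_nonneg) auto
    finally show ?thesis unfolding * by (simp add: mult.commute)
  qed
  let ?A = "2 * (C * real \<kappa>) ^ (2 * D) * (2 * real K) ^ D"
  have square: "indicator unit_cube x * (g x)\<^sup>2 \<le>
    (\<Sum>c\<in>cells \<kappa>. ?A * (a c)\<^sup>2 * indicator (near c) x) + 2 * E'\<^sup>2 * indicator unit_cube x" for x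
  proof (cases "x \<in> unit_cube")
    case False
    then show ?thesis using assms(4) by (auto intro!: sum_nonneg)
  next
    case True
    let ?s = "\<Sum>c\<in>cells \<kappa>. indicator (near c) x * \<bar>a c\<bar>"
    have s0: "0 \<le> ?s" by (intro sum_nonneg) auto
    have E0: "0 \<le> E'" using assms(4,5) by (simp add: E'_def)
    have "(g x)\<^sup>2 \<le> ((C * real \<kappa>) ^ D * ?s + E')\<^sup>2"
      using pointwise[OF True] by (simp add: abs_le_square_iff[symmetric])
    also have "\<dots> \<le> 2 * ((C * real \<kappa>) ^ D * ?s)\<^sup>2 + 2 * E'\<^sup>2"
      using zero_le_power2[of "(C * real \<kappa>) ^ D * ?s - E'"] by (simp add: power2_eq_square algebra_simps)
    also have "((C * real \<kappa>) ^ D * ?s)\<^sup>2 = (C * real \<kappa>) ^ (2 * D) * ?s\<^sup>2"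
      by (simp add: power_mult_distrib power_mult[symmetric] mult.commute)
    also have "2 * ((C * real \<kappa>) ^ (2 * D) * ?s\<^sup>2) \<le> 2 * ((C * real \<kappa>) ^ (2 * D) * ((2 * real K) ^ D * (\<Sum>c\<in>cells \<kappa>. indicator (near c) x * (a c)\<^sup>2)))"
      using assms(4) by (intro mult_left_mono count) auto
    also have "\<dots> = (\<Sum>c\<in>cells \<kappa>. ?A * (a c)\<^sup>2 * indicator (near c) x)"
      unfolding sum_distrib_left by (intro sum.cong refl) (simp only: mult_ac)
    finally show ?thesis using True by simp
  qed
  have vol: "(LINT x|lborel. indicator (near c) x :: real) \<le> (2 * real K / real \<kappa>) ^ D" and near_int: "integrable lborel (\<lambda>x. indicator (near c) x :: real)"
    if "c \<in> cells \<kappa>" for c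
  proof -
    let ?l = "of_coords (\<lambda>b. (real_of_int (c b) - real K) / real \<kappa>)" and ?h = "of_coords (\<lambda>b. (real_of_int (c b) + real K) / real \<kappa>)"
    have sub: "near c \<subseteq> cbox ?l ?h"
    proof
      fix x assume x: "x \<in> near c"
      show "x \<in> cbox ?l ?h"
        unfolding mem_box
      proof
        fix b :: 'a assume b: "b \<in> Basis"
        have "x \<bullet> b \<in> bin_set \<kappa> (coord_bin \<kappa> (x \<bullet> b))" using x b by (auto simp: near_def bin_set_def mem_box)
        then have 1: "x \<bullet> b \<in> {real_of_int (coord_bin \<kappa> (x \<bullet> b)) / real \<kappa>..(real_of_int (coord_bin \<kappa> (x \<bullet> b)) + 1) / real \<kappa>}"
          using bin_set_subset[OF \<kappa>] by blast
        have "\<bar>coord_bin \<kappa> (x \<bullet> b) - c b\<bar> < int K" using x b by (auto simp: near_def)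
        then have 2: "real_of_int (c b) - real K \<le> real_of_int (coord_bin \<kappa> (x \<bullet> b))"
          "real_of_int (coord_bin \<kappa> (x \<bullet> b)) + 1 \<le> real_of_int (c b) + real K" by linarith+
        show "?l \<bullet> b \<le> x \<bullet> b \<and> x \<bullet> b \<le> ?h \<bullet> b"
          using 1 divide_right_mono[OF 2(1), of "real \<kappa>"] divide_right_mono[OF 2(2), of "real \<kappa>"] b by auto
      qed
    qed
    have fin: "emeasure lborel (cbox ?l ?h) < \<infinity>" by (simp add: emeasure_lborel_cbox_eq)
    have "emeasure lborel (near c) \<le> emeasure lborel (cbox ?l ?h)" by (rule emeasure_mono[OF sub]) simp
    then show "integrable lborel (\<lambda>x. indicator (near c) x :: real)"
      using fin near_meas by (intro integrable_real_indicator) (auto intro: le_less_trans)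
    have "measure lborel (near c) \<le> measure lborel (cbox ?l ?h)"
      by (rule measure_mono_fmeasurable[OF sub]) (use near_meas in \<open>auto simp: fmeasurable_def emeasure_lborel_cbox_eq\<close>)
    also have "\<dots> = (\<Prod>b\<in>(Basis::'a set). (?h - ?l) \<bullet> b)"
      by (rule measure_lborel_cbox) (use \<kappa> in \<open>auto intro!: divide_right_mono\<close>)
    also have "\<dots> = (\<Prod>b\<in>(Basis::'a set). 2 * real K / real \<kappa>)"
      by (intro prod.cong refl) (simp add: inner_diff_left diff_divide_distrib[symmetric])
    finally show "(LINT x|lborel. indicator (near c) x :: real) \<le> (2 * real K / real \<kappa>) ^ D"
      using near_meas by (simp add: D_def)
  qed
  have cube_int: "integrable lborel (\<lambda>x::'a. indicator unit_cube x :: real)"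
    by (intro integrable_real_indicator) (auto simp: emeasure_lborel_cbox_eq)
  have cube_vol: "(LINT x|lborel. indicator unit_cube (x::'a) :: real) = 1"
    by (simp add: measure_lborel_cbox_eq)
  have "(LINT x|lborel. indicator unit_cube x * (g x)\<^sup>2) \<le>
    (LINT x|lborel. (\<Sum>c\<in>cells \<kappa>. ?A * (a c)\<^sup>2 * indicator (near c) x) + 2 * E'\<^sup>2 * indicator unit_cube x)"
    using near_int cube_int assms(4)
    by (intro integral_mono' square Bochner_Integration.integrable_add Bochner_Integration.integrable_sum integrable_mult_right)
       (auto intro!: add_nonneg_nonneg sum_nonneg)
  also have "\<dots> = (\<Sum>c\<in>cells \<kappa>. ?A * (a c)\<^sup>2 * (LINT x|lborel. indicator (near c) x)) + 2 * E'\<^sup>2 * (LINT x|lborel. indicator unit_cube (x::'a))"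
  proof -
    have i1: "integrable lborel (\<lambda>x. ?A * (a c)\<^sup>2 * indicator (near c) x :: real)" if "c \<in> cells \<kappa>" for c
      by (rule integrable_mult_right) (rule near_int[OF that])
    have i2: "integrable lborel (\<lambda>x::'a. 2 * E'\<^sup>2 * indicator unit_cube x :: real)"
      by (rule integrable_mult_right) (rule cube_int)
    show ?thesis
      by (simp only: Bochner_Integration.integral_add[OF Bochner_Integration.integrable_sum[OF i1] i2]
        Bochner_Integration.integral_sum[OF i1] Bochner_Integration.integral_mult_right_zero)
  qed
  also have "\<dots> \<le> (\<Sum>c\<in>cells \<kappa>. ?A * (a c)\<^sup>2 * (2 * real K / real \<kappa>) ^ D) + 2 * E'\<^sup>2 * 1"
    unfolding cube_vol using assms(4)
    by (intro add_mono sum_mono mult_left_mono vol) auto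
  also have "\<dots> = 2 * (2 * real K * C) ^ (2 * D) * real \<kappa> ^ D * (\<Sum>c\<in>cells \<kappa>. (a c)\<^sup>2) + 2 * E'\<^sup>2"
  proof -
    have eq: "?A * (2 * real K / real \<kappa>) ^ D = 2 * (2 * real K * C) ^ (2 * D) * real \<kappa> ^ D"
      unfolding mult_2[of D] power_add power_mult_distrib power_divide using \<kappa> by simp
    have "(\<Sum>c\<in>cells \<kappa>. ?A * (a c)\<^sup>2 * (2 * real K / real \<kappa>) ^ D) =
      ?A * (2 * real K / real \<kappa>) ^ D * (\<Sum>c\<in>cells \<kappa>. (a c)\<^sup>2)"
      unfolding sum_distrib_left by (intro sum.cong refl) (simp only: mult_ac)
    then show ?thesis unfolding eq by simp
  qed
  finally show ?thesis by (simp only: a_def E'_def)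
qed

subsection \<open>Hoelder functions\<close>

text \<open>Downward induction from the top derivative, which is nearly constant by the Hoelder
  condition. Each step takes an antiderivative of the approximation and gains a factor r by the mean
  value inequality, so only derivatives within [0, 1] occur.\<close>

lemma Taylor_approximation:
  fixes \<phi> :: "nat \<Rightarrow> real \<Rightarrow> real"
  assumes deriv: "\<And>k t. k < m \<Longrightarrow> t \<in> {0..1} \<Longrightarrow> (\<phi> k has_real_derivative \<phi> (Suc k) t) (at t within {0..1})"
    and top: "\<And>t t'. t \<in> {0..1} \<Longrightarrow> t' \<in> {0..1} \<Longrightarrow> \<bar>\<phi> m t - \<phi> m t'\<bar> \<le> L * \<bar>t - t'\<bar> powr (s - real m)"
    and "real m \<le> s" "0 \<le> L" and a: "0 \<le> a" "0 < r" "a + r \<le> 1" and "k \<le> m"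
  shows "\<exists>q. degree q \<le> m - k \<and> (\<forall>\<tau>\<in>{a..a + r}. \<bar>\<phi> k \<tau> - poly q \<tau>\<bar> \<le> L * r powr (s - real k))"
  using \<open>k \<le> m\<close>
proof (induction rule: inc_induct)
  case base
  show ?case
  proof (intro exI conjI ballI)
    fix \<tau> assume \<tau>: "\<tau> \<in> {a..a + r}"
    then have "\<bar>\<phi> m \<tau> - \<phi> m a\<bar> \<le> L * \<bar>\<tau> - a\<bar> powr (s - real m)"
      using a by (intro top) auto
    also have "\<dots> \<le> L * r powr (s - real m)"
      using assms(3,4) \<tau> by (intro mult_left_mono powr_mono2) auto
    finally show "\<bar>\<phi> m \<tau> - poly [:\<phi> m a:] \<tau>\<bar> \<le> L * r powr (s - real m)" by simp
  qed simp
next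
  case (step k)
  then obtain q where q: "degree q \<le> m - Suc k"
    "\<And>\<tau>. \<tau> \<in> {a..a + r} \<Longrightarrow> \<bar>\<phi> (Suc k) \<tau> - poly q \<tau>\<bar> \<le> L * r powr (s - real (Suc k))" by blast
  obtain P where P: "pderiv P = q" "degree P \<le> Suc (degree q)" using poly_antiderivative by blast
  \<comment> \<open>The constant of integration is chosen so that Q agrees with
    \<open>\<phi> k\<close> at a; thus Q is the Taylor polynomial at a.\<close>
  define Q where "Q = P + [:\<phi> k a - poly P a:]"
  have Q: "pderiv Q = q" "poly Q a = \<phi> k a" by (simp_all add: Q_def P pderiv_add pderiv_pCons)
  have "degree Q \<le> m - k"
    unfolding Q_def using P(2) q(1) step.hyps by (intro degree_add_le) auto
  moreover have "\<bar>\<phi> k \<tau> - poly Q \<tau>\<bar> \<le> L * r powr (s - real k)" if \<tau>: "\<tau> \<in> {a..a + r}" for \<tau>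
  proof -
    have "norm ((\<phi> k \<tau> - poly Q \<tau>) - (\<phi> k a - poly Q a)) \<le> L * r powr (s - real (Suc k)) * norm (\<tau> - a)"
    proof (rule field_differentiable_bound[where S = "{a..a + r}" and f = "\<lambda>t. \<phi> k t - poly Q t"])
      fix t assume t: "t \<in> {a..a + r}"
      have "(\<phi> k has_real_derivative \<phi> (Suc k) t) (at t within {a..a + r})"
        using t a step.hyps by (intro DERIV_subset[OF deriv]) auto
      then show "((\<lambda>t. \<phi> k t - poly Q t) has_real_derivative \<phi> (Suc k) t - poly q t) (at t within {a..a + r})"
        using DERIV_subset[OF poly_DERIV[of Q t], of "{a..a + r}"] by (intro DERIV_diff) (auto simp: Q)
      show "norm (\<phi> (Suc k) t - poly q t) \<le> L * r powr (s - real (Suc k))" using q(2)[OF t] by simp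
    qed (use \<tau> a in auto)
    also have "\<dots> \<le> L * r powr (s - real (Suc k)) * r"
      using \<tau> assms(4) by (intro mult_left_mono) auto
    also have "\<dots> = L * (r powr (s - real (Suc k)) * r powr 1)" using a by simp
    also have "\<dots> = L * r powr (s - real k)" unfolding powr_add[symmetric] by simp
    finally show ?thesis by (simp add: Q)
  qed
  ultimately show ?case by blast
qed

lemma finite_multi_index: "finite (multi_index k :: 'a::euclidean_space list set)"
  unfolding multi_index_def by (rule finite_lists_length_eq) simp

lemma replicate_multi_index: "b \<in> Basis \<Longrightarrow> replicate k b \<in> multi_index k"
  by (auto simp: multi_index_def)

lemma abs_le_L2_set: "finite A \<Longrightarrow> i \<in> A \<Longrightarrow> \<bar>f i\<bar> \<le> L2_set f A"
  using member_le_L2_set[of A i "\<lambda>i. \<bar>f i\<bar>"] by (simp add: L2_set_def)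

context
  fixes f :: "'a::euclidean_space \<Rightarrow> real" and s L :: real
  assumes f: "f \<in> holder_class s L" and s: "0 < s" and L: "0 < L"
begin

lemma line_in_cube: "x \<in> unit_cube \<Longrightarrow> b \<in> Basis \<Longrightarrow> t \<in> {0..1} \<Longrightarrow> x + (t - x \<bullet> b) *\<^sub>R b \<in> unit_cube"
  for x b :: 'a
  by (auto simp: mem_box inner_add_left inner_Basis)

text \<open>All points of a coordinate line have the same restriction of the function to that line.
  So the pointwise partial derivatives, taken at moving points, are the derivative of one function
  of one variable.\<close>

lemma line_deriv:
  fixes x b :: 'a
  assumes x: "x \<in> unit_cube" and b: "b \<in> Basis" and k: "k < nat \<lfloor>s\<rfloor>" and t: "t \<in> {0..1}"
  shows "(coord_line b x (iter_partial (replicate k b) f) has_real_derivative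
    coord_line b x (iter_partial (replicate (Suc k) b) f) t) (at t within {0..1})"
proof -
  let ?F = "iter_partial (replicate k b) f" and ?y = "x + (t - x \<bullet> b) *\<^sub>R b"
  have yb: "?y \<bullet> b = t" using b by (simp add: inner_add_left)
  have line: "coord_line b ?y ?F = coord_line b x ?F"
    unfolding coord_line_def yb by (simp add: algebra_simps scaleR_diff_left)
  have "partial_differentiable b ?F"
    using f k b replicate_multi_index[OF b, of k] unfolding holder_class_def times_differentiable_def Let_def by blast
  then have "coord_line b ?y ?F differentiable (at (?y \<bullet> b) within {0..1})"
    unfolding partial_differentiable_def using line_in_cube[OF x b t] by blast
  then have d: "coord_line b x ?F differentiable (at t within {0..1})" unfolding line yb .
  have "coord_line b x (iter_partial (replicate (Suc k) b) f) t = vector_derivative (coord_line b x ?F) (at t within {0..1})"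
    unfolding coord_line_def[of b x "iter_partial (replicate (Suc k) b) f"] by (simp add: partial_deriv_def yb[simplified] line[simplified])
  then show ?thesis
    using d unfolding has_real_derivative_iff_has_vector_derivative by (simp only: vector_derivative_works)
qed

lemma line_top:
  fixes x b :: 'a
  assumes x: "x \<in> unit_cube" and b: "b \<in> Basis" and t: "t \<in> {0..1}" "t' \<in> {0..1}"
  defines "m \<equiv> nat \<lfloor>s\<rfloor>"
  shows "\<bar>coord_line b x (iter_partial (replicate m b) f) t - coord_line b x (iter_partial (replicate m b) f) t'\<bar>
    \<le> L * \<bar>t - t'\<bar> powr (s - real m)"
proof -
  let ?y = "\<lambda>t. x + (t - x \<bullet> b) *\<^sub>R b"
  have "?y t - ?y t' = (t - t') *\<^sub>R b" by (simp add: algebra_simps)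
  then have n: "norm (?y t - ?y t') = \<bar>t - t'\<bar>" using b by simp
  have "\<bar>iter_partial (replicate m b) f (?y t) - iter_partial (replicate m b) f (?y t')\<bar> \<le>
    L2_set (\<lambda>bs. iter_partial bs f (?y t) - iter_partial bs f (?y t')) (multi_index m)"
    by (rule abs_le_L2_set[OF finite_multi_index replicate_multi_index[OF b]])
  also have "\<dots> \<le> L * norm (?y t - ?y t') powr (s - real m)"
    using f line_in_cube[OF x b] t unfolding holder_class_def Let_def m_def by blast
  finally show ?thesis unfolding n coord_line_def .
qed

lemma holder_locally_polynomial:
  fixes x b :: 'a
  assumes x: "x \<in> unit_cube" and b: "b \<in> Basis" and "1 \<le> \<kappa>"
  defines "K \<equiv> Suc (nat \<lfloor>s\<rfloor>)"
  shows "locally_polynomial \<kappa> K (L * (real K / real \<kappa>) powr s) (coord_line b x f)"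
  unfolding locally_polynomial_def
proof (intro allI impI)
  fix a assume a: "0 \<le> a" "a + real K / real \<kappa> \<le> 1"
  have r: "0 < real K / real \<kappa>" using assms(3) by (simp add: K_def)
  have m: "real (nat \<lfloor>s\<rfloor>) \<le> s" using s by linarith
  have "\<exists>q. degree q \<le> nat \<lfloor>s\<rfloor> - 0 \<and> (\<forall>\<tau>\<in>{a..a + real K / real \<kappa>}.
      \<bar>coord_line b x (iter_partial (replicate 0 b) f) \<tau> - poly q \<tau>\<bar> \<le> L * (real K / real \<kappa>) powr (s - real 0))"
    using L by (intro Taylor_approximation[where \<phi> = "\<lambda>k. coord_line b x (iter_partial (replicate k b) f)"]
      line_deriv[OF x b] line_top[OF x b] m a r) auto
  then obtain q where "degree q \<le> nat \<lfloor>s\<rfloor>"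
    "\<forall>\<tau>\<in>{a..a + real K / real \<kappa>}. \<bar>coord_line b x f \<tau> - poly q \<tau>\<bar> \<le> L * (real K / real \<kappa>) powr s" by auto
  then show "\<exists>q. degree q < K \<and> (\<forall>\<tau>\<in>{a..a + real K / real \<kappa>}. \<bar>coord_line b x f \<tau> - poly q \<tau>\<bar> \<le> L * (real K / real \<kappa>) powr s)"
    unfolding K_def by (intro exI[of _ q]) auto
qed

text \<open>For s < 1 the Hoelder condition bounds the function's own increments; otherwise the
  first derivative is bounded by L. Nothing in the class bounds the function itself, which is why
  oscillations are used.\<close>

lemma line_oscillation:
  fixes x b :: 'a
  assumes x: "x \<in> unit_cube" and b: "b \<in> Basis" and t: "t \<in> {0..1}" "t' \<in> {0..1}"
  shows "\<bar>coord_line b x f t - coord_line b x f t'\<bar> \<le> L"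
proof (cases "nat \<lfloor>s\<rfloor> = 0")
  case True
  have "\<bar>coord_line b x f t - coord_line b x f t'\<bar> \<le> L * \<bar>t - t'\<bar> powr s"
    using line_top[OF x b t] True by simp
  also have "\<dots> \<le> L * 1 powr s"
    using L s t by (intro mult_left_mono powr_mono2) auto
  finally show ?thesis by simp
next
  case False
  let ?\<phi> = "\<lambda>k. coord_line b x (iter_partial (replicate k b) f)"
  have "norm (?\<phi> 0 t - ?\<phi> 0 t') \<le> L * norm (t - t')"
  proof (rule field_differentiable_bound[where S = "{0..1}"])
    fix \<tau> :: real assume \<tau>: "\<tau> \<in> {0..1}"
    show "(?\<phi> 0 has_real_derivative ?\<phi> (Suc 0) \<tau>) (at \<tau> within {0..1})"
      using False by (intro line_deriv[OF x b] \<tau>) auto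
    let ?y = "x + (\<tau> - x \<bullet> b) *\<^sub>R b"
    have "\<bar>iter_partial (replicate (Suc 0) b) f ?y\<bar> \<le> L2_set (\<lambda>bs. iter_partial bs f ?y) (multi_index (Suc 0))"
      by (rule abs_le_L2_set[OF finite_multi_index replicate_multi_index[OF b]])
    also have "\<dots> \<le> L"
    proof -
      have "Suc 0 \<in> {1..nat \<lfloor>s\<rfloor>}" unfolding atLeastAtMost_iff using False by linarith
      then show ?thesis using f line_in_cube[OF x b \<tau>] unfolding holder_class_def Let_def by blast
    qed
    finally show "norm (?\<phi> (Suc 0) \<tau>) \<le> L" by (simp add: coord_line_def)
  qed (use t in auto)
  also have "\<dots> \<le> L * 1" using t L by (intro mult_left_mono) auto
  finally show ?thesis by simp
qed

lemma holder_oscillation: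
  fixes x y :: 'a
  assumes x: "x \<in> unit_cube" and y: "y \<in> unit_cube"
  shows "\<bar>f x - f y\<bar> \<le> real DIM('a) * L"
proof -
  define h where "h S = of_coords (\<lambda>b. if b \<in> S then y \<bullet> b else x \<bullet> b)" for S :: "'a set"
  have "\<bar>f x - f (h S)\<bar> \<le> real (card S) * L" if "S \<subseteq> Basis" for S
    using finite_subset[OF that finite_Basis] that
  proof (induction S rule: finite_induct)
    case empty
    then show ?case by (simp add: h_def)
  next
    case (insert b S)
    then have b: "b \<in> Basis" by simp
    have h: "h S \<in> unit_cube" unfolding h_def of_coords_in_unit_cube using x y by (auto simp: mem_box)
    have c: "coord_line b (h S) f t = f (of_coords ((\<lambda>c. if c \<in> S then y \<bullet> c else x \<bullet> c)(b := t)))" for t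
      unfolding coord_line_def h_def of_coords_update[OF b] ..
    have "coord_line b (h S) f (x \<bullet> b) = f (h S)" unfolding c unfolding h_def
      using insert.hyps by (intro arg_cong[where f = f] of_coords_cong) auto
    moreover have "coord_line b (h S) f (y \<bullet> b) = f (h (insert b S))" unfolding c unfolding h_def
      by (intro arg_cong[where f = f] of_coords_cong) auto
    moreover have "\<bar>coord_line b (h S) f (x \<bullet> b) - coord_line b (h S) f (y \<bullet> b)\<bar> \<le> L"
      using x y b by (intro line_oscillation h b) (auto simp: mem_box)
    ultimately have "\<bar>f (h S) - f (h (insert b S))\<bar> \<le> L" by simp
    moreover have "\<bar>f x - f (h S)\<bar> \<le> real (card S) * L" using insert by simp
    ultimately have "\<bar>f x - f (h (insert b S))\<bar> \<le> real (card S) * L + L" by linarith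
    then show ?case using insert.hyps by (simp add: algebra_simps)
  qed
  from this[of Basis] show ?thesis by (simp add: h_def cong: of_coords_cong)
qed

end

section \<open>Bounded densities and their marginals\<close>

lemma unit_cube_measure:
  "(LINT x|lborel. indicator unit_cube (x::'a::euclidean_space) :: real) = 1"
  "integrable lborel (\<lambda>x::'a. indicator unit_cube x :: real)"
  by (simp add: measure_lborel_cbox_eq) (intro integrable_real_indicator, auto simp: emeasure_lborel_cbox_eq)

lemma joint_density_integrable:
  assumes "joint_density P f"
  shows "integrable lborel f" "(LINT x|lborel. f x) = 1"
proof -
  have f: "f \<in> borel_measurable borel" "\<And>x. 0 \<le> f x" and P: "prob_space P" "P = density lborel (\<lambda>x. ennreal (f x))"
    using assms by (auto simp: joint_density_def)
  have "emeasure P (space P) = 1" using P(1) by (rule prob_space.emeasure_space_1)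
  then have nn: "(\<integral>\<^sup>+x. ennreal (f x) \<partial>lborel) = 1"
    unfolding P(2) using f(1) by (simp add: emeasure_density)
  show "integrable lborel f" using f nn by (intro integrableI_nn_integral_finite[where x = 1]) auto
  show "(LINT x|lborel. f x) = 1" using f nn by (subst integral_eq_nn_integral) auto
qed

text \<open>Averaging f x - f x' over x' in the cube, which has volume 1, compares f x with the unit
  integral of f. This is the origin of the constant M.\<close>

lemma density_bounded:
  fixes f :: "'a::euclidean_space \<times> 'b::euclidean_space \<Rightarrow> real"
  assumes f: "joint_density P f" and "f \<in> holder_class s L" "0 < s" "0 < L"
  shows "f x \<le> 1 + real DIM('a \<times> 'b) * L"
proof (cases "x \<in> unit_cube")
  case False
  then have "f x = 0" using f unfolding joint_density_def by blast
  then show ?thesis using assms(4) by simp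
next
  case True
  let ?O = "real DIM('a \<times> 'b) * L"
  have out: "f x' = 0" if "x' \<notin> unit_cube" for x' using f that unfolding joint_density_def by blast
  have "f x = (LINT x'|lborel. f x * indicator unit_cube (x' :: 'a \<times> 'b))"
    by (simp only: Bochner_Integration.integral_mult_right_zero unit_cube_measure mult_1_right)
  also have "\<dots> \<le> (LINT x'|lborel. f x' + ?O * indicator unit_cube x')"
  proof (rule integral_mono)
    fix x'
    show "f x * indicator unit_cube x' \<le> f x' + ?O * indicator unit_cube x'"
      using holder_oscillation[OF assms(2-4) True, of x'] out[of x'] by (auto simp: indicator_def)
  qed (intro Bochner_Integration.integrable_add integrable_mult_right unit_cube_measure joint_density_integrable[OF f])+
  also have "\<dots> = 1 + ?O"
    by (subst Bochner_Integration.integral_add)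
       (auto simp only: joint_density_integrable[OF f] unit_cube_measure integrable_mult_right Bochner_Integration.integral_mult_right_zero mult_1_right)
  finally show ?thesis .
qed

lemma unit_cube_Pair: "(y, z) \<in> unit_cube \<longleftrightarrow> y \<in> unit_cube \<and> z \<in> unit_cube"
  by (simp add: mem_box) (auto simp: Basis_prod_def ball_Un)

lemma marginal_measurable:
  fixes f :: "'a::euclidean_space \<times> 'b::euclidean_space \<Rightarrow> real"
  assumes "f \<in> borel_measurable borel"
  shows "marginal_Y f \<in> borel_measurable borel" "marginal_Z f \<in> borel_measurable borel"
proof -
  have m2: "f \<in> borel_measurable (lborel \<Otimes>\<^sub>M lborel)" using assms by (simp add: lborel_prod)
  have "(\<lambda>y. LINT z|lborel. f (y, z)) \<in> borel_measurable lborel"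
    by (rule lborel.borel_measurable_lebesgue_integral) (use m2 in \<open>simp add: case_prod_unfold\<close>)
  then show "marginal_Y f \<in> borel_measurable borel" by (simp add: marginal_Y_def[abs_def])
  have "(\<lambda>z. LINT y|lborel. f (y, z)) \<in> borel_measurable lborel"
  proof (rule lborel.borel_measurable_lebesgue_integral)
    have "(\<lambda>p. (snd p, fst p)) \<in> (lborel :: 'b measure) \<Otimes>\<^sub>M (lborel :: 'a measure) \<rightarrow>\<^sub>M lborel \<Otimes>\<^sub>M lborel" by measurable
    from measurable_compose[OF this m2] show "(\<lambda>(z, y). f (y, z)) \<in> borel_measurable (lborel \<Otimes>\<^sub>M lborel)"
      by (simp add: case_prod_unfold)
  qed
  then show "marginal_Z f \<in> borel_measurable borel" by (simp add: marginal_Z_def[abs_def])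
qed

lemma marginal_bounds:
  fixes f :: "'a::euclidean_space \<times> 'b::euclidean_space \<Rightarrow> real"
  assumes f: "joint_density P f" and M: "\<And>x. f x \<le> M"
  shows "0 \<le> marginal_Y f y" "marginal_Y f y \<le> M" "y \<notin> unit_cube \<Longrightarrow> marginal_Y f y = 0"
    "0 \<le> marginal_Z f z" "marginal_Z f z \<le> M" "z \<notin> unit_cube \<Longrightarrow> marginal_Z f z = 0"
    "marginal_Y f \<in> borel_measurable borel" "marginal_Z f \<in> borel_measurable borel"
proof -
  have f0: "0 \<le> f x" and out: "x \<notin> unit_cube \<Longrightarrow> f x = 0" for x
    using f unfolding joint_density_def by blast+
  have meas: "f \<in> borel_measurable borel" using f unfolding joint_density_def by blast
  have M0: "0 \<le> M" using f0 M order_trans by blast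
  show "0 \<le> marginal_Y f y" "0 \<le> marginal_Z f z"
    unfolding marginal_Y_def marginal_Z_def by (rule Bochner_Integration.integral_nonneg, rule f0)+
  show "marginal_Y f y = 0" if "y \<notin> unit_cube"
    using that out by (simp add: marginal_Y_def unit_cube_Pair)
  show "marginal_Z f z = 0" if "z \<notin> unit_cube"
    using that out by (simp add: marginal_Z_def unit_cube_Pair)
  have "marginal_Y f y \<le> (LINT z|lborel. M * indicator unit_cube (z::'b))"
    unfolding marginal_Y_def
  proof (rule integral_mono')
    show "f (y, z) \<le> M * indicator unit_cube z" for z
      using M[of "(y, z)"] out[of "(y, z)"] by (cases "z \<in> unit_cube") (auto simp: unit_cube_Pair)
  qed (use M0 in \<open>auto intro!: integrable_mult_right unit_cube_measure(2)\<close>)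
  also have "\<dots> = M" by (simp only: Bochner_Integration.integral_mult_right_zero unit_cube_measure mult_1_right)
  finally show "marginal_Y f y \<le> M" .
  have "marginal_Z f z \<le> (LINT y|lborel. M * indicator unit_cube (y::'a))"
    unfolding marginal_Z_def
  proof (rule integral_mono')
    show "f (y, z) \<le> M * indicator unit_cube y" for y
      using M[of "(y, z)"] out[of "(y, z)"] by (cases "y \<in> unit_cube") (auto simp: unit_cube_Pair)
  qed (use M0 in \<open>auto intro!: integrable_mult_right unit_cube_measure(2)\<close>)
  also have "\<dots> = M" by (simp only: Bochner_Integration.integral_mult_right_zero unit_cube_measure mult_1_right)
  finally show "marginal_Z f z \<le> M" .
  show "marginal_Y f \<in> borel_measurable borel" "marginal_Z f \<in> borel_measurable borel"
    by (rule marginal_measurable[OF meas])+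
qed

lemma marginal_product_bounds:
  fixes f :: "'a::euclidean_space \<times> 'b::euclidean_space \<Rightarrow> real"
  assumes f: "joint_density P f" and M: "\<And>x. f x \<le> M"
  shows "0 \<le> marginal_product f x" "marginal_product f x \<le> M * M"
    "x \<notin> unit_cube \<Longrightarrow> marginal_product f x = 0"
proof -
  note mb = marginal_bounds[OF f M]
  have "0 \<le> M" using mb(1,2) order_trans by blast
  then show "0 \<le> marginal_product f x" "marginal_product f x \<le> M * M"
    unfolding marginal_product_def case_prod_unfold using mb by (auto intro!: mult_mono)
  show "x \<notin> unit_cube \<Longrightarrow> marginal_product f x = 0"
    using mb(3)[of "fst x"] mb(6)[of "snd x"] by (cases x) (auto simp: marginal_product_def unit_cube_Pair)
qed

lemma marginal_product_measurable:
  fixes f :: "'a::euclidean_space \<times> 'b::euclidean_space \<Rightarrow> real"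
  assumes "f \<in> borel_measurable borel"
  shows "marginal_product f \<in> borel_measurable borel"
proof -
  have "(\<lambda>x. marginal_Y f (fst x)) \<in> borel_measurable (borel :: ('a \<times> 'b) measure)"
    "(\<lambda>x. marginal_Z f (snd x)) \<in> borel_measurable (borel :: ('a \<times> 'b) measure)"
    by (rule measurable_compose[OF _ marginal_measurable(1)[OF assms]], simp add: borel_prod[symmetric])
       (rule measurable_compose[OF _ marginal_measurable(2)[OF assms]], simp add: borel_prod[symmetric])
  then show ?thesis unfolding marginal_product_def case_prod_unfold by simp
qed

text \<open>Both the density and the product of marginals are in the class, so their difference is
  locally polynomial with twice the error of one of them. Both constants depend only on s, L and the
  dimension.\<close>

lemma L2_dependence_le_cells:
  assumes "0 < s" "0 < L"
  shows "\<exists>C1>0. \<exists>C2>0. \<forall>\<kappa>\<ge>1. \<forall>P. \<forall>f :: 'a::euclidean_space \<times> 'b::euclidean_space \<Rightarrow> real.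
    joint_density P f \<longrightarrow> f \<in> holder_class s L \<longrightarrow> marginal_product f \<in> holder_class s L \<longrightarrow>
    (L2_norm (\<lambda>x. f x - marginal_product f x))\<^sup>2 \<le>
      C1 * real \<kappa> ^ DIM('a \<times> 'b) *
        (\<Sum>c\<in>cells \<kappa>. (LINT x|lborel. indicator (cell \<kappa> c) x * (f x - marginal_product f x))\<^sup>2)
      + C2 * real \<kappa> powr (- 2 * s)"
proof -
  define D where "D = DIM('a \<times> 'b)"
  define M where "M = 1 + real D * L"
  define K where "K = Suc (nat \<lfloor>s\<rfloor>)"
  obtain C where C: "1 \<le> C" "\<And>\<kappa>. K \<le> \<kappa> \<Longrightarrow> \<exists>R. reconstructs \<kappa> K C R"
    using reconstruction_kernel[of K] unfolding K_def by auto
  define C1 where "C1 = 2 * (2 * real K * C) ^ (2 * D)"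
  \<comment> \<open>The first summand pays for the reconstruction error. The second covers \<kappa>
    < K, where no block of K bins fits: then K / \<kappa> is at least 1, and the bound M^2 on the
    difference suffices.\<close>
  define C2 where "C2 = 2 * (real D * (C ^ D * ((1 + C) * (2 * L))))\<^sup>2 * real K powr (2 * s) + (M\<^sup>2)\<^sup>2 * real K powr (2 * s)"
  have M: "1 \<le> M" using assms by (simp add: M_def)
  have K: "1 \<le> real K" by (simp add: K_def)
  have C1: "0 < C1" using C(1) K by (simp add: C1_def)
  have C2: "0 < C2" using M K by (simp add: C2_def add_nonneg_pos)
  show ?thesis
  proof (rule exI[of _ C1], intro conjI C1, rule exI[of _ C2], intro conjI C2 allI impI)
    fix \<kappa> :: nat and P and f :: "'a \<times> 'b \<Rightarrow> real"
    assume \<kappa>: "1 \<le> \<kappa>" and f: "joint_density P f" "f \<in> holder_class s L" "marginal_product f \<in> holder_class s L"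
    define g where "g x = f x - marginal_product f x" for x
    have fM: "f x \<le> M" for x using density_bounded[OF f(1,2) assms] by (simp add: M_def D_def)
    note mp = marginal_product_bounds[OF f(1) fM]
    have f0: "0 \<le> f x" and out: "x \<notin> unit_cube \<Longrightarrow> f x = 0" for x
      using f(1) unfolding joint_density_def by blast+
    have meas: "f \<in> borel_measurable borel" using f(1) unfolding joint_density_def by blast
    have "f x \<le> M * M" for x using fM[of x] M mult_right_mono[of 1 M M] by linarith
    then have gB: "\<bar>g x\<bar> \<le> M\<^sup>2" for x
      using f0[of x] mp(1,2)[of x] unfolding g_def power2_eq_square abs_le_iff by (smt (verit))
    have g_out: "g x = 0" if "x \<notin> unit_cube" for x
      using out[OF that] mp(3)[OF that] by (simp add: g_def)
    have g_meas: "g \<in> borel_measurable borel"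
      unfolding g_def[abs_def] using meas marginal_product_measurable[OF meas] by simp
    have cube_int: "integrable lborel (\<lambda>x::'a \<times> 'b. c * indicator unit_cube x :: real)" for c
      by (intro integrable_mult_right unit_cube_measure)
    have L2: "(L2_norm g)\<^sup>2 = (LINT x|lborel. indicator unit_cube x * (g x)\<^sup>2)"
    proof -
      have "(g x)\<^sup>2 = indicator unit_cube x * (g x)\<^sup>2" for x using g_out[of x] by (auto simp: indicator_def)
      then have "(LINT x|lborel. (g x)\<^sup>2) = (LINT x|lborel. indicator unit_cube x * (g x)\<^sup>2)" by (rule Bochner_Integration.integral_cong[OF refl])
      then show ?thesis unfolding L2_norm_def by (subst real_sqrt_pow2) (auto intro!: Bochner_Integration.integral_nonneg)
    qed
    have \<kappa>K: "(real K / real \<kappa>) powr (2 * s) = real K powr (2 * s) * real \<kappa> powr (- 2 * s)"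
      using \<kappa> K by (simp add: powr_divide powr_minus_divide)
    let ?S = "\<Sum>c\<in>cells \<kappa>. (LINT x|lborel. indicator (cell \<kappa> c) x * g x)\<^sup>2"
    have S0: "0 \<le> ?S" by (intro sum_nonneg) simp
    have "(L2_norm g)\<^sup>2 \<le> C1 * real \<kappa> ^ D * ?S + C2 * real \<kappa> powr (- 2 * s)"
    proof (cases "K \<le> \<kappa>")
      case False
      have "(L2_norm g)\<^sup>2 \<le> (LINT x|lborel. (M\<^sup>2)\<^sup>2 * indicator unit_cube (x :: 'a \<times> 'b))"
        unfolding L2
      proof (rule integral_mono'[OF cube_int])
        fix x :: "'a \<times> 'b"
        have "(g x)\<^sup>2 \<le> (M\<^sup>2)\<^sup>2" using power_mono[OF gB[of x] abs_ge_zero, of 2] by (simp only: power2_abs)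
        then show "indicator unit_cube x * (g x)\<^sup>2 \<le> (M\<^sup>2)\<^sup>2 * indicator unit_cube x" by (auto simp: indicator_def)
      qed simp
      also have "\<dots> = (M\<^sup>2)\<^sup>2" by (simp only: Bochner_Integration.integral_mult_right_zero unit_cube_measure mult_1_right)
      also have "\<dots> \<le> (M\<^sup>2)\<^sup>2 * (real K / real \<kappa>) powr (2 * s)"
      proof -
        have "1 \<le> (real K / real \<kappa>) powr (2 * s)"
          using False \<kappa> assms by (intro ge_one_powr_ge_zero) (auto simp: le_divide_eq)
        from mult_left_mono[OF this, of "(M\<^sup>2)\<^sup>2"] show ?thesis by simp
      qed
      also have "\<dots> \<le> C2 * real \<kappa> powr (- 2 * s)"
        unfolding \<kappa>K C2_def by (simp add: algebra_simps)
      finally show ?thesis using S0 C1 by (simp add: add_increasing)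
    next
      case True
      then obtain R where R: "reconstructs \<kappa> K C R" using C(2) by blast
      define E where "E = 2 * (L * (real K / real \<kappa>) powr s)"
      have lp: "locally_polynomial \<kappa> K E (coord_line b x g)" if xb: "x \<in> unit_cube" "b \<in> Basis" for x b
        unfolding locally_polynomial_def
      proof (intro allI impI)
        fix a assume a: "0 \<le> a" "a + real K / real \<kappa> \<le> 1"
        let ?I = "{a..a + real K / real \<kappa>}" and ?e = "L * (real K / real \<kappa>) powr s"
        obtain q1 where q1: "degree q1 < K" "\<And>\<tau>. \<tau> \<in> ?I \<Longrightarrow> \<bar>coord_line b x f \<tau> - poly q1 \<tau>\<bar> \<le> ?e"
          using holder_locally_polynomial[OF f(2) assms xb \<kappa>] a unfolding locally_polynomial_def K_def[symmetric] by blast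
        obtain q2 where q2: "degree q2 < K" "\<And>\<tau>. \<tau> \<in> ?I \<Longrightarrow> \<bar>coord_line b x (marginal_product f) \<tau> - poly q2 \<tau>\<bar> \<le> ?e"
          using holder_locally_polynomial[OF f(3) assms xb \<kappa>] a unfolding locally_polynomial_def K_def[symmetric] by blast
        show "\<exists>q. degree q < K \<and> (\<forall>\<tau>\<in>?I. \<bar>coord_line b x g \<tau> - poly q \<tau>\<bar> \<le> E)"
        proof (intro exI[of _ "q1 - q2"] conjI ballI)
          show "degree (q1 - q2) < K" using q1(1) q2(1) by (rule degree_diff_less)
          fix \<tau> assume \<tau>: "\<tau> \<in> ?I"
          have "coord_line b x g \<tau> = coord_line b x f \<tau> - coord_line b x (marginal_product f) \<tau>"
            by (simp add: coord_line_def g_def)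
          then show "\<bar>coord_line b x g \<tau> - poly (q1 - q2) \<tau>\<bar> \<le> E"
            using q1(2)[OF \<tau>] q2(2)[OF \<tau>] unfolding E_def by simp
        qed
      qed
      have "0 \<le> E" using assms by (simp add: E_def)
      have "(L2_norm g)\<^sup>2 \<le> C1 * real \<kappa> ^ D * ?S + 2 * (real D * (C ^ D * ((1 + C) * E)))\<^sup>2"
        using L2_le_cell_integrals[OF _ True R C(1) \<open>0 \<le> E\<close> g_meas gB lp] K
        unfolding L2 C1_def D_def by simp
      also have "2 * (real D * (C ^ D * ((1 + C) * E)))\<^sup>2 \<le> C2 * real \<kappa> powr (- 2 * s)"
      proof -
        have "((real K / real \<kappa>) powr s)\<^sup>2 = (real K / real \<kappa>) powr (2 * s)"
          by (simp add: power2_eq_square powr_add[symmetric])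
        then have "2 * (real D * (C ^ D * ((1 + C) * E)))\<^sup>2 =
          2 * (real D * (C ^ D * ((1 + C) * (2 * L))))\<^sup>2 * (real K / real \<kappa>) powr (2 * s)"
          by (simp add: E_def power_mult_distrib)
        also have "\<dots> \<le> C2 * real \<kappa> powr (- 2 * s)"
          unfolding \<kappa>K C2_def by (simp add: algebra_simps)
        finally show ?thesis .
      qed
      finally show ?thesis by simp
    qed
    then show "(L2_norm (\<lambda>x. f x - marginal_product f x))\<^sup>2 \<le>
      C1 * real \<kappa> ^ DIM('a \<times> 'b) *
        (\<Sum>c\<in>cells \<kappa>. (LINT x|lborel. indicator (cell \<kappa> c) x * (f x - marginal_product f x))\<^sup>2)
      + C2 * real \<kappa> powr (- 2 * s)"
      by (simp only: g_def[abs_def] D_def)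
  qed
qed

subsection \<open>Reduction to bin labels\<close>

definition bin_label :: "nat \<Rightarrow> (real ^ 'd1) \<times> (real ^ 'd2) \<Rightarrow> ('d1 \<Rightarrow> int) \<times> ('d2 \<Rightarrow> int)" where
  "bin_label \<kappa> x = (bin_index \<kappa> (fst x), bin_index \<kappa> (snd x))"

lemma h_in_label: "h_in \<kappa> x1 x2 x3 x4 =
    label_kernel (bin_label \<kappa> x1) (bin_label \<kappa> x2) (bin_label \<kappa> x3) (bin_label \<kappa> x4)"
  by (simp add: h_in_def label_kernel_def contrast_def same_bin_def bin_label_def of_bool_def)

lemma U_stat_label: "U_stat \<kappa> n X = label_U n (\<lambda>i. bin_label \<kappa> (X i))"
  by (simp add: U_stat_def label_U_def h_in_label)

lemma U_perm_label: "U_perm \<kappa> n X \<pi> = label_U_perm n (\<lambda>i. bin_label \<kappa> (X i)) \<pi>"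
  by (simp add: U_perm_def label_U_perm_def U_stat_label bin_label_def)

lemma crit_value_label: "crit_value \<kappa> n \<alpha> X = label_crit n \<alpha> (\<lambda>i. bin_label \<kappa> (X i))"
  by (simp add: crit_value_def label_crit_def U_perm_label)

text \<open>The event is covered by the boxes of its label vectors and by the null sets of samples
  with a label outside \<open>S\<close>. An upper bound is all that the theorem asks for, and
  \<open>emeasure_mono\<close> requires measurability of the cover only, so measurability of the
  event itself does not have to be established.\<close>

lemma emeasure_label_event_le:
  fixes lab :: "'a \<Rightarrow> 'x" and J :: "'i set"
  assumes "prob_space P" and S: "finite S" and J: "finite J"
    and meas: "\<And>c. {x \<in> space P. lab x = c} \<in> sets P"
    and null: "emeasure P {x \<in> space P. lab x \<notin> S} = 0"
    and \<Phi>: "\<And>X X'. (\<And>i. i \<in> J \<Longrightarrow> X i = X' i) \<Longrightarrow> \<Phi> X \<longleftrightarrow> \<Phi> X'"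
  shows "emeasure (PiM J (\<lambda>_. P)) {X \<in> space (PiM J (\<lambda>_. P)). \<Phi> (\<lambda>i. lab (X i))}
    \<le> ennreal (sample_mean S (\<lambda>c. measure P {x \<in> space P. lab x = c}) J (\<lambda>\<omega>. of_bool (\<Phi> \<omega>)))"
proof -
  interpret P: prob_space P by fact
  interpret product_sigma_finite "\<lambda>_::'i. P" by standard
  let ?B = "\<lambda>c. {x \<in> space P. lab x = c}"
  define w where "w c = measure P (?B c)" for c
  define Z where "Z = {x \<in> space P. lab x \<notin> S}"
  have Z: "Z \<in> sets P"
  proof -
    have "Z = space P - (\<Union>c\<in>S. ?B c)" by (auto simp: Z_def)
    then show ?thesis using S meas by auto
  qed
  define \<Omega> where "\<Omega> = {\<omega> \<in> PiE J (\<lambda>_. S). \<Phi> \<omega>}"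
  have fin\<Omega>: "finite \<Omega>" unfolding \<Omega>_def using S J by (simp add: finite_PiE)
  let ?box = "\<lambda>\<omega>. PiE J (\<lambda>i. ?B (\<omega> i))" and ?bad = "\<lambda>i. PiE J (\<lambda>k. if k = i then Z else space P)"
  have boxm: "?box \<omega> \<in> sets (PiM J (\<lambda>_. P))" for \<omega> using J meas by (intro sets_PiM_I_finite) auto
  have badm: "?bad i \<in> sets (PiM J (\<lambda>_. P))" for i using J Z by (intro sets_PiM_I_finite) auto
  have bad0: "emeasure (PiM J (\<lambda>_. P)) (?bad i) = 0" if "i \<in> J" for i
  proof -
    have "emeasure (PiM J (\<lambda>_. P)) (?bad i) = (\<Prod>k\<in>J. emeasure P (if k = i then Z else space P))"
      using J Z by (intro emeasure_PiM) auto
    also have "\<dots> = 0" using J that null by (intro prod_zero) (auto simp: Z_def)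
    finally show ?thesis .
  qed
  have unions: "(\<Union>\<omega>\<in>\<Omega>. ?box \<omega>) \<in> sets (PiM J (\<lambda>_. P))" "(\<Union>i\<in>J. ?bad i) \<in> sets (PiM J (\<lambda>_. P))"
    by (intro sets.finite_UN boxm badm fin\<Omega> J)+
  have sub: "{X \<in> space (PiM J (\<lambda>_. P)). \<Phi> (\<lambda>i. lab (X i))} \<subseteq> (\<Union>\<omega>\<in>\<Omega>. ?box \<omega>) \<union> (\<Union>i\<in>J. ?bad i)"
  proof
    fix X assume X: "X \<in> {X \<in> space (PiM J (\<lambda>_. P)). \<Phi> (\<lambda>i. lab (X i))}"
    then have XP: "X \<in> PiE J (\<lambda>_. space P)" by (simp add: space_PiM)
    show "X \<in> (\<Union>\<omega>\<in>\<Omega>. ?box \<omega>) \<union> (\<Union>i\<in>J. ?bad i)"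
    proof (cases "\<forall>i\<in>J. lab (X i) \<in> S")
      case True
      let ?\<omega> = "restrict (\<lambda>i. lab (X i)) J"
      have "\<Phi> ?\<omega> \<longleftrightarrow> \<Phi> (\<lambda>i. lab (X i))" by (rule \<Phi>) simp
      then have "?\<omega> \<in> \<Omega>" using X True by (simp add: \<Omega>_def restrict_PiE_iff)
      moreover have "X \<in> ?box ?\<omega>" using XP by (auto simp: PiE_iff)
      ultimately show ?thesis by blast
    next
      case False
      then obtain i where "i \<in> J" "lab (X i) \<notin> S" by blast
      then have "X \<in> ?bad i" using XP by (auto simp: PiE_iff Z_def)
      then show ?thesis using \<open>i \<in> J\<close> by blast
    qed
  qed
  have "emeasure (PiM J (\<lambda>_. P)) {X \<in> space (PiM J (\<lambda>_. P)). \<Phi> (\<lambda>i. lab (X i))} \<le>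
    emeasure (PiM J (\<lambda>_. P)) ((\<Union>\<omega>\<in>\<Omega>. ?box \<omega>) \<union> (\<Union>i\<in>J. ?bad i))"
    by (rule emeasure_mono[OF sub]) (intro sets.Un unions)
  also have "\<dots> \<le> emeasure (PiM J (\<lambda>_. P)) (\<Union>\<omega>\<in>\<Omega>. ?box \<omega>) + emeasure (PiM J (\<lambda>_. P)) (\<Union>i\<in>J. ?bad i)"
    by (rule emeasure_subadditive) (intro unions)+
  also have "\<dots> \<le> (\<Sum>\<omega>\<in>\<Omega>. emeasure (PiM J (\<lambda>_. P)) (?box \<omega>)) + (\<Sum>i\<in>J. emeasure (PiM J (\<lambda>_. P)) (?bad i))"
    by (intro add_mono emeasure_subadditive_finite) (use boxm badm fin\<Omega> J in auto)
  also have "(\<Sum>i\<in>J. emeasure (PiM J (\<lambda>_. P)) (?bad i)) = 0" using bad0 by simp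
  also have "(\<Sum>\<omega>\<in>\<Omega>. emeasure (PiM J (\<lambda>_. P)) (?box \<omega>)) = (\<Sum>\<omega>\<in>\<Omega>. ennreal (\<Prod>i\<in>J. w (\<omega> i)))"
  proof (rule sum.cong[OF refl])
    fix \<omega>
    have "emeasure (PiM J (\<lambda>_. P)) (?box \<omega>) = (\<Prod>i\<in>J. emeasure P (?B (\<omega> i)))"
      using J meas by (intro emeasure_PiM) auto
    then show "emeasure (PiM J (\<lambda>_. P)) (?box \<omega>) = ennreal (\<Prod>i\<in>J. w (\<omega> i))"
      by (simp add: P.emeasure_eq_measure prod_ennreal w_def)
  qed
  also have "\<dots> = ennreal (\<Sum>\<omega>\<in>\<Omega>. \<Prod>i\<in>J. w (\<omega> i))"
    by (rule sum_ennreal) (auto intro!: prod_nonneg simp: w_def)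
  also have "(\<Sum>\<omega>\<in>\<Omega>. \<Prod>i\<in>J. w (\<omega> i)) = sample_mean S w J (\<lambda>\<omega>. of_bool (\<Phi> \<omega>))"
    unfolding sample_mean_def \<Omega>_def by (rule sum.mono_neutral_cong_left) (auto simp: finite_PiE S J)
  finally show ?thesis by (simp add: w_def[abs_def])
qed

definition labels :: "nat \<Rightarrow> ('d::finite \<Rightarrow> int) set" where
  "labels \<kappa> = PiE UNIV (\<lambda>_. {0..<int \<kappa>})"

lemma finite_labels [simp]: "finite (labels \<kappa> :: ('d::finite \<Rightarrow> int) set)"
  unfolding labels_def by (intro finite_PiE) auto

lemma card_labels: "card (labels \<kappa> :: ('d::finite \<Rightarrow> int) set) = \<kappa> ^ CARD('d)"
  unfolding labels_def by (subst card_PiE) auto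

lemma bin_index_coord: "bin_index \<kappa> y i = coord_bin \<kappa> (y $ i)"
  by (simp add: bin_index_def coord_bin_def)

lemma vec_unit_cube: "y \<in> (unit_cube :: (real ^ 'd) set) \<longleftrightarrow> (\<forall>i. y $ i \<in> {0..1})"
  by (simp add: mem_box) (auto simp: Basis_vec_def inner_axis)

lemma bin_index_labels:
  "1 \<le> \<kappa> \<Longrightarrow> y \<in> unit_cube \<Longrightarrow> bin_index \<kappa> y \<in> labels \<kappa>"
  unfolding labels_def using coord_bin_range[of \<kappa>] by (auto simp: PiE_iff bin_index_coord vec_unit_cube)

lemma bin_index_measurable: "{y \<in> unit_cube. bin_index \<kappa> y = k} \<in> sets (borel :: (real ^ 'd) measure)"
proof -
  have "{y \<in> unit_cube. bin_index \<kappa> y = k} =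
    unit_cube \<inter> (\<Inter>i\<in>UNIV. (\<lambda>y. coord_bin \<kappa> (y \<bullet> axis i 1)) -` {k i} \<inter> space borel)"
    by (auto simp: fun_eq_iff bin_index_coord inner_axis)
  also have "\<dots> \<in> sets borel"
    by (intro sets.Int sets.finite_INT measurable_sets[OF coord_bin_measurable_inner]) auto
  finally show ?thesis .
qed

lemma bin_label_set: "{x \<in> unit_cube. bin_label \<kappa> x = (k, l)} =
  {y \<in> unit_cube. bin_index \<kappa> y = k} \<times> {z \<in> unit_cube. bin_index \<kappa> z = l}"
  by (auto simp: bin_label_def unit_cube_Pair)

lemma bin_label_measurable: "{x \<in> unit_cube. bin_label \<kappa> x = c} \<in> sets borel"
proof (cases c)
  case (Pair k l)
  show ?thesis unfolding Pair bin_label_set borel_prod[symmetric]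
    by (intro pair_measureI bin_index_measurable)
qed

lemma bin_index_all_measurable: "{y. bin_index \<kappa> y = k} \<in> sets (borel :: (real ^ 'd) measure)"
proof -
  have "{y. bin_index \<kappa> y = k} = (\<Inter>i\<in>UNIV. (\<lambda>y. coord_bin \<kappa> (y \<bullet> axis i 1)) -` {k i} \<inter> space borel)"
    by (auto simp: fun_eq_iff bin_index_coord inner_axis)
  also have "\<dots> \<in> sets borel"
    by (intro sets.finite_INT measurable_sets[OF coord_bin_measurable_inner]) auto
  finally show ?thesis .
qed

lemma bin_label_all_measurable: "{x. bin_label \<kappa> x = c} \<in> sets borel"
proof -
  have "{x. bin_label \<kappa> x = c} = {y. bin_index \<kappa> y = fst c} \<times> {z. bin_index \<kappa> z = snd c}"
    by (auto simp: bin_label_def)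
  then show ?thesis unfolding borel_prod[symmetric] by (simp add: pair_measureI bin_index_all_measurable)
qed

lemma bin_label_cell_volume:
  fixes c :: "('d1::finite \<Rightarrow> int) \<times> ('d2::finite \<Rightarrow> int)"
  assumes "1 \<le> \<kappa>"
  shows "(LINT x|lborel. indicator {x \<in> unit_cube. bin_label \<kappa> x = c} x :: real)
     \<le> 1 / real \<kappa> ^ (CARD('d1) + CARD('d2))"
    and "integrable lborel (\<lambda>x. indicator {x \<in> unit_cube. bin_label \<kappa> x = c} x :: real)"
proof -
  let ?l = "(\<chi> i. real_of_int (fst c i) / real \<kappa>, \<chi> i. real_of_int (snd c i) / real \<kappa>) :: (real ^ 'd1) \<times> (real ^ 'd2)"
    and ?h = "(\<chi> i. (real_of_int (fst c i) + 1) / real \<kappa>, \<chi> i. (real_of_int (snd c i) + 1) / real \<kappa>) :: (real ^ 'd1) \<times> (real ^ 'd2)"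
  have coord: "real_of_int (k i) / real \<kappa> \<le> y $ i \<and> y $ i \<le> (real_of_int (k i) + 1) / real \<kappa>"
    if "y \<in> unit_cube" "bin_index \<kappa> y = k" for y :: "real ^ 'd" and k :: "'d::finite \<Rightarrow> int" and i
  proof -
    have "y $ i \<in> bin_set \<kappa> (k i)" using that by (auto simp: bin_set_def vec_unit_cube bin_index_coord)
    then show ?thesis using bin_set_subset[OF assms, of "k i"] by auto
  qed
  have sub: "{x \<in> unit_cube. bin_label \<kappa> x = c} \<subseteq> cbox ?l ?h"
  proof
    fix x :: "(real ^ 'd1) \<times> (real ^ 'd2)"
    assume "x \<in> {x \<in> unit_cube. bin_label \<kappa> x = c}"
    then obtain y z where x: "x = (y, z)" "y \<in> unit_cube" "z \<in> unit_cube" "bin_index \<kappa> y = fst c" "bin_index \<kappa> z = snd c"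
      by (cases x) (auto simp: unit_cube_Pair bin_label_def)
    then show "x \<in> cbox ?l ?h"
      using coord[OF x(2,4)] coord[OF x(3,5)]
      unfolding x(1) cbox_Pair_iff by (auto simp: mem_box Basis_vec_def inner_axis)
  qed
  have le: "?l \<bullet> b \<le> ?h \<bullet> b" "(?h - ?l) \<bullet> b = 1 / real \<kappa>" if "b \<in> Basis" for b
    using that by (auto simp: Basis_prod_def Basis_vec_def inner_axis divide_right_mono diff_divide_distrib[symmetric])
  have "emeasure lborel {x \<in> unit_cube. bin_label \<kappa> x = c} \<le> emeasure lborel (cbox ?l ?h)"
    by (rule emeasure_mono[OF sub]) simp
  then show "integrable lborel (\<lambda>x. indicator {x \<in> unit_cube. bin_label \<kappa> x = c} x :: real)"
    by (intro integrable_real_indicator) (auto simp: bin_label_measurable emeasure_lborel_cbox_eq intro: le_less_trans)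
  have "measure lborel {x \<in> unit_cube. bin_label \<kappa> x = c} \<le> measure lborel (cbox ?l ?h)"
    by (rule measure_mono_fmeasurable[OF sub]) (auto simp: bin_label_measurable fmeasurable_def emeasure_lborel_cbox_eq)
  also have "\<dots> = (\<Prod>b\<in>(Basis :: ((real ^ 'd1) \<times> (real ^ 'd2)) set). (?h - ?l) \<bullet> b)"
    by (rule measure_lborel_cbox) (rule le)
  also have "\<dots> = (\<Prod>b\<in>(Basis :: ((real ^ 'd1) \<times> (real ^ 'd2)) set). 1 / real \<kappa>)"
    by (intro prod.cong refl le)
  also have "\<dots> = 1 / real \<kappa> ^ (CARD('d1) + CARD('d2))" by (simp add: power_one_over)
  finally show "(LINT x|lborel. indicator {x \<in> unit_cube. bin_label \<kappa> x = c} x :: real)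
     \<le> 1 / real \<kappa> ^ (CARD('d1) + CARD('d2))" using bin_label_measurable[of \<kappa> c] by simp
qed

section \<open>The table of bin probabilities of a bounded density\<close>

context
  fixes f :: "(real ^ 'd1::finite) \<times> (real ^ 'd2::finite) \<Rightarrow> real" and P :: "((real ^ 'd1) \<times> (real ^ 'd2)) measure"
    and M :: real and \<kappa> :: nat
  assumes f: "joint_density P f" and fM: "\<And>x. f x \<le> M" and M1: "1 \<le> M" and \<kappa>: "1 \<le> \<kappa>"
begin

lemma P_prob: "prob_space P" and f_meas: "f \<in> borel_measurable borel" and f_nonneg: "0 \<le> f x"
  and f_out: "x \<notin> unit_cube \<Longrightarrow> f x = 0" and P_density: "P = density lborel (\<lambda>x. ennreal (f x))"
  using f unfolding joint_density_def by blast+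

lemma P_space: "space P = UNIV" and P_sets: "sets P = sets borel"
  unfolding P_density by auto

lemma bounded_integrable:
  fixes g :: "'e::euclidean_space \<Rightarrow> real"
  assumes "g \<in> borel_measurable borel" "\<And>x. \<bar>g x\<bar> \<le> B" "\<And>x. x \<notin> unit_cube \<Longrightarrow> g x = 0" "A \<in> sets borel"
  shows "integrable lborel (\<lambda>x. indicator A x * g x)"
proof (rule Bochner_Integration.integrable_bound[where f = "\<lambda>x::'e. B * indicator unit_cube x"])
  show "integrable lborel (\<lambda>x::'e. B * indicator unit_cube x)" by (intro integrable_mult_right unit_cube_measure(2))
  show "AE x in lborel. norm (indicator A x * g x) \<le> norm (B * indicator unit_cube x)"
  proof (rule AE_I2)
    fix x show "norm (indicator A x * g x) \<le> norm (B * indicator unit_cube x)"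
      using assms(2)[of x] assms(3)[of x] by (cases "x \<in> unit_cube") (auto simp: indicator_def)
  qed
qed (use assms in measurable)

definition weight :: "('d1 \<Rightarrow> int) \<times> ('d2 \<Rightarrow> int) \<Rightarrow> real" where
  "weight c = measure P {x \<in> space P. bin_label \<kappa> x = c}"

lemma measure_P: "A \<in> sets borel \<Longrightarrow> measure P A = (LINT x|lborel. indicator A x * f x)"
proof -
  assume A: "A \<in> sets borel"
  have "measure P A = (LINT x|P. indicator A x)" using A by (simp add: P_sets P_space)
  also have "\<dots> = (LINT x|lborel. f x *\<^sub>R indicator A x)"
    unfolding P_density using A f_meas f_nonneg by (intro integral_density) auto
  finally show ?thesis by (simp add: mult.commute)
qed

lemma weight_integral: "weight c = (LINT x|lborel. indicator {x \<in> unit_cube. bin_label \<kappa> x = c} x * f x)"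
proof -
  have "weight c = (LINT x|lborel. indicator {x. bin_label \<kappa> x = c} x * f x)"
    unfolding weight_def P_space by (subst measure_P) (auto simp: bin_label_all_measurable)
  also have "\<dots> = (LINT x|lborel. indicator {x \<in> unit_cube. bin_label \<kappa> x = c} x * f x)"
    by (intro Bochner_Integration.integral_cong refl) (use f_out in \<open>auto simp: indicator_def\<close>)
  finally show ?thesis .
qed

definition Y_bin :: "('d1 \<Rightarrow> int) \<Rightarrow> real" where
  "Y_bin k = (LINT y|lborel. indicator {y \<in> unit_cube. bin_index \<kappa> y = k} y * marginal_Y f y)"

definition Z_bin :: "('d2 \<Rightarrow> int) \<Rightarrow> real" where
  "Z_bin l = (LINT z|lborel. indicator {z \<in> unit_cube. bin_index \<kappa> z = l} z * marginal_Z f z)"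

lemma f_abs: "\<bar>f x\<bar> \<le> M" using f_nonneg fM by simp

lemma indicator_labels: "1 \<le> \<kappa> \<Longrightarrow> (\<Sum>k\<in>labels \<kappa>. indicator {y \<in> unit_cube. bin_index \<kappa> y = k} y) = (indicator unit_cube y :: real)"
  for y :: "real ^ 'd"
proof -
  have "(\<Sum>k\<in>labels \<kappa>. indicator {y \<in> unit_cube. bin_index \<kappa> y = k} y) =
    (\<Sum>k\<in>labels \<kappa>. if k = bin_index \<kappa> y then indicator unit_cube y else (0::real))"
    by (intro sum.cong) (auto simp: indicator_def)
  then show "1 \<le> \<kappa> \<Longrightarrow> ?thesis" using bin_index_labels[of \<kappa> y] by (auto simp: indicator_def)
qed

text \<open>Summing over the bins of one component covers the whole unit cube of that component,
  outside which f vanishes; Fubini then leaves the bin integral of the other marginal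
  density.\<close>

lemma Fubini_bins:
  shows "(\<Sum>l\<in>labels \<kappa>. weight (k, l)) = Y_bin k" and "(\<Sum>k\<in>labels \<kappa>. weight (k, l)) = Z_bin l"
proof -
  have int: "integrable lborel (\<lambda>x. indicator {x \<in> unit_cube. bin_label \<kappa> x = c} x * f x)" for c
    by (rule bounded_integrable[OF f_meas f_abs f_out bin_label_measurable])
  have split: "indicator {x \<in> unit_cube. bin_label \<kappa> x = (k, l)} x =
    (indicator {y \<in> unit_cube. bin_index \<kappa> y = k} (fst x) * indicator {z \<in> unit_cube. bin_index \<kappa> z = l} (snd x) :: real)" for x k l
    unfolding bin_label_set by (cases x) (simp add: indicator_times)
  have "(\<Sum>l\<in>labels \<kappa>. weight (k, l)) = (LINT x|lborel. (\<Sum>l\<in>labels \<kappa>. indicator {x \<in> unit_cube. bin_label \<kappa> x = (k, l)} x * f x))"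
    unfolding weight_integral using int by (subst Bochner_Integration.integral_sum) auto
  also have "\<dots> = (LINT x|lborel. indicator ({y \<in> unit_cube. bin_index \<kappa> y = k} \<times> UNIV) x * f x)"
  proof (rule Bochner_Integration.integral_cong[OF refl])
    fix x :: "(real ^ 'd1) \<times> (real ^ 'd2)"
    have "(\<Sum>l\<in>labels \<kappa>. indicator {x \<in> unit_cube. bin_label \<kappa> x = (k, l)} x * f x) =
      indicator {y \<in> unit_cube. bin_index \<kappa> y = k} (fst x) * indicator unit_cube (snd x) * f x"
      unfolding split sum_distrib_right[symmetric] sum_distrib_left[symmetric] indicator_labels[OF \<kappa>] ..
    also have "\<dots> = indicator ({y \<in> unit_cube. bin_index \<kappa> y = k} \<times> UNIV) x * f x"
      using f_out[of x] by (cases x) (auto simp: indicator_def unit_cube_Pair)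
    finally show "(\<Sum>l\<in>labels \<kappa>. indicator {x \<in> unit_cube. bin_label \<kappa> x = (k, l)} x * f x) =
      indicator ({y \<in> unit_cube. bin_index \<kappa> y = k} \<times> UNIV) x * f x" .
  qed
  also have "\<dots> = (LINT y|lborel. LINT z|lborel. indicator ({y \<in> unit_cube. bin_index \<kappa> y = k} \<times> UNIV) (y, z) * f (y, z))"
  proof -
    have "{y \<in> unit_cube. bin_index \<kappa> y = k} \<times> UNIV \<in> sets (borel :: ((real ^ 'd1) \<times> (real ^ 'd2)) measure)"
      unfolding borel_prod[symmetric] by (intro pair_measureI bin_index_measurable) auto
    from bounded_integrable[OF f_meas f_abs f_out this] show ?thesis
      unfolding lborel_prod[symmetric] by (rule lborel_pair.integral_fst'[symmetric])
  qed
  also have "\<dots> = Y_bin k" unfolding Y_bin_def marginal_Y_def by (simp add: indicator_times)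
  finally show "(\<Sum>l\<in>labels \<kappa>. weight (k, l)) = Y_bin k" .
  have "(\<Sum>k\<in>labels \<kappa>. weight (k, l)) = (LINT x|lborel. (\<Sum>k\<in>labels \<kappa>. indicator {x \<in> unit_cube. bin_label \<kappa> x = (k, l)} x * f x))"
    unfolding weight_integral using int by (subst Bochner_Integration.integral_sum) auto
  also have "\<dots> = (LINT x|lborel. indicator (UNIV \<times> {z \<in> unit_cube. bin_index \<kappa> z = l}) x * f x)"
  proof (rule Bochner_Integration.integral_cong[OF refl])
    fix x :: "(real ^ 'd1) \<times> (real ^ 'd2)"
    have "(\<Sum>k\<in>labels \<kappa>. indicator {x \<in> unit_cube. bin_label \<kappa> x = (k, l)} x * f x) =
      indicator unit_cube (fst x) * indicator {z \<in> unit_cube. bin_index \<kappa> z = l} (snd x) * f x"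
      unfolding split sum_distrib_right[symmetric] indicator_labels[OF \<kappa>] ..
    also have "\<dots> = indicator (UNIV \<times> {z \<in> unit_cube. bin_index \<kappa> z = l}) x * f x"
      using f_out[of x] by (cases x) (auto simp: indicator_def unit_cube_Pair)
    finally show "(\<Sum>k\<in>labels \<kappa>. indicator {x \<in> unit_cube. bin_label \<kappa> x = (k, l)} x * f x) =
      indicator (UNIV \<times> {z \<in> unit_cube. bin_index \<kappa> z = l}) x * f x" .
  qed
  also have "\<dots> = (LINT z|lborel. LINT y|lborel. indicator (UNIV \<times> {z \<in> unit_cube. bin_index \<kappa> z = l}) (y, z) * f (y, z))"
  proof -
    have "UNIV \<times> {z \<in> unit_cube. bin_index \<kappa> z = l} \<in> sets (borel :: ((real ^ 'd1) \<times> (real ^ 'd2)) measure)"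
      unfolding borel_prod[symmetric] by (intro pair_measureI bin_index_measurable) auto
    from bounded_integrable[OF f_meas f_abs f_out this] show ?thesis
      unfolding lborel_prod[symmetric]
      by (intro lborel_pair.integral_snd[symmetric, where f = "\<lambda>y z. indicator (UNIV \<times> {z \<in> unit_cube. bin_index \<kappa> z = l}) (y, z) * f (y, z)", simplified case_prod_unfold prod.collapse])
  qed
  also have "\<dots> = Z_bin l" unfolding Z_bin_def marginal_Z_def by (simp add: indicator_times)
  finally show "(\<Sum>k\<in>labels \<kappa>. weight (k, l)) = Z_bin l" .
qed

lemma marginal_product_meas: "marginal_product f \<in> borel_measurable borel"
  by (rule marginal_product_measurable[OF f_meas])

lemma marginal_product_abs: "\<bar>marginal_product f x\<bar> \<le> M * M"
  using marginal_product_bounds(1,2)[OF f fM] by simp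

lemma marginal_product_out: "x \<notin> unit_cube \<Longrightarrow> marginal_product f x = 0"
  by (rule marginal_product_bounds(3)[OF f fM])

text \<open>With this, \<open>dev\<close> of a cell is the integral of the density minus the product
  of its marginals over that cell, which links the table to the L2 distance.\<close>

lemma marginal_product_bin:
  "(LINT x|lborel. indicator {x \<in> unit_cube. bin_label \<kappa> x = (k, l)} x * marginal_product f x) = Y_bin k * Z_bin l"
proof -
  have "(LINT x|lborel. indicator {x \<in> unit_cube. bin_label \<kappa> x = (k, l)} x * marginal_product f x) =
    (LINT y|lborel. LINT z|lborel. indicator {x \<in> unit_cube. bin_label \<kappa> x = (k, l)} (y, z) * marginal_product f (y, z))"
    using bounded_integrable[OF marginal_product_meas marginal_product_abs marginal_product_out bin_label_measurable, of \<kappa> "(k, l)"]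
    unfolding lborel_prod[symmetric] by (rule lborel_pair.integral_fst'[symmetric])
  also have "\<dots> = (LINT y|lborel. (indicator {y \<in> unit_cube. bin_index \<kappa> y = k} y * marginal_Y f y) *
    (LINT z|lborel. indicator {z \<in> unit_cube. bin_index \<kappa> z = l} z * marginal_Z f z))"
    unfolding bin_label_set
    by (subst Bochner_Integration.integral_mult_right_zero[symmetric]) (simp add: indicator_times marginal_product_def mult_ac)
  finally show ?thesis by (simp add: Y_bin_def Z_bin_def)
qed

lemma weight_nonneg: "0 \<le> weight c" by (simp add: weight_def)

lemma weight_le: "weight c \<le> M / real \<kappa> ^ (CARD('d1) + CARD('d2))"
proof -
  have "weight c \<le> (LINT x|lborel. M * indicator {x \<in> unit_cube. bin_label \<kappa> x = c} x)"
    unfolding weight_integral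
  proof (rule integral_mono)
    show "integrable lborel (\<lambda>x. indicator {x \<in> unit_cube. bin_label \<kappa> x = c} x * f x)"
      by (rule bounded_integrable[OF f_meas f_abs f_out bin_label_measurable])
    show "integrable lborel (\<lambda>x. M * indicator {x \<in> unit_cube. bin_label \<kappa> x = c} x)"
      by (intro integrable_mult_right bin_label_cell_volume(2)[OF \<kappa>])
    show "indicator {x \<in> unit_cube. bin_label \<kappa> x = c} x * f x \<le> M * indicator {x \<in> unit_cube. bin_label \<kappa> x = c} x" for x
      using fM[of x] by (simp add: indicator_def)
  qed
  also have "\<dots> \<le> M * (1 / real \<kappa> ^ (CARD('d1) + CARD('d2)))"
    unfolding Bochner_Integration.integral_mult_right_zero
    using M1 by (intro mult_left_mono bin_label_cell_volume(1)[OF \<kappa>]) auto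
  finally show ?thesis by simp
qed

lemma weight_sum: "sum weight (labels \<kappa> \<times> labels \<kappa>) = 1"
proof -
  have "sum weight (labels \<kappa> \<times> labels \<kappa>) = (\<Sum>k\<in>labels \<kappa>. Y_bin k)"
    unfolding Fubini_bins(1)[symmetric] by (simp add: sum.cartesian_product)
  also have "\<dots> = (LINT y|lborel. (\<Sum>k\<in>labels \<kappa>. indicator {y \<in> unit_cube. bin_index \<kappa> y = k} y * marginal_Y f y))"
    unfolding Y_bin_def
  proof (subst Bochner_Integration.integral_sum)
    note mb = marginal_bounds[OF f fM]
    have "\<bar>marginal_Y f y\<bar> \<le> M" for y using mb(1,2)[of y] by simp
    then show "integrable lborel (\<lambda>y. indicator {y \<in> unit_cube. bin_index \<kappa> y = k} y * marginal_Y f y)" for k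
      by (rule bounded_integrable[OF mb(7) _ mb(3) bin_index_measurable])
  qed simp
  also have "\<dots> = (LINT y|lborel. marginal_Y f y)"
  proof (rule Bochner_Integration.integral_cong[OF refl])
    fix y
    show "(\<Sum>k\<in>labels \<kappa>. indicator {y \<in> unit_cube. bin_index \<kappa> y = k} y * marginal_Y f y) = marginal_Y f y"
      unfolding sum_distrib_right[symmetric] indicator_labels[OF \<kappa>]
      using marginal_bounds(3)[OF f fM, of y] by (auto simp: indicator_def)
  qed
  also have "\<dots> = (LINT x|lborel. f x)"
    using joint_density_integrable(1)[OF f] unfolding marginal_Y_def lborel_prod[symmetric] by (rule lborel_pair.integral_fst')
  finally show ?thesis using joint_density_integrable(2)[OF f] by simp
qed

lemma table: "contingency_table (labels \<kappa>) (labels \<kappa>) weight"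
  by standard (auto simp: weight_nonneg weight_sum)

lemma row_eq: "contingency_table.row (labels \<kappa>) weight k = Y_bin k"
  by (simp add: contingency_table.row_def[OF table] Fubini_bins)

lemma col_eq: "contingency_table.col (labels \<kappa>) weight l = Z_bin l"
  by (simp add: contingency_table.col_def[OF table] Fubini_bins)

text \<open>A row sums the cell bound over all Z-bins, which cancels their number. For single cells
  M at least 1 is used: M is at most M^2, the numerator of \<open>a * b\<close>.\<close>

lemma bounded_table:
  "bounded_contingency_table (labels \<kappa>) (labels \<kappa>) weight (M / real \<kappa> ^ CARD('d1)) (M / real \<kappa> ^ CARD('d2))"
proof -
  interpret contingency_table "labels \<kappa>" "labels \<kappa>" weight by (rule table)
  have k0: "real \<kappa> > 0" using \<kappa> by simp
  show ?thesis
  proof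
    fix k :: "'d1 \<Rightarrow> int"
    have "row k \<le> (\<Sum>l\<in>(labels \<kappa> :: ('d2 \<Rightarrow> int) set). M / real \<kappa> ^ (CARD('d1) + CARD('d2)))"
      unfolding row_def by (intro sum_mono weight_le)
    then show "row k \<le> M / real \<kappa> ^ CARD('d1)"
      using k0 by (simp add: card_labels power_add)
  next
    fix l :: "'d2 \<Rightarrow> int"
    have "col l \<le> (\<Sum>k\<in>(labels \<kappa> :: ('d1 \<Rightarrow> int) set). M / real \<kappa> ^ (CARD('d1) + CARD('d2)))"
      unfolding col_def by (intro sum_mono weight_le)
    then show "col l \<le> M / real \<kappa> ^ CARD('d2)"
      using k0 by (simp add: card_labels power_add)
  next
    fix c
    have "weight c \<le> M / real \<kappa> ^ (CARD('d1) + CARD('d2))" by (rule weight_le)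
    also have "\<dots> \<le> M * M / real \<kappa> ^ (CARD('d1) + CARD('d2))"
      using M1 mult_right_mono[of 1 M M] by (intro divide_right_mono) auto
    finally show "weight c \<le> M / real \<kappa> ^ CARD('d1) * (M / real \<kappa> ^ CARD('d2))"
      by (simp add: power_add)
  qed (use M1 in auto)
qed

lemma event_le:
  assumes "\<And>X X'. (\<And>i. i \<in> {1..n} \<Longrightarrow> X i = X' i) \<Longrightarrow> \<Phi> X \<longleftrightarrow> \<Phi> X'"
  shows "emeasure (iid_sample n P) {X \<in> space (iid_sample n P). \<Phi> (\<lambda>i. bin_label \<kappa> (X i))}
    \<le> ennreal (sample_mean (labels \<kappa> \<times> labels \<kappa>) weight {1..n} (\<lambda>\<omega>. of_bool (\<Phi> \<omega>)))"
  unfolding weight_def[abs_def]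
proof (rule emeasure_label_event_le[OF P_prob _ _ _ _ assms])
  show "{x \<in> space P. bin_label \<kappa> x = c} \<in> sets P" for c by (simp add: P_space P_sets bin_label_all_measurable)
  let ?N = "{x \<in> space P. bin_label \<kappa> x \<notin> labels \<kappa> \<times> labels \<kappa>}"
  have N: "?N \<in> sets borel"
  proof -
    have "?N = UNIV - (\<Union>c\<in>labels \<kappa> \<times> labels \<kappa>. {x. bin_label \<kappa> x = c})" by (auto simp: P_space)
    also have "\<dots> \<in> sets borel" using bin_label_all_measurable by (intro sets.Diff sets.finite_UN) auto
    finally show ?thesis .
  qed
  have "emeasure P ?N = (\<integral>\<^sup>+x. ennreal (f x) * indicator ?N x \<partial>lborel)"
    unfolding P_density using N f_meas by (subst emeasure_density) (auto simp: P_space P_density)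
  also have "\<dots> = (\<integral>\<^sup>+x. 0 \<partial>(lborel :: ((real ^ 'd1) \<times> (real ^ 'd2)) measure))"
  proof (rule nn_integral_cong)
    fix x :: "(real ^ 'd1) \<times> (real ^ 'd2)"
    have "f x = 0" if "x \<in> ?N"
    proof (rule f_out)
      show "x \<notin> unit_cube" using that by (cases x) (auto simp: bin_label_def unit_cube_Pair bin_index_labels[OF \<kappa>])
    qed
    then show "ennreal (f x) * indicator ?N x = 0" by (auto simp: indicator_def)
  qed
  finally show "emeasure P ?N = 0" by simp
qed auto

text \<open>The map \<open>\<psi>\<close> only renames indices: functions on the basis of the
  product space become pairs of labels. Injectivity is enough, as further labels would add
  nonnegative terms.\<close>

lemma cells_le_dependence:
  "(\<Sum>c\<in>cells \<kappa>. (LINT x|lborel. indicator (cell \<kappa> c) x * (f x - marginal_product f x))\<^sup>2)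
    \<le> contingency_table.dependence (labels \<kappa>) (labels \<kappa>) weight"
proof -
  interpret contingency_table "labels \<kappa>" "labels \<kappa>" weight by (rule table)
  define \<psi> :: "((real ^ 'd1) \<times> (real ^ 'd2) \<Rightarrow> int) \<Rightarrow> ('d1 \<Rightarrow> int) \<times> ('d2 \<Rightarrow> int)"
    where "\<psi> c = (\<lambda>i. c (axis i 1, 0), \<lambda>i. c (0, axis i 1))" for c
  have basis: "b \<in> (Basis :: ((real ^ 'd1) \<times> (real ^ 'd2)) set) \<longleftrightarrow> (\<exists>i. b = (axis i 1, 0)) \<or> (\<exists>i. b = (0, axis i 1))" for b
    by (auto simp: Basis_prod_def Basis_vec_def)
  have ball_basis: "(\<forall>b\<in>(Basis :: ((real ^ 'd1) \<times> (real ^ 'd2)) set). Q b) \<longleftrightarrow>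
    (\<forall>i. Q (axis i 1, 0)) \<and> (\<forall>i. Q (0, axis i 1))" for Q
    unfolding Ball_def basis by blast
  have \<psi>_in: "\<psi> c \<in> labels \<kappa> \<times> labels \<kappa>" if "c \<in> cells \<kappa>" for c
  proof -
    have "(axis i 1, 0) \<in> (Basis :: ((real ^ 'd1) \<times> (real ^ 'd2)) set)"
      "(0, axis j 1) \<in> (Basis :: ((real ^ 'd1) \<times> (real ^ 'd2)) set)" for i j
      unfolding basis by blast+
    then show ?thesis using that by (auto simp: \<psi>_def labels_def cells_def PiE_iff)
  qed
  have inj: "inj_on \<psi> (cells \<kappa>)"
  proof (rule inj_onI)
    fix c c' assume c: "c \<in> cells \<kappa>" "c' \<in> cells \<kappa>" and eq: "\<psi> c = \<psi> c'"
    show "c = c'"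
    proof (rule PiE_ext[OF c[unfolded cells_def]])
      fix b :: "(real ^ 'd1) \<times> (real ^ 'd2)" assume "b \<in> Basis"
      then show "c b = c' b" using eq by (auto simp: \<psi>_def basis fun_eq_iff)
    qed
  qed
  have cell_label: "cell \<kappa> c = {x \<in> unit_cube. bin_label \<kappa> x = \<psi> c}" for c
    unfolding cell_def bin_label_def \<psi>_def
    by (intro Collect_cong conj_cong refl) (simp add: ball_basis prod_eq_iff fun_eq_iff bin_index_coord inner_prod_def inner_axis)
  have dev_integral: "(LINT x|lborel. indicator (cell \<kappa> c) x * (f x - marginal_product f x)) = dev (\<psi> c)" for c
  proof -
    obtain k l where kl: "\<psi> c = (k, l)" by fastforce
    have "(LINT x|lborel. indicator (cell \<kappa> c) x * (f x - marginal_product f x)) =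
      (LINT x|lborel. indicator (cell \<kappa> c) x * f x) - (LINT x|lborel. indicator (cell \<kappa> c) x * marginal_product f x)"
      unfolding right_diff_distrib
      by (intro Bochner_Integration.integral_diff bounded_integrable[OF f_meas f_abs f_out cell_measurable]
        bounded_integrable[OF marginal_product_meas marginal_product_abs marginal_product_out cell_measurable])
    also have "\<dots> = dev (\<psi> c)"
      unfolding cell_label kl marginal_product_bin weight_integral[symmetric] by (simp add: dev_def row_eq col_eq)
    finally show ?thesis .
  qed
  have "(\<Sum>c\<in>cells \<kappa>. (LINT x|lborel. indicator (cell \<kappa> c) x * (f x - marginal_product f x))\<^sup>2) = (\<Sum>x\<in>\<psi> ` cells \<kappa>. (dev x)\<^sup>2)"
    unfolding dev_integral by (simp add: sum.reindex[OF inj])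
  also have "\<dots> \<le> (\<Sum>x\<in>labels \<kappa> \<times> labels \<kappa>. (dev x)\<^sup>2)"
    by (intro sum_mono2 image_subsetI \<psi>_in) auto
  finally show ?thesis by (simp add: dependence_def)
qed

end

subsection \<open>The two error bounds\<close>

text \<open>The definitions of the null and of the alternative quantify over a version of the
  density that need not be the Hoelder version. Almost everywhere equality passes to the marginals
  by Fubini and from there to their product.\<close>

lemma joint_density_unique:
  fixes f f' :: "'a::euclidean_space \<times> 'b::euclidean_space \<Rightarrow> real"
  assumes f: "joint_density P f" and f': "joint_density P f'"
  shows "AE x in lborel. f x = f' x" "AE x in lborel. marginal_product f x = marginal_product f' x"
proof -
  have meas: "f \<in> borel_measurable borel" "f' \<in> borel_measurable borel"
    and nn: "\<And>x. 0 \<le> f x" "\<And>x. 0 \<le> f' x"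
    and d: "density lborel (\<lambda>x. ennreal (f x)) = density lborel (\<lambda>x. ennreal (f' x))"
    using f f' unfolding joint_density_def by auto
  have meas2: "f \<in> borel_measurable (lborel \<Otimes>\<^sub>M lborel)" "f' \<in> borel_measurable (lborel \<Otimes>\<^sub>M lborel)"
    using meas by (simp_all add: lborel_prod)
  have "AE x in lborel. ennreal (f x) = ennreal (f' x)"
    using d meas by (subst (asm) sigma_finite_measure.density_unique_iff[OF sigma_finite_lborel]) auto
  then show ae: "AE x in lborel. f x = f' x"
    by eventually_elim (use nn in auto)
  from ae have ae2: "AE x in lborel \<Otimes>\<^sub>M lborel. f x = f' x" unfolding lborel_prod .
  have Y: "AE y in lborel. marginal_Y f y = marginal_Y f' y"
    using lborel_pair.AE_pair[OF ae2]
  proof eventually_elim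
    case (elim y)
    have "(\<lambda>z. f (y, z)) \<in> borel_measurable lborel" "(\<lambda>z. f' (y, z)) \<in> borel_measurable lborel"
      using meas2 by (auto intro: measurable_compose[OF measurable_Pair1'])
    with elim show ?case unfolding marginal_Y_def by (intro integral_cong_AE) auto
  qed
  have swapped: "AE z in lborel. AE y in lborel. f (y, z) = f' (y, z)"
  proof -
    have "{x \<in> space (lborel \<Otimes>\<^sub>M lborel). f (fst x, snd x) = f' (fst x, snd x)} \<in> sets (lborel \<Otimes>\<^sub>M lborel)"
      unfolding prod.collapse using meas2 by measurable
    from lborel_pair.AE_commute[OF this] lborel_pair.AE_pair[OF ae2] show ?thesis by blast
  qed
  then have Z: "AE z in lborel. marginal_Z f z = marginal_Z f' z"
  proof eventually_elim
    case (elim z)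
    have "(\<lambda>y. f (y, z)) \<in> borel_measurable lborel" "(\<lambda>y. f' (y, z)) \<in> borel_measurable lborel"
      using meas2 by (auto intro: measurable_compose[OF measurable_Pair2'])
    with elim show ?case unfolding marginal_Z_def by (intro integral_cong_AE) auto
  qed
  have "AE x in lborel \<Otimes>\<^sub>M lborel. marginal_product f x = marginal_product f' x"
  proof (rule lborel_pair.AE_pair_measure)
    show "{x \<in> space (lborel \<Otimes>\<^sub>M lborel). marginal_product f x = marginal_product f' x} \<in> sets (lborel \<Otimes>\<^sub>M lborel)"
    proof -
      have [measurable]: "marginal_product f \<in> borel_measurable (lborel \<Otimes>\<^sub>M lborel)"
        "marginal_product f' \<in> borel_measurable (lborel \<Otimes>\<^sub>M lborel)"
        using marginal_product_measurable[OF meas(1)] marginal_product_measurable[OF meas(2)]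
        by (simp_all add: lborel_prod)
      show ?thesis by measurable
    qed
    show "AE y in lborel. AE z in lborel. marginal_product f (y, z) = marginal_product f' (y, z)"
      using Y
    proof eventually_elim
      case (elim y)
      from Z show ?case by eventually_elim (simp add: marginal_product_def elim)
    qed
  qed
  then show "AE x in lborel. marginal_product f x = marginal_product f' x" unfolding lborel_prod .
qed

lemma L2_norm_unique:
  fixes f f' :: "'a::euclidean_space \<times> 'b::euclidean_space \<Rightarrow> real"
  assumes f: "joint_density P f" and f': "joint_density P f'"
  shows "L2_norm (\<lambda>x. f x - marginal_product f x) = L2_norm (\<lambda>x. f' x - marginal_product f' x)"
proof -
  have meas: "f \<in> borel_measurable borel" "f' \<in> borel_measurable borel"
    using f f' unfolding joint_density_def by auto
  have "AE x in lborel. (f x - marginal_product f x)\<^sup>2 = (f' x - marginal_product f' x)\<^sup>2"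
    using joint_density_unique[OF f f'] by eventually_elim simp
  then show ?thesis
    unfolding L2_norm_def using meas marginal_product_measurable[OF meas(1)] marginal_product_measurable[OF meas(2)]
    by (intro arg_cong[where f = sqrt] integral_cong_AE) auto
qed

section \<open>Choice of the constants and of the number of bins\<close>

text \<open>C^2 has two parts: C2 * 4^s absorbs the bias, and 2 C1 A then forces \<kappa>^D \<theta>
  to be at least A times the squared rate, with the \<alpha> and \<beta> factors. A is such that
  each of the three error terms, before the factor 10^6 M^2, is at most \<beta> / A; together they
  make exactly \<beta>.\<close>

lemma error_budget:
  fixes D n \<kappa> :: nat and s \<alpha> \<beta> \<epsilon> C1 C2 M A C \<theta> L2 :: real
  assumes "n \<ge> 1" "0 < s" "0 < \<alpha>" "\<alpha> < 1" "0 < \<beta>" "\<beta> < 1" "0 < C1" "0 < C2" "1 \<le> M"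
    and A: "A = 3 * 10 ^ 6 * M\<^sup>2"
    and C: "C = sqrt (2 * C1 * A + C2 * 4 powr s)"
    and \<kappa>: "\<kappa> = nat \<lfloor>real n powr (2 / (4 * s + real D))\<rfloor>"
    and \<epsilon>: "\<epsilon> \<ge> C / (\<alpha> powr (1/4) * \<beta> powr (1/2)) * (1 / real n) powr (2 * s / (4 * s + real D))"
    and L2: "\<epsilon>\<^sup>2 \<le> L2" "L2 \<le> C1 * real \<kappa> ^ D * \<theta> + C2 * real \<kappa> powr (- 2 * s)"
  shows "0 < \<theta>" and "10 ^ 6 * (M\<^sup>2 / real \<kappa> ^ D) * (1 / (real n * \<theta>) + 1 / (real n * \<theta>)\<^sup>2 + 1 / (\<alpha> * (real n * \<theta>)\<^sup>2)) \<le> \<beta>"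
proof -
  define \<gamma> where "\<gamma> = 4 * s + real D"
  have \<gamma>: "0 < \<gamma>" using assms(2) by (simp add: \<gamma>_def add_pos_nonneg)
  define t where "t = real n powr (2 / \<gamma>)"
  \<comment> \<open>The squared rate, which equals t^(-2s), the squared bias for t bins per axis;
    \<open>r\<close> collects the squared factors of \<alpha> and \<beta> in the separation.\<close>
  define \<rho> where "\<rho> = real n powr (- (4 * s / \<gamma>))"
  define r where "r = 1 / (sqrt \<alpha> * \<beta>)"
  have n: "1 \<le> real n" using assms(1) by simp
  have t1: "1 \<le> t" unfolding t_def using n \<gamma> by (intro ge_one_powr_ge_zero) auto
  have \<kappa>t: "real \<kappa> = of_int \<lfloor>t\<rfloor>" using t1 by (simp add: \<kappa> t_def \<gamma>_def)
  have \<kappa>1: "1 \<le> real \<kappa>" "real \<kappa> \<le> t" "t / 2 \<le> real \<kappa>"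
  proof -
    have "1 \<le> \<lfloor>t\<rfloor>" using t1 by simp
    then show "1 \<le> real \<kappa>" unfolding \<kappa>t by linarith
    then show "real \<kappa> \<le> t" "t / 2 \<le> real \<kappa>" unfolding \<kappa>t by linarith+
  qed
  have \<rho>0: "0 < \<rho>" using n by (simp add: \<rho>_def)
  have sa: "0 < sqrt \<alpha>" "sqrt \<alpha> \<le> 1" using assms(3,4) by auto
  have "sqrt \<alpha> * \<beta> \<le> 1 * 1" using sa assms(5,6) by (intro mult_mono) auto
  then have r1: "1 \<le> r" using sa assms(5) by (simp add: r_def le_divide_eq)
  have A1: "1 \<le> A" unfolding A using one_le_power[OF assms(9), of 2] by simp
  \<comment> \<open>Rounding down loses at most a factor 2, since t is at least 1; in the bias this
    becomes 2^(2s) = 4^s.\<close>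
  have bias: "real \<kappa> powr (- 2 * s) \<le> 4 powr s * \<rho>"
  proof -
    have "real \<kappa> powr (- 2 * s) \<le> (t / 2) powr (- 2 * s)"
      using \<kappa>1 t1 assms(2) by (intro powr_mono2') auto
    also have "\<dots> = t powr (- 2 * s) * 2 powr (2 * s)"
      using t1 by (simp add: powr_divide powr_minus_divide)
    also have "2 powr (2 * s) = 4 powr s"
      using powr_powr[of 2 2 s] by simp
    also have "t powr (- 2 * s) = \<rho>" unfolding t_def \<rho>_def powr_powr by simp
    finally show ?thesis by (simp add: mult.commute)
  qed
  have C2': "C\<^sup>2 = 2 * C1 * A + C2 * 4 powr s"
    unfolding C using assms(7,8) A1 by (intro real_sqrt_pow2 add_nonneg_nonneg) auto
  have C0: "0 \<le> C" unfolding C using assms(7,8) A1 by (intro real_sqrt_ge_zero add_nonneg_nonneg) auto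
  have eps: "C\<^sup>2 * (\<rho> * r) \<le> \<epsilon>\<^sup>2"
  proof -
    let ?e = "C / (\<alpha> powr (1/4) * \<beta> powr (1/2)) * (1 / real n) powr (2 * s / \<gamma>)"
    have "?e\<^sup>2 \<le> \<epsilon>\<^sup>2" using \<epsilon> C0 by (intro power_mono) (auto simp: \<gamma>_def)
    moreover have "(\<alpha> powr (1/4))\<^sup>2 = sqrt \<alpha>"
      using assms(3) by (simp add: power2_eq_square powr_add[symmetric] powr_half_sqrt)
    moreover have "(\<beta> powr (1/2))\<^sup>2 = \<beta>"
      using assms(5) by (simp add: powr_half_sqrt)
    moreover have "((1 / real n) powr (2 * s / \<gamma>))\<^sup>2 = \<rho>"
    proof -
      have "((1 / real n) powr (2 * s / \<gamma>))\<^sup>2 = (1 / real n) powr (4 * s / \<gamma>)"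
        by (simp add: power2_eq_square powr_add[symmetric])
      then show ?thesis using n by (simp add: \<rho>_def powr_divide powr_minus_divide)
    qed
    ultimately show ?thesis by (simp add: power_mult_distrib power_divide r_def)
  qed
  define T where "T = A * (\<rho> * r)"
  have T0: "0 < T" using A1 \<rho>0 r1 by (simp add: T_def)
  define N where "N = real \<kappa> ^ D"
  have N1: "1 \<le> N" using \<kappa>1 by (simp add: N_def)
  have "C1 * (2 * T) \<le> C1 * (N * \<theta>)"
  proof -
    have "C2 * real \<kappa> powr (- 2 * s) \<le> C2 * (4 powr s * \<rho>)" using bias assms(8) by (intro mult_left_mono) auto
    also have "\<dots> \<le> C2 * 4 powr s * (\<rho> * r)"
      using mult_left_mono[OF r1, of "C2 * 4 powr s * \<rho>"] \<rho>0 assms(8) by (simp add: mult_ac)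
    finally have "C\<^sup>2 * (\<rho> * r) \<le> C1 * N * \<theta> + C2 * 4 powr s * (\<rho> * r)"
      using eps L2 by (simp add: N_def)
    then show ?thesis unfolding C2' T_def by (simp add: algebra_simps)
  qed
  then have NT: "T \<le> N * \<theta>" using assms(7) T0 by simp
  then have "0 < N * \<theta>" using T0 by linarith
  then show \<theta>0: "0 < \<theta>" using N1 by (simp add: zero_less_mult_iff)
  define x where "x = real n * T"
  have x0: "0 < x" using n T0 by (simp add: x_def)
  have nt: "x / N \<le> real n * \<theta>"
    using mult_left_mono[OF NT, of "real n"] N1 n by (simp add: x_def divide_le_eq mult_ac)
  \<comment> \<open>The balance behind the choice of \<kappa>: n \<rho> = n^(D/\<gamma>) = t^(D/2),
    so N is at most (n \<rho>)^2. The stochastic threshold for N \<theta>, of order N^(1/2) / n, is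
    therefore at most of the order of the squared bias.\<close>
  have n\<rho>: "1 \<le> real n * \<rho>" "N \<le> (real n * \<rho>)\<^sup>2"
  proof -
    have e: "real n * \<rho> = real n powr (real D / \<gamma>)"
    proof -
      have "real n * \<rho> = real n powr (1 + - (4 * s / \<gamma>))" unfolding \<rho>_def powr_add using n by simp
      also have "1 + - (4 * s / \<gamma>) = real D / \<gamma>" using \<gamma> by (simp add: \<gamma>_def field_simps)
      finally show ?thesis .
    qed
    show "1 \<le> real n * \<rho>" unfolding e using n \<gamma> by (intro ge_one_powr_ge_zero) auto
    have "N \<le> t ^ D" unfolding N_def using \<kappa>1 by (intro power_mono) auto
    also have "\<dots> = real n powr (2 / \<gamma> * real D)"     proof -
      have "t ^ D = t powr real D" using t1 by (simp add: powr_realpow)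
      then show ?thesis by (simp only: t_def powr_powr)
    qed
    also have "\<dots> = (real n * \<rho>)\<^sup>2" unfolding e by (simp add: power2_eq_square powr_add[symmetric])
    finally show "N \<le> (real n * \<rho>)\<^sup>2" .
  qed
  have xr: "A * r \<le> x" "N * (A * r)\<^sup>2 \<le> x\<^sup>2"
  proof -
    have x: "x = real n * \<rho> * (A * r)" by (simp add: x_def T_def)
    show "A * r \<le> x" unfolding x using mult_right_mono[OF n\<rho>(1), of "A * r"] A1 r1 by simp
    show "N * (A * r)\<^sup>2 \<le> x\<^sup>2" unfolding x power_mult_distrib[of "real n * \<rho>"] using n\<rho>(2) by (rule mult_right_mono) simp
  qed
  have Ar: "0 < A * r" using A1 r1 by simp
  have pos: "0 < real n * \<theta>" "0 < x / N" using \<theta>0 n x0 N1 by auto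
  have ineq1: "1 / N * (1 / (real n * \<theta>)) \<le> 1 / (A * r)"
  proof -
    have "1 / (real n * \<theta>) \<le> 1 / (x / N)" by (intro divide_left_mono mult_pos_pos[OF pos] nt) auto
    from mult_left_mono[OF this, of "1 / N"] have "1 / N * (1 / (real n * \<theta>)) \<le> 1 / x" using N1 by simp
    also have "\<dots> \<le> 1 / (A * r)" using xr(1) Ar x0 by (intro divide_left_mono) auto
    finally show ?thesis .
  qed
  have ineq2: "1 / N * (1 / (real n * \<theta>)\<^sup>2) \<le> 1 / (A * r)\<^sup>2"
  proof -
    have "(x / N)\<^sup>2 \<le> (real n * \<theta>)\<^sup>2" using nt x0 N1 by (intro power_mono) auto
    then have "1 / (real n * \<theta>)\<^sup>2 \<le> 1 / (x / N)\<^sup>2" by (intro divide_left_mono mult_pos_pos[OF zero_less_power[OF pos(1)] zero_less_power[OF pos(2)]]) auto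
    from mult_left_mono[OF this, of "1 / N"] have "1 / N * (1 / (real n * \<theta>)\<^sup>2) \<le> 1 / N * (1 / (x / N)\<^sup>2)" using N1 by simp
    also have "\<dots> = N / x\<^sup>2" using N1 by (simp add: power2_eq_square)
    also have "\<dots> \<le> 1 / (A * r)\<^sup>2"     proof -
      define y where "y = (A * r)\<^sup>2"
      have "0 < y" "0 < x\<^sup>2" unfolding y_def by (rule zero_less_power[OF Ar], rule zero_less_power[OF x0])
      moreover have "N * y \<le> x\<^sup>2" using xr(2) by (simp add: y_def)
      ultimately show ?thesis unfolding y_def[symmetric] by (simp add: field_simps)
    qed
    finally show ?thesis .
  qed
  have b1: "1 / (A * r) \<le> \<beta> / A"
  proof -
    have "1 / r = sqrt \<alpha> * \<beta>" by (simp add: r_def)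
    also have "\<dots> \<le> 1 * \<beta>" using sa assms(5) by (intro mult_right_mono) auto
    finally have "1 / r / A \<le> \<beta> / A" using A1 by (intro divide_right_mono) auto
    then show ?thesis by (simp add: mult.commute)
  qed
  \<comment> \<open>This term dictates the power of \<alpha>: \<alpha> r^2 = \<beta>^(-2), so
    \<alpha> cancels exactly. The other two terms have room to spare in \<alpha>.\<close>
  have b2: "1 / (\<alpha> * (A * r)\<^sup>2) \<le> \<beta> / A"
  proof -
    have "1 / (\<alpha> * (A * r)\<^sup>2) = \<beta>\<^sup>2 / A\<^sup>2"
      using sa assms(3,5) A1 by (simp add: r_def power_mult_distrib power_divide)
    also have "\<dots> = (\<beta> / A) * (\<beta> / A)" by (simp add: power2_eq_square)
    also have "\<dots> \<le> (\<beta> / A) * 1" using assms(5,6) A1 by (intro mult_left_mono) auto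
    finally show ?thesis by simp
  qed
  have b3: "1 / (A * r)\<^sup>2 \<le> \<beta> / A"
  proof -
    have "\<alpha> * (A * r)\<^sup>2 \<le> 1 * (A * r)\<^sup>2" using assms(4) by (intro mult_right_mono) auto
    then have "1 / (A * r)\<^sup>2 \<le> 1 / (\<alpha> * (A * r)\<^sup>2)" using assms(3) zero_less_power[OF Ar, of 2] by (intro divide_left_mono mult_pos_pos) auto
    then show ?thesis using b2 by linarith
  qed
  have "1 / N * (1 / (\<alpha> * (real n * \<theta>)\<^sup>2)) \<le> \<beta> / A"
  proof -
    have "1 / N * (1 / (\<alpha> * (real n * \<theta>)\<^sup>2)) = 1 / \<alpha> * (1 / N * (1 / (real n * \<theta>)\<^sup>2))" by simp
    also have "\<dots> \<le> 1 / \<alpha> * (1 / (A * r)\<^sup>2)" using ineq2 assms(3) by (intro mult_left_mono) auto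
    also have "\<dots> \<le> \<beta> / A" using b2 by simp
    finally show ?thesis .
  qed
  then have "1 / N * (1 / (real n * \<theta>)) + 1 / N * (1 / (real n * \<theta>)\<^sup>2) + 1 / N * (1 / (\<alpha> * (real n * \<theta>)\<^sup>2)) \<le> 3 * (\<beta> / A)"
    using ineq1 ineq2 b1 b3 by linarith
  then have "10 ^ 6 * M\<^sup>2 * (1 / N * (1 / (real n * \<theta>)) + 1 / N * (1 / (real n * \<theta>)\<^sup>2) + 1 / N * (1 / (\<alpha> * (real n * \<theta>)\<^sup>2)))
    \<le> 10 ^ 6 * M\<^sup>2 * (3 * (\<beta> / A))" by (intro mult_left_mono) auto
  also have "\<dots> = \<beta>" using assms(9) by (simp add: A)
  also have "10 ^ 6 * M\<^sup>2 * (1 / N * (1 / (real n * \<theta>)) + 1 / N * (1 / (real n * \<theta>)\<^sup>2) + 1 / N * (1 / (\<alpha> * (real n * \<theta>)\<^sup>2))) =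
    10 ^ 6 * (M\<^sup>2 / N) * (1 / (real n * \<theta>) + 1 / (real n * \<theta>)\<^sup>2 + 1 / (\<alpha> * (real n * \<theta>)\<^sup>2))"
    by (simp only: distrib_left) (simp only: times_divide_eq_left times_divide_eq_right mult_1_left mult_1_right)
  finally show "10 ^ 6 * (M\<^sup>2 / real \<kappa> ^ D) * (1 / (real n * \<theta>) + 1 / (real n * \<theta>)\<^sup>2 + 1 / (\<alpha> * (real n * \<theta>)\<^sup>2)) \<le> \<beta>"
    by (simp only: N_def)
qed

text \<open>The version witnessing independence makes the Hoelder version factorise almost
  everywhere, hence all cell probabilities factorise. Smoothness enters only through the bound M,
  which makes the bin integrals available.\<close>

lemma prob_reject_le:
  fixes P :: "((real ^ 'd1::finite) \<times> (real ^ 'd2::finite)) measure"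
  assumes P: "P \<in> null_distributions s L" and s: "0 < s" "0 < L" and \<alpha>: "0 < \<alpha>" "\<alpha> < 1" and \<kappa>: "1 \<le> \<kappa>"
  shows "prob_reject \<kappa> n \<alpha> P \<le> ennreal \<alpha>"
proof -
  obtain f0 where f0: "joint_density P f0" "f0 = marginal_product f0"
    using P unfolding null_distributions_def by blast
  obtain f where f: "joint_density P f" "f \<in> holder_class s L"
    using P unfolding null_distributions_def holder_distributions_def by blast
  define M where "M = 1 + real DIM((real ^ 'd1) \<times> (real ^ 'd2)) * L"
  have fM: "f x \<le> M" for x using density_bounded[OF f s] by (simp add: M_def)
  have M1: "1 \<le> M" using s by (simp add: M_def)
  note facts = f(1) fM M1 \<kappa>
  have indep: "AE x in lborel. f x = marginal_product f x"
    using joint_density_unique[OF f0(1) f(1)] by eventually_elim (use f0(2) in metis)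
  have product: "weight P \<kappa> (k, l) = Y_bin f \<kappa> k * Z_bin f \<kappa> l" for k l
  proof -
    have "weight P \<kappa> (k, l) = (LINT x|lborel. indicator {x \<in> unit_cube. bin_label \<kappa> x = (k, l)} x * marginal_product f x)"
      unfolding weight_integral[OF facts]
    proof (rule integral_cong_AE)
      show "AE x in lborel. indicator {x \<in> unit_cube. bin_label \<kappa> x = (k, l)} x * f x =
        indicator {x \<in> unit_cube. bin_label \<kappa> x = (k, l)} x * marginal_product f x"
        using indep by eventually_elim simp
    qed (unfold measurable_lborel2, (intro borel_measurable_times borel_measurable_indicator
        bin_label_measurable f_meas[OF facts] marginal_product_meas[OF facts])+)
    then show ?thesis by (simp only: marginal_product_bin[OF facts])
  qed
  interpret contingency_table "labels \<kappa>" "labels \<kappa>" "weight P \<kappa>" by (rule table[OF facts])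
  have cong: "label_U n X > label_crit n \<alpha> X \<longleftrightarrow> label_U n X' > label_crit n \<alpha> X'"
    if "\<And>i. i \<in> {1..n} \<Longrightarrow> X i = X' i" for X X' :: "nat \<Rightarrow> ('d1 \<Rightarrow> int) \<times> ('d2 \<Rightarrow> int)"
    using label_U_cong[of n X X'] label_crit_cong[of n X X' \<alpha>] that by simp
  have "prob_reject \<kappa> n \<alpha> P \<le> ennreal (E {1..n} (\<lambda>\<omega>. of_bool (label_U n \<omega> > label_crit n \<alpha> \<omega>)))"
    unfolding prob_reject_def U_stat_label crit_value_label by (rule event_le[OF facts cong])
  also have "\<dots> \<le> ennreal \<alpha>"
    by (intro ennreal_leI type_I_error[OF product \<alpha>])
  finally show ?thesis .
qed

lemma prob_accept_le:
  fixes P :: "((real ^ 'd1::finite) \<times> (real ^ 'd2::finite)) measure"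
  assumes f: "joint_density P f" and fM: "\<And>x. f x \<le> M" and M1: "1 \<le> M" and \<kappa>: "1 \<le> \<kappa>"
    and "n \<ge> 4" "0 < \<alpha>" "\<alpha> < 1"
  defines "\<theta> \<equiv> contingency_table.dependence (labels \<kappa>) (labels \<kappa>) (weight P \<kappa>)"
  assumes "0 < \<theta>"
  shows "prob_accept \<kappa> n \<alpha> P \<le> ennreal (10 ^ 6 * (M\<^sup>2 / real \<kappa> ^ (CARD('d1) + CARD('d2))) *
    (1 / (real n * \<theta>) + 1 / (real n * \<theta>)\<^sup>2 + 1 / (\<alpha> * (real n * \<theta>)\<^sup>2)))"
proof -
  note facts = f fM M1 \<kappa>
  interpret bounded_contingency_table "labels \<kappa>" "labels \<kappa>" "weight P \<kappa>" "M / real \<kappa> ^ CARD('d1)" "M / real \<kappa> ^ CARD('d2)"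
    by (rule bounded_table[OF facts])
  have ab: "M / real \<kappa> ^ CARD('d1) * (M / real \<kappa> ^ CARD('d2)) = M\<^sup>2 / real \<kappa> ^ (CARD('d1) + CARD('d2))"
    by (simp add: power_add power2_eq_square)
  have cong: "label_U n X \<le> label_crit n \<alpha> X \<longleftrightarrow> label_U n X' \<le> label_crit n \<alpha> X'"
    if "\<And>i. i \<in> {1..n} \<Longrightarrow> X i = X' i" for X X' :: "nat \<Rightarrow> ('d1 \<Rightarrow> int) \<times> ('d2 \<Rightarrow> int)"
    using label_U_cong[of n X X'] label_crit_cong[of n X X' \<alpha>] that by simp
  have "prob_accept \<kappa> n \<alpha> P \<le> ennreal (E {1..n} (\<lambda>\<omega>. of_bool (label_U n \<omega> \<le> label_crit n \<alpha> \<omega>)))"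
    unfolding prob_accept_def U_stat_label crit_value_label by (rule event_le[OF facts cong])
  also have "\<dots> \<le> ennreal (10 ^ 6 * (M\<^sup>2 / real \<kappa> ^ (CARD('d1) + CARD('d2))) *
    (1 / (real n * \<theta>) + 1 / (real n * \<theta>)\<^sup>2 + 1 / (\<alpha> * (real n * \<theta>)\<^sup>2)))"
    using type_II_error[OF assms(5-7)] assms(9) unfolding \<theta>_def ab by (intro ennreal_leI)
  finally show ?thesis .
qed

theorem proposition5p5:
  fixes s L :: real
  assumes "s > 0" and "L > 0"
  shows "\<exists>C>0. \<forall>n::nat. \<forall>\<alpha> \<beta> \<epsilon> :: real.
    n \<ge> 4 \<longrightarrow> 0 < \<alpha> \<longrightarrow> \<alpha> < 1 \<longrightarrow> 0 < \<beta> \<longrightarrow> \<beta> < 1 - \<alpha> \<longrightarrow>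
    \<epsilon> \<ge> C / (\<alpha> powr (1/4) * \<beta> powr (1/2))
          * (1 / real n) powr (2 * s / (4 * s + real CARD('d1::finite) + real CARD('d2::finite))) \<longrightarrow>
    (let \<kappa> = nat \<lfloor>real n powr (2 / (4 * s + real CARD('d1) + real CARD('d2)))\<rfloor> in
      (SUP P \<in> (null_distributions s L :: ((real ^ 'd1) \<times> (real ^ 'd2)) measure set).
         prob_reject \<kappa> n \<alpha> P) \<le> ennreal \<alpha> \<and>
      (SUP P \<in> (alt_distributions s L \<epsilon> :: ((real ^ 'd1) \<times> (real ^ 'd2)) measure set).
         prob_accept \<kappa> n \<alpha> P) \<le> ennreal \<beta>)"
proof -
  define D where "D = CARD('d1) + CARD('d2)"
  have dim: "DIM((real ^ 'd1) \<times> (real ^ 'd2)) = D" by (simp add: D_def)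
  obtain C1 C2 where C12: "0 < C1" "0 < C2"
    and L2: "\<And>\<kappa> P. \<And>f :: (real ^ 'd1) \<times> (real ^ 'd2) \<Rightarrow> real. 1 \<le> \<kappa> \<Longrightarrow>
      joint_density P f \<Longrightarrow> f \<in> holder_class s L \<Longrightarrow> marginal_product f \<in> holder_class s L \<Longrightarrow>
      (L2_norm (\<lambda>x. f x - marginal_product f x))\<^sup>2 \<le> C1 * real \<kappa> ^ D *
        (\<Sum>c\<in>cells \<kappa>. (LINT x|lborel. indicator (cell \<kappa> c) x * (f x - marginal_product f x))\<^sup>2)
      + C2 * real \<kappa> powr (- 2 * s)"
    using L2_dependence_le_cells[OF assms, where 'a = "real ^ 'd1" and 'b = "real ^ 'd2"] unfolding dim by blast
  define M where "M = 1 + real D * L"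
  define A where "A = 3 * 10 ^ 6 * M\<^sup>2"
  define C where "C = sqrt (2 * C1 * A + C2 * 4 powr s)"
  have M1: "1 \<le> M" using assms by (simp add: M_def)
  have C0: "0 < C" unfolding C_def A_def using C12 M1 by (intro real_sqrt_gt_zero add_nonneg_pos) auto
  show ?thesis
  proof (intro exI[of _ C] conjI C0 allI impI)
    fix n :: nat and \<alpha> \<beta> \<epsilon> :: real
    assume n: "4 \<le> n" and \<alpha>: "0 < \<alpha>" "\<alpha> < 1" and \<beta>: "0 < \<beta>" "\<beta> < 1 - \<alpha>"
      and \<epsilon>: "C / (\<alpha> powr (1/4) * \<beta> powr (1/2))
          * (1 / real n) powr (2 * s / (4 * s + real CARD('d1) + real CARD('d2))) \<le> \<epsilon>"
    define \<kappa> where "\<kappa> = nat \<lfloor>real n powr (2 / (4 * s + real D))\<rfloor>"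
    have D: "4 * s + real CARD('d1) + real CARD('d2) = 4 * s + real D" by (simp add: D_def)
    have "1 \<le> real n powr (2 / (4 * s + real D))"
      using n assms by (intro ge_one_powr_ge_zero) auto
    then have "1 \<le> \<lfloor>real n powr (2 / (4 * s + real D))\<rfloor>" by simp
    then have \<kappa>: "1 \<le> \<kappa>" unfolding \<kappa>_def by linarith
    \<comment> \<open>Needed to square the separation condition.\<close>
    have \<epsilon>0: "0 \<le> \<epsilon>" using \<epsilon> C0 by (rule_tac order_trans[rotated]) auto
    have accept: "prob_accept \<kappa> n \<alpha> P \<le> ennreal \<beta>"
      if P: "P \<in> (alt_distributions s L \<epsilon> :: ((real ^ 'd1) \<times> (real ^ 'd2)) measure set)" for P
    proof -
      obtain f where f: "joint_density P f" "f \<in> holder_class s L" "marginal_product f \<in> holder_class s L"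
        using P unfolding alt_distributions_def holder_distributions_def by blast
      \<comment> \<open>\<open>f\<close> witnesses the smoothness and \<open>f'\<close> the
        separation; both are densities of P, so the two L2 distances agree.\<close>
      obtain f' where f': "joint_density P f'" "\<epsilon> \<le> L2_norm (\<lambda>x. f' x - marginal_product f' x)"
        using P unfolding alt_distributions_def by blast
      have fM: "f x \<le> M" for x using density_bounded[OF f(1,2) assms] unfolding dim M_def .
      define \<theta> where "\<theta> = contingency_table.dependence (labels \<kappa>) (labels \<kappa>) (weight P \<kappa>)"
      define l where "l = (L2_norm (\<lambda>x. f x - marginal_product f x))\<^sup>2"
      have "\<epsilon>\<^sup>2 \<le> l"
        using f'(2) \<epsilon>0 unfolding l_def L2_norm_unique[OF f(1) f'(1)] by (intro power_mono)
      moreover have "l \<le> C1 * real \<kappa> ^ D * \<theta> + C2 * real \<kappa> powr (- 2 * s)"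
      proof -
        have "l \<le> C1 * real \<kappa> ^ D *
            (\<Sum>c\<in>cells \<kappa>. (LINT x|lborel. indicator (cell \<kappa> c) x * (f x - marginal_product f x))\<^sup>2)
          + C2 * real \<kappa> powr (- 2 * s)" unfolding l_def by (rule L2[OF \<kappa> f])
        also have "\<dots> \<le> C1 * real \<kappa> ^ D * \<theta> + C2 * real \<kappa> powr (- 2 * s)"
          unfolding \<theta>_def using C12(1)
          by (intro add_right_mono mult_left_mono cells_le_dependence[OF f(1) fM M1 \<kappa>]) auto
        finally show ?thesis .
      qed
      moreover have "1 \<le> n" "\<beta> < 1" using n \<alpha> \<beta> by auto
      ultimately have budget: "0 < \<theta>"
        "10 ^ 6 * (M\<^sup>2 / real \<kappa> ^ D) * (1 / (real n * \<theta>) + 1 / (real n * \<theta>)\<^sup>2 + 1 / (\<alpha> * (real n * \<theta>)\<^sup>2)) \<le> \<beta>"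
        using error_budget[of n s \<alpha> \<beta> C1 C2 M A C \<kappa> D \<epsilon> l \<theta>] assms \<alpha> \<beta> C12 M1 A_def C_def \<kappa>_def \<epsilon>[unfolded D]
        by blast+
      show ?thesis
        using prob_accept_le[OF f(1) fM M1 \<kappa> n \<alpha> budget(1)[unfolded \<theta>_def]] ennreal_leI[OF budget(2)]
        unfolding \<theta>_def D_def by (rule order_trans)
    qed
    show "let \<kappa> = nat \<lfloor>real n powr (2 / (4 * s + real CARD('d1) + real CARD('d2)))\<rfloor> in
      (SUP P \<in> (null_distributions s L :: ((real ^ 'd1) \<times> (real ^ 'd2)) measure set).
         prob_reject \<kappa> n \<alpha> P) \<le> ennreal \<alpha> \<and>
      (SUP P \<in> (alt_distributions s L \<epsilon> :: ((real ^ 'd1) \<times> (real ^ 'd2)) measure set).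
         prob_accept \<kappa> n \<alpha> P) \<le> ennreal \<beta>"
      unfolding D \<kappa>_def[symmetric] Let_def
      by (intro conjI SUP_least accept prob_reject_le[OF _ assms \<alpha> \<kappa>])
  qed
qed

end
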